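(* Let $H$ be a Hopf algebra over a field $\mathbb F$ with invertible antipode $S$ and with a Hopf pairing $\varphi$. There exists an isomorphism of Hopf algebras $$\Phi^{\mathtt D}:D(H)\to(H\otimes H)^\imath,\qquad a\otimes b\mapsto(a\otimes1)\ast(1\otimes b),$$ with inverse given by $$(\Phi^{\mathtt D})^{-1}:(H\otimes H)^\imath\to D(H),\qquad a\otimes b\mapsto\sum\varphi(a_{(1)},S^{-1}(b_{(2)}))\,a_{(2)}\otimes b_{(1)}.$$
   Context: A Hopf pairing on $H$ is a bilinear form $\varphi:H\times H\to\mathbb F$ with $\varphi(a,1)=\varepsilon(a)$, $\varphi(1,b)=\varepsilon(b)$, $\varphi(a,bb')=\varphi(\Delta(a),b\otimes b')$, $\varphi(aa',b)=\varphi(a\otimes a',\Delta(b))$, $\varphi(a,S(b))=\varphi(S(a),b)$, where $\varphi(a\otimes a',b\otimes b')=\varphi(a,b)\varphi(a',b')$. Sweedler notation is used. Drinfeld double: $D(H)$ is the associative algebra on the vector space $H\otimes H$ determined by the relations, for $a,a',b,b'\in H$: $(a\otimes1)(a'\otimes1)=aa'\otimes1$; $(1\otimes b)(1\otimes b')=1\otimes bb'$; $(a\otimes1)(1\otimes b)=a\otimes b$; $\sum\varphi(a_{(1)},b_{(2)})(1\otimes b_{(1)})(a_{(2)}\otimes1)=\sum\varphi(a_{(2)},b_{(1)})(a_{(1)}\otimes b_{(2)})$. It is a Hopf algebra with $\Delta(a\otimes b)=\sum(a_{(1)}\otimes b_{(2)})\otimes(a_{(2)}\otimes b_{(1)})$,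 $\varepsilon(a\otimes b)=\varepsilon(a)\varepsilon(b)$, $S(a\otimes b)=(1\otimes S^{-1}(b))(S(a)\otimes1)$. $(H\otimes H)^\imath$ is the vector space $H\otimes H$ with multiplication $(a\otimes b)\ast(c\otimes d)=\sum\varphi(a_{(1)},d_{(2)})\varphi(c_{(2)},b_{(1)})\,a_{(2)}c_{(1)}\otimes b_{(2)}d_{(1)}$ and unit $1\otimes 1$; it is a Hopf algebra with $\Delta^\imath(a\otimes b)=\sum\varphi(a_{(2)},b_{(2)})(a_{(1)}\otimes b_{(3)})\otimes(a_{(3)}\otimes b_{(1)})$, $\varepsilon^\imath(a\otimes b)=\varphi(a,S^{-1}(b))$, $S^\imath(a\otimes b)=S(a)\otimes S^{-1}(b)$. *)

theory Defs
  imports "HOL-Algebra.AbelCoset" "HOL-Algebra.Module"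
begin

section \<open>Linear and bilinear maps\<close>

definition linear_maps ::
  "('k, 'n) ring_scheme \<Rightarrow> ('k, 'a, 'p) module_scheme \<Rightarrow> ('k, 'b, 'q) module_scheme \<Rightarrow> ('a \<Rightarrow> 'b) set"
  where "linear_maps K M N =
    {f \<in> carrier M \<rightarrow> carrier N.
       (\<forall>x\<in>carrier M. \<forall>y\<in>carrier M. f (x \<oplus>\<^bsub>M\<^esub> y) = f x \<oplus>\<^bsub>N\<^esub> f y) \<and>
       (\<forall>r\<in>carrier K. \<forall>x\<in>carrier M. f (r \<odot>\<^bsub>M\<^esub> x) = r \<odot>\<^bsub>N\<^esub> f x)}"

definition bilinear_maps ::
  "('k, 'n) ring_scheme \<Rightarrow> ('k, 'a, 'p) module_scheme \<Rightarrow> ('k, 'b, 'q) module_scheme \<Rightarrow>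
   ('k, 'c, 'r) module_scheme \<Rightarrow> ('a \<Rightarrow> 'b \<Rightarrow> 'c) set"
  where "bilinear_maps K M N P =
    {f. (\<forall>x\<in>carrier M. (\<lambda>y. f x y) \<in> linear_maps K N P) \<and>
        (\<forall>y\<in>carrier N. (\<lambda>x. f x y) \<in> linear_maps K M P)}"

definition self_module :: "('k, 'n) ring_scheme \<Rightarrow> ('k, 'k) module"
  where "self_module K =
    \<lparr>carrier = carrier K, mult = mult K, one = one K, zero = zero K, add = add K, smult = mult K\<rparr>"


section \<open>Tensor products\<close>

text \<open>
  The tensor product of two modules is the free module on the pairs of their elements modulo the
  submodule generated by the bilinearity relations; its elements are cosets. Only the module part
  of the two records below is meaningful: the fields \<open>mult\<close> and \<open>one\<close> are left unspecified.
\<close>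

definition free_module :: "('k, 'n) ring_scheme \<Rightarrow> 'x set \<Rightarrow> ('k, 'x \<Rightarrow> 'k) module"
  where "free_module K X =
    \<lparr>carrier = {f. (\<forall>x. f x \<in> carrier K) \<and> (\<forall>x. x \<notin> X \<longrightarrow> f x = \<zero>\<^bsub>K\<^esub>) \<and> finite {x. f x \<noteq> \<zero>\<^bsub>K\<^esub>}},
     mult = undefined, one = undefined,
     zero = (\<lambda>x. \<zero>\<^bsub>K\<^esub>), add = (\<lambda>f g x. f x \<oplus>\<^bsub>K\<^esub> g x),
     smult = (\<lambda>r f x. r \<otimes>\<^bsub>K\<^esub> f x)\<rparr>"

definition free_gen :: "('k, 'n) ring_scheme \<Rightarrow> 'x \<Rightarrow> 'x \<Rightarrow> 'k"
  where "free_gen K x = (\<lambda>y. if y = x then \<one>\<^bsub>K\<^esub> else \<zero>\<^bsub>K\<^esub>)"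

definition tensor_relations ::
  "('k, 'n) ring_scheme \<Rightarrow> ('k, 'a, 'p) module_scheme \<Rightarrow> ('k, 'b, 'q) module_scheme \<Rightarrow>
   ('a \<times> 'b \<Rightarrow> 'k) set"
  where "tensor_relations K M N =
    (let F = free_module K (carrier M \<times> carrier N); \<delta> = free_gen K in
      {\<delta> (x \<oplus>\<^bsub>M\<^esub> x', y) \<ominus>\<^bsub>F\<^esub> (\<delta> (x, y) \<oplus>\<^bsub>F\<^esub> \<delta> (x', y)) | x x' y.
         x \<in> carrier M \<and> x' \<in> carrier M \<and> y \<in> carrier N} \<union>
      {\<delta> (x, y \<oplus>\<^bsub>N\<^esub> y') \<ominus>\<^bsub>F\<^esub> (\<delta> (x, y) \<oplus>\<^bsub>F\<^esub> \<delta> (x, y')) | x y y'.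
         x \<in> carrier M \<and> y \<in> carrier N \<and> y' \<in> carrier N} \<union>
      {\<delta> (r \<odot>\<^bsub>M\<^esub> x, y) \<ominus>\<^bsub>F\<^esub> r \<odot>\<^bsub>F\<^esub> \<delta> (x, y) | r x y.
         r \<in> carrier K \<and> x \<in> carrier M \<and> y \<in> carrier N} \<union>
      {\<delta> (x, r \<odot>\<^bsub>N\<^esub> y) \<ominus>\<^bsub>F\<^esub> r \<odot>\<^bsub>F\<^esub> \<delta> (x, y) | r x y.
         r \<in> carrier K \<and> x \<in> carrier M \<and> y \<in> carrier N})"

definition tensor_null ::
  "('k, 'n) ring_scheme \<Rightarrow> ('k, 'a, 'p) module_scheme \<Rightarrow> ('k, 'b, 'q) module_scheme \<Rightarrow>
   ('a \<times> 'b \<Rightarrow> 'k) set"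
  where "tensor_null K M N =
    \<Inter>{U. submodule U K (free_module K (carrier M \<times> carrier N)) \<and> tensor_relations K M N \<subseteq> U}"

type_synonym ('k, 'a, 'b) tensor = "('a \<times> 'b \<Rightarrow> 'k) set"

definition tensor_module ::
  "('k, 'n) ring_scheme \<Rightarrow> ('k, 'a, 'p) module_scheme \<Rightarrow> ('k, 'b, 'q) module_scheme \<Rightarrow>
   ('k, ('k, 'a, 'b) tensor) module"
  where "tensor_module K M N =
    (let F = free_module K (carrier M \<times> carrier N); U = tensor_null K M N in
      \<lparr>carrier = a_rcosets\<^bsub>F\<^esub> U, mult = undefined, one = undefined,
       zero = U, add = set_add F,
       smult = (\<lambda>r X. \<Union>x\<in>X. U +>\<^bsub>F\<^esub> (r \<odot>\<^bsub>F\<^esub> x))\<rparr>)"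

definition pure_tensor ::
  "('k, 'n) ring_scheme \<Rightarrow> ('k, 'a, 'p) module_scheme \<Rightarrow> ('k, 'b, 'q) module_scheme \<Rightarrow>
   'a \<Rightarrow> 'b \<Rightarrow> ('k, 'a, 'b) tensor"
  where "pure_tensor K M N x y =
    tensor_null K M N +>\<^bsub>free_module K (carrier M \<times> carrier N)\<^esub> free_gen K (x, y)"

text \<open>
  The linear map into \<open>P\<close> induced by a bilinear map \<open>f\<close>: write the tensor as a formal sum of
  pairs and evaluate \<open>f\<close> termwise. For bilinear \<open>f\<close> the result does not depend on the formal sum.
\<close>

definition tensor_lift ::
  "('k, 'n) ring_scheme \<Rightarrow> ('k, 'c, 'r) module_scheme \<Rightarrow> ('a \<Rightarrow> 'b \<Rightarrow> 'c) \<Rightarrow>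
   ('k, 'a, 'b) tensor \<Rightarrow> 'c"
  where "tensor_lift K P f t =
    (let g = (SOME g. g \<in> t) in
      \<Oplus>\<^bsub>P\<^esub>p\<in>{p. g p \<noteq> \<zero>\<^bsub>K\<^esub>}. g p \<odot>\<^bsub>P\<^esub> f (fst p) (snd p))"

definition tensor_map ::
  "('k, 'n) ring_scheme \<Rightarrow> ('k, 'c, 'p) module_scheme \<Rightarrow> ('k, 'd, 'q) module_scheme \<Rightarrow>
   ('a \<Rightarrow> 'c) \<Rightarrow> ('b \<Rightarrow> 'd) \<Rightarrow> ('k, 'a, 'b) tensor \<Rightarrow> ('k, 'c, 'd) tensor"
  where "tensor_map K M' N' f g =
    tensor_lift K (tensor_module K M' N') (\<lambda>x y. pure_tensor K M' N' (f x) (g y))"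

definition tensor_algebra ::
  "('k, 'n) ring_scheme \<Rightarrow> ('k, 'a, 'p) module_scheme \<Rightarrow> ('k, 'b, 'q) module_scheme \<Rightarrow>
   ('k, ('k, 'a, 'b) tensor) module"
  where "tensor_algebra K A B =
    (let T = tensor_module K A B in
      T\<lparr>mult := (\<lambda>s t. tensor_lift K T (\<lambda>a b. tensor_lift K T
                   (\<lambda>a' b'. pure_tensor K A B (a \<otimes>\<^bsub>A\<^esub> a') (b \<otimes>\<^bsub>B\<^esub> b')) t) s),
        one := pure_tensor K A B \<one>\<^bsub>A\<^esub> \<one>\<^bsub>B\<^esub>\<rparr>)"


section \<open>Hopf algebras\<close>

text \<open>The library's locale \<open>algebra\<close> covers commutative algebras only.\<close>

locale unital_algebra = module K A + A?: ring A for K (structure) and A (structure) +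
  assumes smult_mult_left:
      "\<lbrakk>r \<in> carrier K; x \<in> carrier A; y \<in> carrier A\<rbrakk> \<Longrightarrow>
        (r \<odot>\<^bsub>A\<^esub> x) \<otimes>\<^bsub>A\<^esub> y = r \<odot>\<^bsub>A\<^esub> (x \<otimes>\<^bsub>A\<^esub> y)"
    and smult_mult_right:
      "\<lbrakk>r \<in> carrier K; x \<in> carrier A; y \<in> carrier A\<rbrakk> \<Longrightarrow>
        x \<otimes>\<^bsub>A\<^esub> (r \<odot>\<^bsub>A\<^esub> y) = r \<odot>\<^bsub>A\<^esub> (x \<otimes>\<^bsub>A\<^esub> y)"

record ('k, 'h) hopf = "('k, 'h) module" +
  comult :: "'h \<Rightarrow> ('k, 'h, 'h) tensor"
  counit :: "'h \<Rightarrow> 'k"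
  antipode :: "'h \<Rightarrow> 'h"

text \<open>
  Sweedler notation: \<open>sweedler K H P a (\<lambda>a\<^sub>1 a\<^sub>2. F a\<^sub>1 a\<^sub>2)\<close> stands for the element
  \<open>\<Sum> F a\<^sub>(\<^sub>1\<^sub>) a\<^sub>(\<^sub>2\<^sub>)\<close> of \<open>P\<close>, and \<open>sweedler3\<close> is the version with three legs, obtained from
  \<open>(\<Delta> \<otimes> id) \<circ> \<Delta>\<close>.
\<close>

definition sweedler ::
  "('k, 'n) ring_scheme \<Rightarrow> ('k, 'h, 'm) hopf_scheme \<Rightarrow> ('k, 'c, 'r) module_scheme \<Rightarrow>
   'h \<Rightarrow> ('h \<Rightarrow> 'h \<Rightarrow> 'c) \<Rightarrow> 'c"
  where "sweedler K H P a F = tensor_lift K P F (comult H a)"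

definition sweedler3 ::
  "('k, 'n) ring_scheme \<Rightarrow> ('k, 'h, 'm) hopf_scheme \<Rightarrow> ('k, 'c, 'r) module_scheme \<Rightarrow>
   'h \<Rightarrow> ('h \<Rightarrow> 'h \<Rightarrow> 'h \<Rightarrow> 'c) \<Rightarrow> 'c"
  where "sweedler3 K H P a F =
    sweedler K H P a (\<lambda>x a3. sweedler K H P x (\<lambda>a1 a2. F a1 a2 a3))"

locale hopf_algebra = field K + H?: unital_algebra K H for K (structure) and H (structure) +
  assumes comult_linear: "comult H \<in> linear_maps K H (tensor_module K H H)"
    and counit_linear: "counit H \<in> linear_maps K H (self_module K)"
    and antipode_linear: "antipode H \<in> linear_maps K H H"
    and coassoc:
      "a \<in> carrier H \<Longrightarrow>
        (let H2 = tensor_module K H H; H3 = tensor_module K H H2 in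
          sweedler3 K H H3 a
            (\<lambda>a1 a2 a3. pure_tensor K H H2 a1 (pure_tensor K H H a2 a3)) =
          sweedler K H H3 a (\<lambda>a1 x. pure_tensor K H H2 a1 (comult H x)))"
    and counit_left:
      "a \<in> carrier H \<Longrightarrow> sweedler K H H a (\<lambda>a1 a2. counit H a1 \<odot>\<^bsub>H\<^esub> a2) = a"
    and counit_right:
      "a \<in> carrier H \<Longrightarrow> sweedler K H H a (\<lambda>a1 a2. counit H a2 \<odot>\<^bsub>H\<^esub> a1) = a"
    and comult_ring_hom: "comult H \<in> ring_hom H (tensor_algebra K H H)"
    and counit_ring_hom: "counit H \<in> ring_hom H K"
    and antipode_left:
      "a \<in> carrier H \<Longrightarrow>
        sweedler K H H a (\<lambda>a1 a2. antipode H a1 \<otimes>\<^bsub>H\<^esub> a2) = counit H a \<odot>\<^bsub>H\<^esub> \<one>\<^bsub>H\<^esub>"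
    and antipode_right:
      "a \<in> carrier H \<Longrightarrow>
        sweedler K H H a (\<lambda>a1 a2. a1 \<otimes>\<^bsub>H\<^esub> antipode H a2) = counit H a \<odot>\<^bsub>H\<^esub> \<one>\<^bsub>H\<^esub>"

definition hopf_hom ::
  "('k, 'n) ring_scheme \<Rightarrow> ('k, 'a, 'p) hopf_scheme \<Rightarrow> ('k, 'b, 'q) hopf_scheme \<Rightarrow> ('a \<Rightarrow> 'b) set"
  where "hopf_hom K A B =
    {f \<in> linear_maps K A B \<inter> ring_hom A B.
       \<forall>x\<in>carrier A.
         comult B (f x) = tensor_map K B B f f (comult A x) \<and>
         counit B (f x) = counit A x \<and>
         antipode B (f x) = f (antipode A x)}"

definition hopf_iso ::
  "('k, 'n) ring_scheme \<Rightarrow> ('k, 'a, 'p) hopf_scheme \<Rightarrow> ('k, 'b, 'q) hopf_scheme \<Rightarrow> ('a \<Rightarrow> 'b) set"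
  where "hopf_iso K A B = {f \<in> hopf_hom K A B. bij_betw f (carrier A) (carrier B)}"

locale hopf_pairing = hopf_algebra K H for K (structure) and H (structure) +
  fixes \<phi>
  assumes pairing_bilinear: "\<phi> \<in> bilinear_maps K H H (self_module K)"
    and pairing_one_right: "a \<in> carrier H \<Longrightarrow> \<phi> a \<one>\<^bsub>H\<^esub> = counit H a"
    and pairing_one_left: "b \<in> carrier H \<Longrightarrow> \<phi> \<one>\<^bsub>H\<^esub> b = counit H b"
    and pairing_mult_right:
      "\<lbrakk>a \<in> carrier H; b \<in> carrier H; b' \<in> carrier H\<rbrakk> \<Longrightarrow>
        \<phi> a (b \<otimes>\<^bsub>H\<^esub> b') = sweedler K H (self_module K) a (\<lambda>a1 a2. \<phi> a1 b \<otimes>\<^bsub>K\<^esub> \<phi> a2 b')"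
    and pairing_mult_left:
      "\<lbrakk>a \<in> carrier H; a' \<in> carrier H; b \<in> carrier H\<rbrakk> \<Longrightarrow>
        \<phi> (a \<otimes>\<^bsub>H\<^esub> a') b = sweedler K H (self_module K) b (\<lambda>b1 b2. \<phi> a b1 \<otimes>\<^bsub>K\<^esub> \<phi> a' b2)"
    and pairing_antipode:
      "\<lbrakk>a \<in> carrier H; b \<in> carrier H\<rbrakk> \<Longrightarrow> \<phi> a (antipode H b) = \<phi> (antipode H a) b"

definition antipode_inv :: "('k, 'h, 'm) hopf_scheme \<Rightarrow> 'h \<Rightarrow> 'h"
  where "antipode_inv H = inv_into (carrier H) (antipode H)"


section \<open>The Drinfeld double and the twisted tensor square\<close>

context
  fixes K :: "('k, 'n) ring_scheme"
    and H :: "('k, 'h, 'm) hopf_scheme"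
    and \<phi> :: "'h \<Rightarrow> 'h \<Rightarrow> 'k"
begin

private abbreviation (input) T :: "('k, ('k, 'h, 'h) tensor) module"
  where "T \<equiv> tensor_module K H H"

private abbreviation (input) TT :: "('k, ('k, ('k, 'h, 'h) tensor, ('k, 'h, 'h) tensor) tensor) module"
  where "TT \<equiv> tensor_module K T T"

private abbreviation (input) tens :: "'h \<Rightarrow> 'h \<Rightarrow> ('k, 'h, 'h) tensor"  (infix \<open>\<boxtimes>\<close> 75)
  where "a \<boxtimes> b \<equiv> pure_tensor K H H a b"

private abbreviation (input) tens2 ::
  "('k, 'h, 'h) tensor \<Rightarrow> ('k, 'h, 'h) tensor \<Rightarrow> ('k, ('k, 'h, 'h) tensor, ('k, 'h, 'h) tensor) tensor"
    (infix \<open>\<boxtimes>\<boxtimes>\<close> 74)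
  where "s \<boxtimes>\<boxtimes> t \<equiv> pure_tensor K T T s t"

text \<open>
  The multiplication of the Drinfeld double is the unique one, on the vector space \<open>H \<otimes> H\<close>, that
  satisfies the defining relations. (Extensionality only fixes its values outside the carrier.)
\<close>

definition is_drinfeld_mult ::
  "(('k, 'h, 'h) tensor \<Rightarrow> ('k, 'h, 'h) tensor \<Rightarrow> ('k, 'h, 'h) tensor) \<Rightarrow> bool"
  where "is_drinfeld_mult m \<longleftrightarrow>
    m \<in> carrier T \<rightarrow>\<^sub>E carrier T \<rightarrow>\<^sub>E carrier T \<and>
    unital_algebra K (T\<lparr>mult := m, one := \<one>\<^bsub>H\<^esub> \<boxtimes> \<one>\<^bsub>H\<^esub>\<rparr>) \<and>
    (\<forall>a\<in>carrier H. \<forall>a'\<in>carrier H.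
       m (a \<boxtimes> \<one>\<^bsub>H\<^esub>) (a' \<boxtimes> \<one>\<^bsub>H\<^esub>) = (a \<otimes>\<^bsub>H\<^esub> a') \<boxtimes> \<one>\<^bsub>H\<^esub>) \<and>
    (\<forall>b\<in>carrier H. \<forall>b'\<in>carrier H.
       m (\<one>\<^bsub>H\<^esub> \<boxtimes> b) (\<one>\<^bsub>H\<^esub> \<boxtimes> b') = \<one>\<^bsub>H\<^esub> \<boxtimes> (b \<otimes>\<^bsub>H\<^esub> b')) \<and>
    (\<forall>a\<in>carrier H. \<forall>b\<in>carrier H. m (a \<boxtimes> \<one>\<^bsub>H\<^esub>) (\<one>\<^bsub>H\<^esub> \<boxtimes> b) = a \<boxtimes> b) \<and>
    (\<forall>a\<in>carrier H. \<forall>b\<in>carrier H.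
       sweedler K H T a (\<lambda>a1 a2. sweedler K H T b (\<lambda>b1 b2.
         \<phi> a1 b2 \<odot>\<^bsub>T\<^esub> m (\<one>\<^bsub>H\<^esub> \<boxtimes> b1) (a2 \<boxtimes> \<one>\<^bsub>H\<^esub>))) =
       sweedler K H T a (\<lambda>a1 a2. sweedler K H T b (\<lambda>b1 b2.
         \<phi> a2 b1 \<odot>\<^bsub>T\<^esub> (a1 \<boxtimes> b2))))"

definition drinfeld_mult ::
  "('k, 'h, 'h) tensor \<Rightarrow> ('k, 'h, 'h) tensor \<Rightarrow> ('k, 'h, 'h) tensor"
  where "drinfeld_mult = (THE m. is_drinfeld_mult m)"

definition drinfeld_double :: "('k, ('k, 'h, 'h) tensor) hopf"
  where "drinfeld_double =
    \<lparr>carrier = carrier T, mult = drinfeld_mult, one = \<one>\<^bsub>H\<^esub> \<boxtimes> \<one>\<^bsub>H\<^esub>,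
     zero = zero T, add = add T, smult = smult T,
     comult = tensor_lift K TT (\<lambda>a b.
       sweedler K H TT a (\<lambda>a1 a2. sweedler K H TT b (\<lambda>b1 b2. (a1 \<boxtimes> b2) \<boxtimes>\<boxtimes> (a2 \<boxtimes> b1)))),
     counit = tensor_lift K (self_module K) (\<lambda>a b. counit H a \<otimes>\<^bsub>K\<^esub> counit H b),
     antipode = tensor_lift K T (\<lambda>a b.
       drinfeld_mult (\<one>\<^bsub>H\<^esub> \<boxtimes> antipode_inv H b) (antipode H a \<boxtimes> \<one>\<^bsub>H\<^esub>))\<rparr>"

definition twisted_square :: "('k, ('k, 'h, 'h) tensor) hopf"
  where "twisted_square =
    \<lparr>carrier = carrier T,
     mult = (\<lambda>s t. tensor_lift K T (\<lambda>a b. tensor_lift K T (\<lambda>c d.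
       sweedler K H T a (\<lambda>a1 a2. sweedler K H T b (\<lambda>b1 b2.
       sweedler K H T c (\<lambda>c1 c2. sweedler K H T d (\<lambda>d1 d2.
         (\<phi> a1 d2 \<otimes>\<^bsub>K\<^esub> \<phi> c2 b1) \<odot>\<^bsub>T\<^esub> ((a2 \<otimes>\<^bsub>H\<^esub> c1) \<boxtimes> (b2 \<otimes>\<^bsub>H\<^esub> d1))))))) t) s),
     one = \<one>\<^bsub>H\<^esub> \<boxtimes> \<one>\<^bsub>H\<^esub>,
     zero = zero T, add = add T, smult = smult T,
     comult = tensor_lift K TT (\<lambda>a b.
       sweedler3 K H TT a (\<lambda>a1 a2 a3. sweedler3 K H TT b (\<lambda>b1 b2 b3.
         \<phi> a2 b2 \<odot>\<^bsub>TT\<^esub> ((a1 \<boxtimes> b3) \<boxtimes>\<boxtimes> (a3 \<boxtimes> b1))))),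
     counit = tensor_lift K (self_module K) (\<lambda>a b. \<phi> a (antipode_inv H b)),
     antipode = tensor_lift K T (\<lambda>a b. antipode H a \<boxtimes> antipode_inv H b)\<rparr>"

end

end

theory Submission
  imports Defs
begin

text \<open>
  Write \<open>a \<leftharpoonup> b = \<Sum> \<phi>(a\<^sub>1, b) a\<^sub>2\<close> and \<open>b \<rightharpoonup> a = \<Sum> \<phi>(a\<^sub>2, b) a\<^sub>1\<close>. These are commuting
  right and left actions of \<open>H\<close> on itself, compatible with the product through the coproduct
  of \<open>b\<close>, and the twisted square becomes
  \<open>(a \<otimes> b) \<star> (c \<otimes> d) = \<Sum> (a \<leftharpoonup> d\<^sub>2)(b\<^sub>1 \<rightharpoonup> c) \<otimes> b\<^sub>2 d\<^sub>1\<close> with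
  \<open>\<Delta>(a \<otimes> b) = \<Sum> (a\<^sub>1 \<otimes> b\<^sub>3) \<otimes> ((a\<^sub>2 \<leftharpoonup> b\<^sub>2) \<otimes> b\<^sub>1)\<close>; in this form its Hopf algebra axioms are
  direct calculations. The map \<open>\<Phi>(a \<otimes> b) = (a \<otimes> 1) \<star> (1 \<otimes> b) = \<Sum> (a \<leftharpoonup> b\<^sub>2) \<otimes> b\<^sub>1\<close> is a
  linear bijection, since \<open>\<Sum> S\<inverse>(b\<^sub>2) b\<^sub>1 = \<epsilon>(b) = \<Sum> b\<^sub>2 S\<inverse>(b\<^sub>1)\<close>. Pulling \<open>\<star>\<close> back along \<open>\<Phi>\<close>
  gives a product satisfying the relations of the Drinfeld double. It is the only one: by the
  same inversion, the cross relation determines \<open>(1 \<otimes> b)(a \<otimes> 1)\<close>. The remaining structure maps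
  of the double correspond to those of the twisted square under \<open>\<Phi>\<close>, so its Hopf algebra
  axioms follow by transport.
\<close>

section \<open>Linear maps and tensor products of modules\<close>

text \<open>The inverse antipode enters because the second tensor factor carries the co-opposite
  coproduct: in both comultiplications the legs of \<open>b\<close> occur in reversed order, and the
  antipode of the co-opposite coalgebra is \<open>S\<inverse>\<close>. The actions are introduced to
  control the size of the formulas. They absorb all pairing scalars and, in the product, the sums
  over \<open>a\<close> and \<open>c\<close>, so that only coproducts of second factors remain. What
  is left are regroupings of nested Sweedler sums. Since such a sum is a lift along
  \<open>\<Delta>(a)\<close>, each regrouping needs linearity in every leg, which explains the stock
  of linearity rules. The two actions interact across a coproduct in one further way,
  \<open>sw_hit_middle\<close>; multiplicativity of the twisted coproduct rests on it. The product
  of the double is given by a definite description, so nothing about it can be evaluated before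
  existence and uniqueness are settled. The twisted square has an explicit product, and this is why
  associativity is checked there and carried over, and why its Hopf axioms come before those of the
  double.\<close>

lemma linear_mapsI:
  assumes "\<And>x. x \<in> carrier M \<Longrightarrow> f x \<in> carrier N"
    and "\<And>x y. \<lbrakk>x \<in> carrier M; y \<in> carrier M\<rbrakk> \<Longrightarrow> f (x \<oplus>\<^bsub>M\<^esub> y) = f x \<oplus>\<^bsub>N\<^esub> f y"
    and "\<And>r x. \<lbrakk>r \<in> carrier K; x \<in> carrier M\<rbrakk> \<Longrightarrow> f (r \<odot>\<^bsub>M\<^esub> x) = r \<odot>\<^bsub>N\<^esub> f x"
  shows "f \<in> linear_maps K M N"
  using assms by (auto simp: linear_maps_def)

lemma linear_closed: "\<lbrakk>f \<in> linear_maps K M N; x \<in> carrier M\<rbrakk> \<Longrightarrow> f x \<in> carrier N"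
  by (auto simp: linear_maps_def)

lemma linear_add:
  "\<lbrakk>f \<in> linear_maps K M N; x \<in> carrier M; y \<in> carrier M\<rbrakk> \<Longrightarrow> f (x \<oplus>\<^bsub>M\<^esub> y) = f x \<oplus>\<^bsub>N\<^esub> f y"
  by (auto simp: linear_maps_def)

lemma linear_smult:
  "\<lbrakk>f \<in> linear_maps K M N; r \<in> carrier K; x \<in> carrier M\<rbrakk> \<Longrightarrow> f (r \<odot>\<^bsub>M\<^esub> x) = r \<odot>\<^bsub>N\<^esub> f x"
  by (auto simp: linear_maps_def)

text \<open>Linearity tests only arguments in the carrier. Several products below have a usable
  formula only there, and this lemma lets their linearity be read off from that formula.\<close>

lemma linear_cong:
  assumes "module K M" and "\<And>x. x \<in> carrier M \<Longrightarrow> f x = g x"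
  shows "f \<in> linear_maps K M N \<longleftrightarrow> g \<in> linear_maps K M N"
proof -
  interpret module K M by fact
  have "g \<in> linear_maps K M N" if "f \<in> linear_maps K M N" "\<And>x. x \<in> carrier M \<Longrightarrow> f x = g x" for f g
    using that(2) linear_closed[OF that(1)] linear_add[OF that(1)] linear_smult[OF that(1)]
    by (intro linear_mapsI) (metis M.a_closed smult_closed)+
  then show ?thesis using assms(2) by metis
qed

lemma linear_id: "(\<lambda>x. x) \<in> linear_maps K M M"
  by (rule linear_mapsI) auto

lemma linear_compose:
  "\<lbrakk>g \<in> linear_maps K N P; f \<in> linear_maps K M N\<rbrakk> \<Longrightarrow> (\<lambda>x. g (f x)) \<in> linear_maps K M P"
  by (rule linear_mapsI) (auto simp: linear_closed linear_add linear_smult)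

lemma linear_zero:
  assumes "module K M" "module K N" "f \<in> linear_maps K M N"
  shows "f \<zero>\<^bsub>M\<^esub> = \<zero>\<^bsub>N\<^esub>"
proof -
  interpret M: module K M by fact
  interpret N: module K N by fact
  have "f (\<zero>\<^bsub>K\<^esub> \<odot>\<^bsub>M\<^esub> \<zero>\<^bsub>M\<^esub>) = \<zero>\<^bsub>K\<^esub> \<odot>\<^bsub>N\<^esub> f \<zero>\<^bsub>M\<^esub>"
    by (rule linear_smult[OF assms(3)]) auto
  then show ?thesis
    using assms(3) by (simp add: linear_closed)
qed

lemma linear_finsum:
  assumes "module K M" "module K N" "f \<in> linear_maps K M N" "g \<in> A \<rightarrow> carrier M"
  shows "f (\<Oplus>\<^bsub>M\<^esub>i\<in>A. g i) = (\<Oplus>\<^bsub>N\<^esub>i\<in>A. f (g i))"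
proof -
  interpret M: module K M by fact
  interpret N: module K N by fact
  show ?thesis
    using assms(4)
  proof (induction A rule: infinite_finite_induct)
    case (insert x F)
    then have "f (g x \<oplus>\<^bsub>M\<^esub> finsum M g F) = f (g x) \<oplus>\<^bsub>N\<^esub> (\<Oplus>\<^bsub>N\<^esub>i\<in>F. f (g i))"
      using linear_add[OF assms(3)] by (auto simp: Pi_iff)
    then show ?case
      using insert by (simp add: Pi_iff linear_closed[OF assms(3)])
  qed (use assms linear_zero in auto)
qed

lemma (in module) finsum_swap:
  assumes "finite A" "finite B" "\<And>i j. \<lbrakk>i \<in> A; j \<in> B\<rbrakk> \<Longrightarrow> f i j \<in> carrier M"
  shows "(\<Oplus>\<^bsub>M\<^esub>i\<in>A. \<Oplus>\<^bsub>M\<^esub>j\<in>B. f i j) = (\<Oplus>\<^bsub>M\<^esub>j\<in>B. \<Oplus>\<^bsub>M\<^esub>i\<in>A. f i j)"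
  using assms(1,3)
proof (induction A)
  case empty
  then show ?case by simp
next
  case (insert x F)
  have "(\<Oplus>\<^bsub>M\<^esub>j\<in>B. \<Oplus>\<^bsub>M\<^esub>i\<in>insert x F. f i j) = (\<Oplus>\<^bsub>M\<^esub>j\<in>B. f x j \<oplus>\<^bsub>M\<^esub> (\<Oplus>\<^bsub>M\<^esub>i\<in>F. f i j))"
    using insert by (intro M.finsum_cong') (auto simp: Pi_iff)
  also have "\<dots> = (\<Oplus>\<^bsub>M\<^esub>j\<in>B. f x j) \<oplus>\<^bsub>M\<^esub> (\<Oplus>\<^bsub>M\<^esub>j\<in>B. \<Oplus>\<^bsub>M\<^esub>i\<in>F. f i j)"
    using insert by (intro M.finsum_addf) auto
  finally show ?case
    using insert by (simp add: Pi_iff)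
qed

text \<open>An induction over the graph of the fold uses only values at elements of the index set,
  so neither closure of the summands nor any law of \<open>P\<close> is required. The congruence
  rules for Sweedler sums thereby have no side conditions on the target.\<close>

lemma finsum_cong_unconditional:
  fixes f g :: "'i \<Rightarrow> 'c" and P :: "('c, 'r) ring_scheme"
  assumes "\<And>i. i \<in> A \<Longrightarrow> f i = g i"
  shows "finsum P f A = finsum P g A"
proof -
  have *: "(B, x) \<in> foldSetD D (\<lambda>i. add P (g' i)) e"
    if "(B, x) \<in> foldSetD D (\<lambda>i. add P (f' i)) e" "\<And>i. i \<in> B \<Longrightarrow> f' i = g' i"
    for B x D e and f' g' :: "'i \<Rightarrow> 'c"
    using that
  proof (induction B x)
    case emptyI
    then show ?case by (blast intro: foldSetD.intros)
  next
    case (insertI i B x)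
    then have "(insert i B, add P (g' i) x) \<in> foldSetD D (\<lambda>i. add P (g' i)) e"
      by (intro foldSetD.intros) auto
    then show ?case using insertI by simp
  qed
  have "(A, x) \<in> foldSetD D (\<lambda>i. add P (f i)) e \<longleftrightarrow> (A, x) \<in> foldSetD D (\<lambda>i. add P (g i)) e"
    for x D e
    using *[of A x D f e g] *[of A x D g e f] assms by auto
  then show ?thesis
    by (simp add: finsum_def finprod_def foldD_def comp_def)
qed

lemma bilinear_mapsI:
  assumes "\<And>x. x \<in> carrier M \<Longrightarrow> (\<lambda>y. f x y) \<in> linear_maps K N P"
    and "\<And>y. y \<in> carrier N \<Longrightarrow> (\<lambda>x. f x y) \<in> linear_maps K M P"
  shows "f \<in> bilinear_maps K M N P"
  using assms by (auto simp: bilinear_maps_def)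

lemma bilinear_left:
  "\<lbrakk>f \<in> bilinear_maps K M N P; y \<in> carrier N\<rbrakk> \<Longrightarrow> (\<lambda>x. f x y) \<in> linear_maps K M P"
  by (auto simp: bilinear_maps_def)

lemma bilinear_right:
  "\<lbrakk>f \<in> bilinear_maps K M N P; x \<in> carrier M\<rbrakk> \<Longrightarrow> (\<lambda>y. f x y) \<in> linear_maps K N P"
  by (auto simp: bilinear_maps_def)

lemma bilinear_closed:
  "\<lbrakk>f \<in> bilinear_maps K M N P; x \<in> carrier M; y \<in> carrier N\<rbrakk> \<Longrightarrow> f x y \<in> carrier P"
  using linear_closed bilinear_right by metis

lemma module_self: "cring K \<Longrightarrow> module K (self_module K)"
proof -
  assume "cring K"
  then interpret cring K .
  show ?thesis
    by (intro moduleI abelian_groupI)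
      (auto simp: self_module_def is_cring a_assoc m_assoc l_distr r_distr
        intro: a_comm bexI[where x = "\<ominus>\<^bsub>K\<^esub> _"] l_neg)
qed

lemma self_module_simps [simp]:
  "carrier (self_module K) = carrier K" "zero (self_module K) = zero K"
  "add (self_module K) = add K" "smult (self_module K) = mult K"
  by (simp_all add: self_module_def)

subsection \<open>The free module\<close>

lemma free_module_simps:
  "carrier (free_module K X) =
    {f. (\<forall>x. f x \<in> carrier K) \<and> (\<forall>x. x \<notin> X \<longrightarrow> f x = \<zero>\<^bsub>K\<^esub>) \<and> finite {x. f x \<noteq> \<zero>\<^bsub>K\<^esub>}}"
  "zero (free_module K X) = (\<lambda>x. \<zero>\<^bsub>K\<^esub>)"
  "add (free_module K X) = (\<lambda>f g x. f x \<oplus>\<^bsub>K\<^esub> g x)"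
  "smult (free_module K X) = (\<lambda>r f x. r \<otimes>\<^bsub>K\<^esub> f x)"
  by (simp_all add: free_module_def)

lemma module_free:
  assumes "cring K" shows "module K (free_module K X)"
proof -
  interpret cring K by fact
  have add: "finite {x. f x \<oplus>\<^bsub>K\<^esub> g x \<noteq> \<zero>\<^bsub>K\<^esub>}"
    if "finite {x. f x \<noteq> \<zero>\<^bsub>K\<^esub>}" "finite {x. g x \<noteq> \<zero>\<^bsub>K\<^esub>}" for f g :: "'c \<Rightarrow> 'a"
    by (rule finite_subset[OF _ finite_UnI[OF that]]) auto
  have smult: "finite {x. r \<otimes>\<^bsub>K\<^esub> f x \<noteq> \<zero>\<^bsub>K\<^esub>}"
    if "finite {x. f x \<noteq> \<zero>\<^bsub>K\<^esub>}" "r \<in> carrier K" for r and f :: "'c \<Rightarrow> 'a"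
    by (rule finite_subset[OF _ that(1)]) (use that(2) in auto)
  have inv: "\<exists>g\<in>carrier (free_module K X). g \<oplus>\<^bsub>free_module K X\<^esub> f = \<zero>\<^bsub>free_module K X\<^esub>"
    if "f \<in> carrier (free_module K X)" for f
  \<comment> \<open>Negation is written as multiplication by minus one, so that finiteness of the
    support comes from \<open>smult\<close>.\<close>
  proof (rule bexI[of _ "\<lambda>x. (\<ominus>\<^bsub>K\<^esub> \<one>\<^bsub>K\<^esub>) \<otimes>\<^bsub>K\<^esub> f x"])
    show "(\<lambda>x. (\<ominus>\<^bsub>K\<^esub> \<one>\<^bsub>K\<^esub>) \<otimes>\<^bsub>K\<^esub> f x) \<in> carrier (free_module K X)"
      using that smult[of f "\<ominus>\<^bsub>K\<^esub> \<one>\<^bsub>K\<^esub>"] by (auto simp: free_module_simps)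
    show "(\<lambda>x. (\<ominus>\<^bsub>K\<^esub> \<one>\<^bsub>K\<^esub>) \<otimes>\<^bsub>K\<^esub> f x) \<oplus>\<^bsub>free_module K X\<^esub> f = \<zero>\<^bsub>free_module K X\<^esub>"
      using that by (auto simp: free_module_simps l_minus l_neg)
  qed
  show ?thesis
    by (intro moduleI abelian_groupI inv)
      (auto simp: free_module_simps is_cring a_assoc m_assoc l_distr r_distr add smult
        intro: a_comm)
qed

lemma free_gen_closed:
  assumes "cring K" "x \<in> X" shows "free_gen K x \<in> carrier (free_module K X)"
proof -
  interpret cring K by fact
  have "finite {y. free_gen K x y \<noteq> \<zero>\<^bsub>K\<^esub>}"
    by (rule finite_subset[of _ "{x}"]) (auto simp: free_gen_def)
  then show ?thesis
    using assms(2) by (auto simp: free_module_simps free_gen_def)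
qed

definition free_lift ::
  "('k, 'n) ring_scheme \<Rightarrow> ('k, 'c, 'r) module_scheme \<Rightarrow> ('x \<Rightarrow> 'c) \<Rightarrow> ('x \<Rightarrow> 'k) \<Rightarrow> 'c"
  where "free_lift K P f g = (\<Oplus>\<^bsub>P\<^esub>p\<in>{p. g p \<noteq> \<zero>\<^bsub>K\<^esub>}. g p \<odot>\<^bsub>P\<^esub> f p)"

text \<open>Supports shrink under addition and scaling; comparing two lifts needs one common finite
  index set.\<close>

lemma free_lift_superset:
  assumes "module K P" "f \<in> X \<rightarrow> carrier P" "g \<in> carrier (free_module K X)"
    and "finite B" "{p. g p \<noteq> \<zero>\<^bsub>K\<^esub>} \<subseteq> B" "B \<subseteq> X"
  shows "free_lift K P f g = (\<Oplus>\<^bsub>P\<^esub>p\<in>B. g p \<odot>\<^bsub>P\<^esub> f p)"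
proof -
  interpret P: module K P by fact
  have fX: "f p \<in> carrier P" if "p \<in> B" for p using assms that by auto
  show ?thesis unfolding free_lift_def
    by (rule P.add.finprod_mono_neutral_cong_left)
      (use assms fX in \<open>auto simp: free_module_simps\<close>)
qed

lemma free_lift_linear:
  assumes "module K P" "f \<in> X \<rightarrow> carrier P"
  shows "free_lift K P f \<in> linear_maps K (free_module K X) P"
proof (rule linear_mapsI)
  interpret P: module K P by fact
  interpret F: module K "free_module K X" using P.is_cring by (rule module_free)
  have fX: "f p \<in> carrier P" if "p \<in> X" for p using assms that by auto
  have supp: "finite {p. g p \<noteq> \<zero>\<^bsub>K\<^esub>}" "{p. g p \<noteq> \<zero>\<^bsub>K\<^esub>} \<subseteq> X" "g p \<in> carrier K"
    if "g \<in> carrier (free_module K X)" for g p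
    using that by (auto simp: free_module_simps)
  show "free_lift K P f g \<in> carrier P" if g: "g \<in> carrier (free_module K X)" for g
    unfolding free_lift_def
    by (rule P.M.finsum_closed) (use supp[OF g] fX in auto)
  show "free_lift K P f (g \<oplus>\<^bsub>free_module K X\<^esub> h) = free_lift K P f g \<oplus>\<^bsub>P\<^esub> free_lift K P f h"
    if g: "g \<in> carrier (free_module K X)" and h: "h \<in> carrier (free_module K X)" for g h
  proof -
    let ?B = "{p. g p \<noteq> \<zero>\<^bsub>K\<^esub>} \<union> {p. h p \<noteq> \<zero>\<^bsub>K\<^esub>}"
    have B: "finite ?B" "?B \<subseteq> X" using supp[OF g] supp[OF h] by auto
    have clo: "g p \<odot>\<^bsub>P\<^esub> f p \<in> carrier P" "h p \<odot>\<^bsub>P\<^esub> f p \<in> carrier P" if "p \<in> ?B" for p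
      using that B supp[OF g] supp[OF h] fX by blast+
    have "free_lift K P f (g \<oplus>\<^bsub>free_module K X\<^esub> h) =
        (\<Oplus>\<^bsub>P\<^esub>p\<in>?B. (g \<oplus>\<^bsub>free_module K X\<^esub> h) p \<odot>\<^bsub>P\<^esub> f p)"
      by (rule free_lift_superset[OF assms F.a_closed[OF g h] B(1) _ B(2)])
        (auto simp: free_module_simps)
    also have "\<dots> = (\<Oplus>\<^bsub>P\<^esub>p\<in>?B. g p \<odot>\<^bsub>P\<^esub> f p \<oplus>\<^bsub>P\<^esub> h p \<odot>\<^bsub>P\<^esub> f p)"
      by (rule P.M.finsum_cong')
        (use clo B fX supp[OF g] supp[OF h] P.smult_l_distr in \<open>auto simp: free_module_simps\<close>)
    also have "\<dots> = (\<Oplus>\<^bsub>P\<^esub>p\<in>?B. g p \<odot>\<^bsub>P\<^esub> f p) \<oplus>\<^bsub>P\<^esub> (\<Oplus>\<^bsub>P\<^esub>p\<in>?B. h p \<odot>\<^bsub>P\<^esub> f p)"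
      by (rule P.M.finsum_addf) (use clo in blast)+
    also have "\<dots> = free_lift K P f g \<oplus>\<^bsub>P\<^esub> free_lift K P f h"
      using free_lift_superset[OF assms g B(1) _ B(2)] free_lift_superset[OF assms h B(1) _ B(2)]
      by auto
    finally show ?thesis .
  qed
  show "free_lift K P f (r \<odot>\<^bsub>free_module K X\<^esub> g) = r \<odot>\<^bsub>P\<^esub> free_lift K P f g"
    if r: "r \<in> carrier K" and g: "g \<in> carrier (free_module K X)" for r g
  proof -
    let ?B = "{p. g p \<noteq> \<zero>\<^bsub>K\<^esub>}"
    have fB: "f p \<in> carrier P" if "p \<in> ?B" for p using that supp(2)[OF g] fX by blast
    have "free_lift K P f (r \<odot>\<^bsub>free_module K X\<^esub> g) =
        (\<Oplus>\<^bsub>P\<^esub>p\<in>?B. (r \<odot>\<^bsub>free_module K X\<^esub> g) p \<odot>\<^bsub>P\<^esub> f p)"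
      by (rule free_lift_superset[OF assms F.smult_closed[OF r g] supp(1)[OF g] _ supp(2)[OF g]])
        (use r in \<open>auto simp: free_module_simps\<close>)
    also have "\<dots> = (\<Oplus>\<^bsub>P\<^esub>p\<in>?B. r \<odot>\<^bsub>P\<^esub> (g p \<odot>\<^bsub>P\<^esub> f p))"
      by (rule P.M.finsum_cong')
        (use fB r supp(3)[OF g] in \<open>auto simp: free_module_simps P.smult_assoc1\<close>)
    also have "\<dots> = r \<odot>\<^bsub>P\<^esub> free_lift K P f g"
      unfolding free_lift_def
      by (rule P.finsum_smult_ldistr[symmetric]) (use r fB supp[OF g] in auto)
    finally show ?thesis .
  qed
qed

lemma free_lift_gen:
  assumes "module K P" "x \<in> X" "f \<in> X \<rightarrow> carrier P"
  shows "free_lift K P f (free_gen K x) = f x"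
proof -
  interpret P: module K P by fact
  have fx: "f x \<in> carrier P" using assms by auto
  have "free_lift K P f (free_gen K x) = (\<Oplus>\<^bsub>P\<^esub>p\<in>{x}. free_gen K x p \<odot>\<^bsub>P\<^esub> f p)"
    by (rule free_lift_superset[OF assms(1,3) free_gen_closed[OF P.is_cring assms(2)]])
      (use assms in \<open>auto simp: free_gen_def\<close>)
  then show ?thesis using fx by (simp add: free_gen_def)
qed

text \<open>An element of the free module is the finite sum of its values times the generators, so a
  linear map is fixed by its values on generators.\<close>

lemma free_lift_unique:
  assumes "module K P" "f \<in> linear_maps K (free_module K X) P" "g \<in> carrier (free_module K X)"
  shows "f g = free_lift K P (\<lambda>x. f (free_gen K x)) g"
proof -
  interpret P: module K P by fact
  interpret F: module K "free_module K X" using P.is_cring by (rule module_free)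
  let ?S = "{p. g p \<noteq> \<zero>\<^bsub>K\<^esub>}" and ?F = "free_module K X"
  have S: "finite ?S" "?S \<subseteq> X" "\<And>p. g p \<in> carrier K"
    using assms(3) by (auto simp: free_module_simps)
  have gen: "free_gen K p \<in> carrier ?F" if "p \<in> X" for p
    by (rule free_gen_closed[OF P.is_cring that])
  \<comment> \<open>Stated for every finite subset instead of the support alone, so that the
    induction goes through.\<close>
  have val: "(\<Oplus>\<^bsub>?F\<^esub>p\<in>B. g p \<odot>\<^bsub>?F\<^esub> free_gen K p) x = (if x \<in> B then g x else \<zero>\<^bsub>K\<^esub>)"
    if "finite B" "B \<subseteq> X" for x B
    using that
  proof (induction B)
    case empty
    then show ?case by (simp add: free_module_simps)
  next
    case (insert y B)
    have "(\<Oplus>\<^bsub>?F\<^esub>p\<in>insert y B. g p \<odot>\<^bsub>?F\<^esub> free_gen K p) =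
      g y \<odot>\<^bsub>?F\<^esub> free_gen K y \<oplus>\<^bsub>?F\<^esub> (\<Oplus>\<^bsub>?F\<^esub>p\<in>B. g p \<odot>\<^bsub>?F\<^esub> free_gen K p)"
      by (rule F.M.finsum_insert) (use insert S gen in auto)
    then show ?case
      using insert S(3) by (auto simp: free_module_simps free_gen_def)
  qed
  have "(\<Oplus>\<^bsub>?F\<^esub>p\<in>?S. g p \<odot>\<^bsub>?F\<^esub> free_gen K p) = g"
    using val[OF S(1,2)] by (auto intro!: ext)
  then have "f g = f (\<Oplus>\<^bsub>?F\<^esub>p\<in>?S. g p \<odot>\<^bsub>?F\<^esub> free_gen K p)" by simp
  also have "\<dots> = (\<Oplus>\<^bsub>P\<^esub>p\<in>?S. f (g p \<odot>\<^bsub>?F\<^esub> free_gen K p))"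
    by (rule linear_finsum[OF F.module_axioms assms(1,2)]) (use gen S in auto)
  also have "\<dots> = free_lift K P (\<lambda>x. f (free_gen K x)) g"
    unfolding free_lift_def
    by (rule P.M.finsum_cong')
      (use gen S linear_smult[OF assms(2)] linear_closed[OF assms(2)] in auto)
  finally show ?thesis .
qed

subsection \<open>The tensor product\<close>

text \<open>The twisted square and the double share the module part of \<open>H \<otimes> H\<close>
  but are other records. This lemma and the next two identify the notions built from that
  part.\<close>

lemma tensor_cong:
  assumes "carrier M = carrier M'" "add M = add M'" "smult M = smult M'"
    and "carrier N = carrier N'" "add N = add N'" "smult N = smult N'"
  shows "tensor_module K M N = tensor_module K M' N'" "pure_tensor K M N = pure_tensor K M' N'"
  using assms
  by (simp_all add: tensor_module_def tensor_null_def tensor_relations_def pure_tensor_def fun_eq_iff)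

lemma module_cong:
  assumes "module K M" "carrier M = carrier M'" "zero M = zero M'" "add M = add M'" "smult M = smult M'"
  shows "module K M'"
proof -
  interpret M: module K M by fact
  show ?thesis
  proof (rule moduleI)
    show "abelian_group M'"
    proof (rule abelian_groupI)
      show "\<exists>y\<in>carrier M'. y \<oplus>\<^bsub>M'\<^esub> x = \<zero>\<^bsub>M'\<^esub>" if "x \<in> carrier M'" for x
        using that by (intro bexI[of _ "\<ominus>\<^bsub>M\<^esub> x"]) (simp_all add: assms(2-5)[symmetric] M.l_neg)
    qed (simp_all add: assms(2-5)[symmetric] M.a_ac)
  qed (simp_all add: assms(2-5)[symmetric] M.smult_l_distr M.smult_r_distr M.smult_assoc1 M.is_cring)
qed

lemma tensor_lift_module_cong:
  assumes "carrier P = carrier P'" "zero P = zero P'" "add P = add P'" "smult P = smult P'"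
  shows "tensor_lift K P f t = tensor_lift K P' f t"
  by (simp only: tensor_lift_def finsum_def finprod_def monoid.simps partial_object.simps assms)

context
  fixes K :: "('k, 'n) ring_scheme" and M :: "('k, 'a, 'p) module_scheme"
    and N :: "('k, 'b, 'q) module_scheme"
  assumes M: "module K M" and N: "module K N"
begin

private abbreviation (input) "F \<equiv> free_module K (carrier M \<times> carrier N)"

interpretation M: module K M by (rule M)
interpretation N: module K N by (rule N)
interpretation F: module K F using M.is_cring by (rule module_free)

lemma tensor_relations_closed: "tensor_relations K M N \<subseteq> carrier F"
  unfolding tensor_relations_def Let_def a_minus_def
  by (auto intro!: F.a_closed F.a_inv_closed F.smult_closed free_gen_closed M.is_cring)

lemma submodule_tensor_null: "submodule (tensor_null K M N) K F"
proof -
  let ?\<U> = "{U. submodule U K F \<and> tensor_relations K M N \<subseteq> U}"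
  \<comment> \<open>The family of submodules has a member, without which its intersection would be
    the whole type.\<close>
  have "carrier F \<in> ?\<U>"
    using F.carrier_is_submodule tensor_relations_closed by blast
  moreover have "\<zero>\<^bsub>F\<^esub> \<in> U" if "submodule U K F" for U
    using subgroup.one_closed[OF submodule.axioms(1)[OF that]] by simp
  ultimately show ?thesis
    unfolding tensor_null_def
    by (intro F.submoduleI) (blast intro: F.submoduleE(3,4,5))+
qed

lemma tensor_null_least:
  "\<lbrakk>submodule U K F; tensor_relations K M N \<subseteq> U\<rbrakk> \<Longrightarrow> tensor_null K M N \<subseteq> U"
  by (auto simp: tensor_null_def)

lemma tensor_relations_null: "tensor_relations K M N \<subseteq> tensor_null K M N"
  by (auto simp: tensor_null_def)

interpretation U: abelian_subgroup "tensor_null K M N" F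
  by (intro abelian_subgroupI3 additive_subgroupI F.abelian_group_axioms
      submodule.axioms(1)[OF submodule_tensor_null])

private abbreviation (input) "coset g \<equiv> tensor_null K M N +>\<^bsub>F\<^esub> g"

lemma tensor_carrier: "carrier (tensor_module K M N) = a_rcosets\<^bsub>F\<^esub> tensor_null K M N"
  and tensor_add: "add (tensor_module K M N) = set_add F"
  and tensor_zero: "zero (tensor_module K M N) = tensor_null K M N"
  by (simp_all add: tensor_module_def Let_def)

lemma tensorE:
  assumes "t \<in> carrier (tensor_module K M N)"
  obtains g where "g \<in> carrier F" "t = coset g"
  using assms by (auto simp: tensor_carrier A_RCOSETS_def')

lemma coset_closed: "g \<in> carrier F \<Longrightarrow> coset g \<in> carrier (tensor_module K M N)"
  by (simp add: tensor_carrier F.a_rcosetsI U.a_subset)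

lemma coset_add:
  "\<lbrakk>g \<in> carrier F; h \<in> carrier F\<rbrakk> \<Longrightarrow>
    coset g \<oplus>\<^bsub>tensor_module K M N\<^esub> coset h = coset (g \<oplus>\<^bsub>F\<^esub> h)"
  by (simp add: tensor_add U.a_rcos_sum)

lemma coset_self: "g \<in> carrier F \<Longrightarrow> g \<in> coset g"
  by (rule U.a_rcos_self)

lemma coset_eqI:
  assumes "g \<in> carrier F" "h \<in> carrier F" "h \<ominus>\<^bsub>F\<^esub> g \<in> tensor_null K M N"
  shows "coset g = coset h"
  using assms by (intro U.a_repr_independence' U.a_rcos_module_rev) (auto simp: a_minus_def)

lemma coset_mem:
  assumes "g \<in> carrier F" "h \<in> coset g"
  shows "h \<in> carrier F" and "h \<ominus>\<^bsub>F\<^esub> g \<in> tensor_null K M N"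
  using assms U.a_rcos_module_imp F.M.a_r_coset_subset_G[OF U.a_subset assms(1)]
  by (auto simp: a_minus_def)

text \<open>The scalar action is defined as a union over all representatives; any two of them yield
  the same coset, so the union collapses.\<close>

lemma coset_smult:
  assumes "r \<in> carrier K" "g \<in> carrier F"
  shows "r \<odot>\<^bsub>tensor_module K M N\<^esub> coset g = coset (r \<odot>\<^bsub>F\<^esub> g)"
proof -
  have "coset (r \<odot>\<^bsub>F\<^esub> h) = coset (r \<odot>\<^bsub>F\<^esub> g)" if "h \<in> coset g" for h
  proof (rule coset_eqI[symmetric])
    note h = coset_mem[OF assms(2) that]
    have "r \<odot>\<^bsub>F\<^esub> (h \<ominus>\<^bsub>F\<^esub> g) \<in> tensor_null K M N"
      using h assms by (intro submodule.smult_closed[OF submodule_tensor_null])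
    then show "r \<odot>\<^bsub>F\<^esub> h \<ominus>\<^bsub>F\<^esub> r \<odot>\<^bsub>F\<^esub> g \<in> tensor_null K M N"
      using h assms by (simp add: a_minus_def F.smult_r_distr F.smult_r_minus)
  qed (use coset_mem[OF assms(2) that] assms in auto)
  then have "(\<Union>h\<in>coset g. coset (r \<odot>\<^bsub>F\<^esub> h)) = coset (r \<odot>\<^bsub>F\<^esub> g)"
    using coset_self[OF assms(2)] by (intro SUP_eq_const) blast+
  then show ?thesis by (simp add: tensor_module_def Let_def)
qed

lemma module_tensor: "module K (tensor_module K M N)"
proof (rule moduleI)
  have zero: "\<zero>\<^bsub>tensor_module K M N\<^esub> = coset \<zero>\<^bsub>F\<^esub>"
    by (simp add: tensor_zero U.a_subset)
  show "abelian_group (tensor_module K M N)"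
  proof (rule abelian_groupI)
    show "\<exists>y\<in>carrier (tensor_module K M N).
        y \<oplus>\<^bsub>tensor_module K M N\<^esub> x = \<zero>\<^bsub>tensor_module K M N\<^esub>"
      if "x \<in> carrier (tensor_module K M N)" for x
    proof -
      obtain g where "g \<in> carrier F" "x = coset g" using \<open>x \<in> _\<close> by (rule tensorE)
      then show ?thesis
        by (intro bexI[of _ "coset (\<ominus>\<^bsub>F\<^esub> g)"]) (simp_all add: coset_add coset_closed zero F.M.l_neg)
    qed
  qed (auto elim!: tensorE simp: coset_add coset_closed zero F.M.a_ac)
  show "\<one>\<^bsub>K\<^esub> \<odot>\<^bsub>tensor_module K M N\<^esub> x = x" if "x \<in> carrier (tensor_module K M N)" for x
    using that by (elim tensorE) (simp add: coset_smult)
qed (auto elim!: tensorE simp: M.is_cring coset_smult coset_add coset_closed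
      F.smult_l_distr F.smult_r_distr F.smult_assoc1)

interpretation T: module K "tensor_module K M N" by (rule module_tensor)

lemma coset_linear: "(\<lambda>g. coset g) \<in> linear_maps K F (tensor_module K M N)"
  by (rule linear_mapsI) (simp_all add: coset_closed coset_add coset_smult)

text \<open>Each law of bilinearity is one of the four families of relations, and these lie in the
  null submodule.\<close>

lemma pure_bilinear: "pure_tensor K M N \<in> bilinear_maps K M N (tensor_module K M N)"
proof -
  have rel: "coset g = coset h" if "g \<in> carrier F" "h \<in> carrier F"
    "h \<ominus>\<^bsub>F\<^esub> g \<in> tensor_relations K M N" for g h
    using that tensor_relations_null by (intro coset_eqI) auto
  have gen: "free_gen K (x, y) \<in> carrier F" if "x \<in> carrier M" "y \<in> carrier N" for x y
    using that by (intro free_gen_closed M.is_cring) auto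
  show ?thesis
  proof (intro bilinear_mapsI linear_mapsI)
    fix x y assume x: "x \<in> carrier M" and y: "y \<in> carrier N"
    show "pure_tensor K M N x y \<in> carrier (tensor_module K M N)"
         "pure_tensor K M N x y \<in> carrier (tensor_module K M N)"
      unfolding pure_tensor_def using x y by (simp_all add: coset_closed gen)
    fix z assume z: "z \<in> carrier N"
    show "pure_tensor K M N x (y \<oplus>\<^bsub>N\<^esub> z) =
      pure_tensor K M N x y \<oplus>\<^bsub>tensor_module K M N\<^esub> pure_tensor K M N x z"
      unfolding pure_tensor_def using x y z
      by (simp add: coset_add gen)
        (intro rel[symmetric]; (simp add: gen; fail | unfold tensor_relations_def Let_def, blast))
  next
    fix x y z assume x: "x \<in> carrier M" and y: "y \<in> carrier N" and z: "z \<in> carrier M"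
    show "pure_tensor K M N (x \<oplus>\<^bsub>M\<^esub> z) y =
      pure_tensor K M N x y \<oplus>\<^bsub>tensor_module K M N\<^esub> pure_tensor K M N z y"
      unfolding pure_tensor_def using x y z
      by (simp add: coset_add gen)
        (intro rel[symmetric]; (simp add: gen; fail | unfold tensor_relations_def Let_def, blast))
  next
    fix x y r assume x: "x \<in> carrier M" and y: "y \<in> carrier N" and r: "r \<in> carrier K"
    show "pure_tensor K M N (r \<odot>\<^bsub>M\<^esub> x) y = r \<odot>\<^bsub>tensor_module K M N\<^esub> pure_tensor K M N x y"
      unfolding pure_tensor_def using x y r
      by (simp add: coset_smult gen)
        (intro rel[symmetric]; (simp add: gen; fail | unfold tensor_relations_def Let_def, blast))
    show "pure_tensor K M N x (r \<odot>\<^bsub>N\<^esub> y) = r \<odot>\<^bsub>tensor_module K M N\<^esub> pure_tensor K M N x y"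
      unfolding pure_tensor_def using x y r
      by (simp add: coset_smult gen)
        (intro rel[symmetric]; (simp add: gen; fail | unfold tensor_relations_def Let_def, blast))
  qed
qed

context
  fixes P :: "('k, 'c, 'r) module_scheme" and f
  assumes P: "module K P" and f: "f \<in> bilinear_maps K M N P"
begin

interpretation P: module K P by (rule P)

private abbreviation (input) "ev \<equiv> free_lift K P (\<lambda>p. f (fst p) (snd p))"

private lemma f_Pi: "(\<lambda>p. f (fst p) (snd p)) \<in> carrier M \<times> carrier N \<rightarrow> carrier P"
  using bilinear_closed[OF f] by auto

private lemma ev_linear: "ev \<in> linear_maps K F P"
  by (rule free_lift_linear[OF P f_Pi])

private lemma ev_gen: "\<lbrakk>x \<in> carrier M; y \<in> carrier N\<rbrakk> \<Longrightarrow> ev (free_gen K (x, y)) = f x y"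
  using free_lift_gen[OF P _ f_Pi, of "(x, y)"] by simp

private lemma ev_minus:
  assumes "g \<in> carrier F" "h \<in> carrier F"
  shows "ev (g \<ominus>\<^bsub>F\<^esub> h) = ev g \<ominus>\<^bsub>P\<^esub> ev h"
proof -
  have "ev (g \<ominus>\<^bsub>F\<^esub> h) = ev (g \<oplus>\<^bsub>F\<^esub> (\<ominus>\<^bsub>K\<^esub> \<one>\<^bsub>K\<^esub>) \<odot>\<^bsub>F\<^esub> h)"
    using assms by (simp add: a_minus_def F.smult_l_minus)
  also have "\<dots> = ev g \<ominus>\<^bsub>P\<^esub> ev h"
    using assms ev_linear linear_closed[OF ev_linear]
    by (simp add: linear_add[OF ev_linear] linear_smult[OF ev_linear] P.smult_l_minus a_minus_def)
  finally show ?thesis .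
qed

text \<open>The kernel of the evaluation is a submodule that contains the bilinearity relations,
  hence it contains the submodule they generate.\<close>

private lemma ev_null: "g \<in> tensor_null K M N \<Longrightarrow> ev g = \<zero>\<^bsub>P\<^esub>"
proof -
  let ?U = "{g \<in> carrier F. ev g = \<zero>\<^bsub>P\<^esub>}"
  have "submodule ?U K F"
  proof (rule F.submoduleI)
    show "\<ominus>\<^bsub>F\<^esub> g \<in> ?U" if "g \<in> ?U" for g
      using that ev_minus[of "\<zero>\<^bsub>F\<^esub>" g] linear_zero[OF F.module_axioms P ev_linear]
      by (auto simp: a_minus_def)
  qed (auto simp: linear_add[OF ev_linear] linear_smult[OF ev_linear]
        linear_zero[OF F.module_axioms P ev_linear])
  moreover have "tensor_relations K M N \<subseteq> ?U"
  proof -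
    have gen: "free_gen K (x, y) \<in> carrier F" if "x \<in> carrier M" "y \<in> carrier N" for x y
      using that by (intro free_gen_closed M.is_cring) auto
    have ev0: "ev (g \<ominus>\<^bsub>F\<^esub> h) = \<zero>\<^bsub>P\<^esub>"
      if "g \<in> carrier F" "h \<in> carrier F" "ev g = ev h" for g h
      using that linear_closed[OF ev_linear] by (simp add: ev_minus P.M.minus_eq P.M.r_neg)
    have f_simps: "f (x \<oplus>\<^bsub>M\<^esub> x') y = f x y \<oplus>\<^bsub>P\<^esub> f x' y"
      "f x (y \<oplus>\<^bsub>N\<^esub> y') = f x y \<oplus>\<^bsub>P\<^esub> f x y'"
      "r \<in> carrier K \<Longrightarrow> f (r \<odot>\<^bsub>M\<^esub> x) y = r \<odot>\<^bsub>P\<^esub> f x y"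
      "r \<in> carrier K \<Longrightarrow> f x (r \<odot>\<^bsub>N\<^esub> y) = r \<odot>\<^bsub>P\<^esub> f x y"
      if "x \<in> carrier M" "y \<in> carrier N" "x' \<in> carrier M" "y' \<in> carrier N" for x y x' y' r
      using that linear_add[OF bilinear_left[OF f]] linear_add[OF bilinear_right[OF f]]
        linear_smult[OF bilinear_left[OF f]] linear_smult[OF bilinear_right[OF f]] by auto
    have "g \<in> carrier F \<and> ev g = \<zero>\<^bsub>P\<^esub>" if "g \<in> tensor_relations K M N" for g
      using that unfolding tensor_relations_def Let_def
      by (auto intro!: ev0 F.M.minus_closed
          simp: gen linear_add[OF ev_linear] linear_smult[OF ev_linear] ev_gen f_simps)
    then show ?thesis by auto
  qed
  ultimately show "g \<in> tensor_null K M N \<Longrightarrow> ev g = \<zero>\<^bsub>P\<^esub>"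
    using tensor_null_least by blast
qed

text \<open>The representative picked by \<open>SOME\<close> differs from \<open>g\<close> by a null
  element, which the evaluation kills.\<close>

lemma tensor_lift_coset: "g \<in> carrier F \<Longrightarrow> tensor_lift K P f (coset g) = ev g"
proof -
  assume g: "g \<in> carrier F"
  define h where "h = (SOME h. h \<in> coset g)"
  have h: "h \<in> coset g"
    unfolding h_def by (rule someI[of _ g]) (rule coset_self[OF g])
  note h' = coset_mem[OF g h]
  have "ev h \<ominus>\<^bsub>P\<^esub> ev g = \<zero>\<^bsub>P\<^esub>"
    using ev_null[OF h'(2)] ev_minus[OF h'(1) g] by simp
  then have "ev h = ev g"
    using linear_closed[OF ev_linear] g h'(1) P.M.a_assoc[of "ev h" "\<ominus>\<^bsub>P\<^esub> ev g" "ev g"]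
    by (simp add: P.M.minus_eq P.M.l_neg)
  then show ?thesis
    by (simp add: tensor_lift_def free_lift_def h_def)
qed

lemma tensor_lift_pure:
  "\<lbrakk>x \<in> carrier M; y \<in> carrier N\<rbrakk> \<Longrightarrow> tensor_lift K P f (pure_tensor K M N x y) = f x y"
  unfolding pure_tensor_def
  by (subst tensor_lift_coset) (auto intro!: free_gen_closed M.is_cring simp: ev_gen)

lemma tensor_lift_linear: "tensor_lift K P f \<in> linear_maps K (tensor_module K M N) P"
  by (rule linear_mapsI)
    (auto elim!: tensorE simp: coset_add coset_smult tensor_lift_coset
      linear_closed[OF ev_linear] linear_add[OF ev_linear] linear_smult[OF ev_linear])

end

text \<open>Composed with the quotient map, \<open>f\<close> and \<open>g\<close> become linear maps
  on the free module that agree on generators. This reduces every identity between linear maps on a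
  tensor product to pure tensors.\<close>

lemma tensor_ext:
  assumes P: "module K P" and f: "f \<in> linear_maps K (tensor_module K M N) P"
    and g: "g \<in> linear_maps K (tensor_module K M N) P"
    and eq: "\<And>x y. \<lbrakk>x \<in> carrier M; y \<in> carrier N\<rbrakk> \<Longrightarrow>
      f (pure_tensor K M N x y) = g (pure_tensor K M N x y)"
    and t: "t \<in> carrier (tensor_module K M N)"
  shows "f t = g t"
proof -
  obtain h where h: "h \<in> carrier F" "t = coset h" using t by (rule tensorE)
  have *: "f' t = free_lift K P (\<lambda>x. f' (coset (free_gen K x))) h"
    if "f' \<in> linear_maps K (tensor_module K M N) P" for f'
    using free_lift_unique[OF P linear_compose[OF that coset_linear] h(1)] h(2) by simp
  have "free_lift K P (\<lambda>x. f (coset (free_gen K x))) h =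
    free_lift K P (\<lambda>x. g (coset (free_gen K x))) h"
  proof -
    interpret P: module K P by (rule P)
    have "x \<in> carrier M \<times> carrier N" if "h x \<noteq> \<zero>\<^bsub>K\<^esub>" for x
      using h(1) that unfolding free_module_simps by blast
    then have supp: "f (coset (free_gen K x)) = g (coset (free_gen K x))"
      "g (coset (free_gen K x)) \<in> carrier P" if "h x \<noteq> \<zero>\<^bsub>K\<^esub>" for x
      using that eq[of "fst x" "snd x"] free_gen_closed[OF M.is_cring, of x "carrier M \<times> carrier N"]
        linear_closed[OF g coset_closed] by (auto simp: pure_tensor_def mem_Times_iff)
    have "h x \<in> carrier K" for x
      using h(1) unfolding free_module_simps by blast
    then show ?thesis unfolding free_lift_def
      by (intro P.M.finsum_cong') (auto simp: supp)
  qed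
  then show ?thesis using *[OF f] *[OF g] by simp
qed

text \<open>
  The value of \<open>tensor_lift\<close> is a concrete finite sum even for functions that are not bilinear.
\<close>

lemma tensor_lift_sum:
  assumes "t \<in> carrier (tensor_module K M N)"
  obtains I :: "('a \<times> 'b) set" and c where "finite I"
    "\<And>p. p \<in> I \<Longrightarrow> fst p \<in> carrier M \<and> snd p \<in> carrier N \<and> c p \<in> carrier K"
    "\<And>(P :: ('k, 'c, 'r) module_scheme) f.
      tensor_lift K P f t = (\<Oplus>\<^bsub>P\<^esub>p\<in>I. c p \<odot>\<^bsub>P\<^esub> f (fst p) (snd p))"
    "\<And>(P :: ('k, 'd, 's) module_scheme) f.
      tensor_lift K P f t = (\<Oplus>\<^bsub>P\<^esub>p\<in>I. c p \<odot>\<^bsub>P\<^esub> f (fst p) (snd p))"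
proof -
  obtain g where g: "g \<in> carrier F" "t = coset g" using assms by (rule tensorE)
  define h where "h = (SOME h. h \<in> t)"
  have "h \<in> coset g"
    unfolding h_def g(2) by (rule someI[of _ g]) (rule coset_self[OF g(1)])
  then have h: "h \<in> carrier F" using coset_mem[OF g(1)] by blast
  have "fst p \<in> carrier M \<and> snd p \<in> carrier N \<and> h p \<in> carrier K" if "h p \<noteq> \<zero>\<^bsub>K\<^esub>" for p
    using h that unfolding free_module_simps mem_Times_iff[symmetric] conj_assoc[symmetric] by blast
  then show ?thesis
    by (intro that[of "{p. h p \<noteq> \<zero>\<^bsub>K\<^esub>}" h])
      (use h in \<open>auto simp: tensor_lift_def h_def[symmetric] free_module_simps\<close>)
qed

end

context
  fixes K :: "('k, 'n) ring_scheme" and M :: "('k, 'a, 'p) module_scheme"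
    and N :: "('k, 'b, 'q) module_scheme" and t
  assumes M: "module K M" and N: "module K N" and t: "t \<in> carrier (tensor_module K M N)"
begin

lemma tensor_lift_cong:
  fixes P :: "('k, 'c, 'r) module_scheme"
  assumes eq: "\<And>x y. \<lbrakk>x \<in> carrier M; y \<in> carrier N\<rbrakk> \<Longrightarrow> f x y = g x y"
  shows "tensor_lift K P f t = tensor_lift K P g t"
proof -
  obtain I :: "('a \<times> 'b) set" and c
    where I: "\<And>p. p \<in> I \<Longrightarrow> fst p \<in> carrier M \<and> snd p \<in> carrier N \<and> c p \<in> carrier K"
    and sum: "\<And>(P :: ('k, 'c, 'r) module_scheme) f.
      tensor_lift K P f t = (\<Oplus>\<^bsub>P\<^esub>p\<in>I. c p \<odot>\<^bsub>P\<^esub> f (fst p) (snd p))"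
    by (rule tensor_lift_sum[OF M N t, where ?'c = 'c and ?'d = 'c and ?'r = 'r and ?'s = 'r]) blast
  show ?thesis unfolding sum
    by (rule finsum_cong_unconditional) (use I eq in auto)
qed

lemma linear_tensor_lift:
  fixes P :: "('k, 'c, 'r) module_scheme" and Q :: "('k, 'd, 's) module_scheme"
  assumes P: "module K P" and Q: "module K Q" and L: "L \<in> linear_maps K P Q"
    and f: "\<And>x y. \<lbrakk>x \<in> carrier M; y \<in> carrier N\<rbrakk> \<Longrightarrow> f x y \<in> carrier P"
  shows "L (tensor_lift K P f t) = tensor_lift K Q (\<lambda>x y. L (f x y)) t"
proof -
  interpret P: module K P by fact
  \<comment> \<open>The same index set and coefficients must serve \<open>P\<close> and
    \<open>Q\<close>; this is why \<open>tensor_lift_sum\<close> provides the formula at two result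
    types.\<close>
  obtain I :: "('a \<times> 'b) set" and c
    where I: "\<And>p. p \<in> I \<Longrightarrow> fst p \<in> carrier M \<and> snd p \<in> carrier N \<and> c p \<in> carrier K"
    and sum: "\<And>(P :: ('k, 'c, 'r) module_scheme) f.
      tensor_lift K P f t = (\<Oplus>\<^bsub>P\<^esub>p\<in>I. c p \<odot>\<^bsub>P\<^esub> f (fst p) (snd p))"
      "\<And>(P :: ('k, 'd, 's) module_scheme) f.
      tensor_lift K P f t = (\<Oplus>\<^bsub>P\<^esub>p\<in>I. c p \<odot>\<^bsub>P\<^esub> f (fst p) (snd p))"
    by (rule tensor_lift_sum[OF M N t, where ?'c = 'c and ?'d = 'd and ?'r = 'r and ?'s = 's]) blast
  have "L (tensor_lift K P f t) = (\<Oplus>\<^bsub>Q\<^esub>p\<in>I. L (c p \<odot>\<^bsub>P\<^esub> f (fst p) (snd p)))"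
    unfolding sum by (rule linear_finsum[OF P Q L]) (use I f in auto)
  also have "\<dots> = tensor_lift K Q (\<lambda>x y. L (f x y)) t"
    unfolding sum by (rule finsum_cong_unconditional) (use I f in \<open>auto intro!: linear_smult[OF L]\<close>)
  finally show ?thesis .
qed

context
  fixes P :: "('k, 'c, 'r) module_scheme"
  assumes P: "module K P"
begin

interpretation P: module K P by (rule P)

lemma tensor_lift_closed:
  assumes f: "\<And>x y. \<lbrakk>x \<in> carrier M; y \<in> carrier N\<rbrakk> \<Longrightarrow> f x y \<in> carrier P"
  shows "tensor_lift K P f t \<in> carrier P"
proof -
  obtain I :: "('a \<times> 'b) set" and c
    where I: "\<And>p. p \<in> I \<Longrightarrow> fst p \<in> carrier M \<and> snd p \<in> carrier N \<and> c p \<in> carrier K"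
    and sum: "\<And>(P :: ('k, 'c, 'r) module_scheme) f.
      tensor_lift K P f t = (\<Oplus>\<^bsub>P\<^esub>p\<in>I. c p \<odot>\<^bsub>P\<^esub> f (fst p) (snd p))"
    by (rule tensor_lift_sum[OF M N t, where ?'c = 'c and ?'d = 'c and ?'r = 'r and ?'s = 'r]) blast
  show ?thesis unfolding sum by (rule P.M.finsum_closed) (use I f in auto)
qed

text \<open>Both lifts are finite sums with coefficients in a commutative ring, so this is an
  exchange of summation. It is the source of the commutation of Sweedler sums over different
  elements.\<close>

lemma tensor_lift_swap:
  assumes M': "module K M'" and N': "module K N'" and t': "t' \<in> carrier (tensor_module K M' N')"
    and f: "\<And>x y x' y'. \<lbrakk>x \<in> carrier M; y \<in> carrier N; x' \<in> carrier M'; y' \<in> carrier N'\<rbrakk> \<Longrightarrow>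
      f x y x' y' \<in> carrier P"
  shows "tensor_lift K P (\<lambda>x y. tensor_lift K P (\<lambda>x' y'. f x y x' y') t') t =
    tensor_lift K P (\<lambda>x' y'. tensor_lift K P (\<lambda>x y. f x y x' y') t) t'"
proof -
  obtain I :: "('a \<times> 'b) set" and c where fin: "finite I"
    and I: "\<And>p. p \<in> I \<Longrightarrow> fst p \<in> carrier M \<and> snd p \<in> carrier N \<and> c p \<in> carrier K"
    and sum: "\<And>(P :: ('k, 'c, 'r) module_scheme) f.
      tensor_lift K P f t = (\<Oplus>\<^bsub>P\<^esub>p\<in>I. c p \<odot>\<^bsub>P\<^esub> f (fst p) (snd p))"
    by (rule tensor_lift_sum[OF M N t, where ?'c = 'c and ?'d = 'c and ?'r = 'r and ?'s = 'r]) blast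
  obtain J and d where fin': "finite J"
    and J: "\<And>p. p \<in> J \<Longrightarrow> fst p \<in> carrier M' \<and> snd p \<in> carrier N' \<and> d p \<in> carrier K"
    and sum': "\<And>(P :: ('k, 'c, 'r) module_scheme) f.
      tensor_lift K P f t' = (\<Oplus>\<^bsub>P\<^esub>p\<in>J. d p \<odot>\<^bsub>P\<^esub> f (fst p) (snd p))"
    by (rule tensor_lift_sum[OF M' N' t', where ?'c = 'c and ?'d = 'c and ?'r = 'r and ?'s = 'r]) blast
  have "tensor_lift K P (\<lambda>x y. tensor_lift K P (\<lambda>x' y'. f x y x' y') t') t =
    (\<Oplus>\<^bsub>P\<^esub>p\<in>I. \<Oplus>\<^bsub>P\<^esub>q\<in>J. c p \<odot>\<^bsub>P\<^esub> (d q \<odot>\<^bsub>P\<^esub> f (fst p) (snd p) (fst q) (snd q)))"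
    unfolding sum sum'
    by (rule finsum_cong_unconditional, rule P.finsum_smult_ldistr) (use fin' I J f in auto)
  also have "\<dots> = (\<Oplus>\<^bsub>P\<^esub>q\<in>J. \<Oplus>\<^bsub>P\<^esub>p\<in>I. c p \<odot>\<^bsub>P\<^esub> (d q \<odot>\<^bsub>P\<^esub> f (fst p) (snd p) (fst q) (snd q)))"
    by (rule P.finsum_swap) (use fin fin' I J f in auto)
  also have "\<dots> = (\<Oplus>\<^bsub>P\<^esub>q\<in>J. \<Oplus>\<^bsub>P\<^esub>p\<in>I. d q \<odot>\<^bsub>P\<^esub> (c p \<odot>\<^bsub>P\<^esub> f (fst p) (snd p) (fst q) (snd q)))"
    by (intro finsum_cong_unconditional)
      (use I J f in \<open>simp add: P.smult_assoc1[symmetric] P.m_comm\<close>)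
  also have "\<dots> = tensor_lift K P (\<lambda>x' y'. tensor_lift K P (\<lambda>x y. f x y x' y') t) t'"
    unfolding sum sum'
    by (rule finsum_cong_unconditional, rule P.finsum_smult_ldistr[symmetric])
      (use fin I J f in auto)
  finally show ?thesis .
qed

lemma tensor_lift_linear_body:
  assumes L: "module K L"
    and F: "\<And>x y. \<lbrakk>x \<in> carrier M; y \<in> carrier N\<rbrakk> \<Longrightarrow> (\<lambda>z. F z x y) \<in> linear_maps K L P"
  shows "(\<lambda>z. tensor_lift K P (F z) t) \<in> linear_maps K L P"
proof -
  obtain I :: "('a \<times> 'b) set" and c where fin: "finite I"
    and I: "\<And>p. p \<in> I \<Longrightarrow> fst p \<in> carrier M \<and> snd p \<in> carrier N \<and> c p \<in> carrier K"
    and sum: "\<And>(P :: ('k, 'c, 'r) module_scheme) f.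
      tensor_lift K P f t = (\<Oplus>\<^bsub>P\<^esub>p\<in>I. c p \<odot>\<^bsub>P\<^esub> f (fst p) (snd p))"
    by (rule tensor_lift_sum[OF M N t, where ?'c = 'c and ?'d = 'c and ?'r = 'r and ?'s = 'r]) blast
  have F': "(\<lambda>z. F z (fst p) (snd p)) \<in> linear_maps K L P" and c: "c p \<in> carrier K" if "p \<in> I" for p
    using I[OF that] by (simp_all add: F)
  note [simp] = linear_closed[OF F'] c
  show ?thesis
    unfolding sum
  proof (rule linear_mapsI)
    fix x y assume xy: "x \<in> carrier L" "y \<in> carrier L"
    have "(\<Oplus>\<^bsub>P\<^esub>p\<in>I. c p \<odot>\<^bsub>P\<^esub> F (x \<oplus>\<^bsub>L\<^esub> y) (fst p) (snd p)) =
      (\<Oplus>\<^bsub>P\<^esub>p\<in>I. c p \<odot>\<^bsub>P\<^esub> F x (fst p) (snd p) \<oplus>\<^bsub>P\<^esub> c p \<odot>\<^bsub>P\<^esub> F y (fst p) (snd p))"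
      by (rule finsum_cong_unconditional) (use xy in \<open>simp add: linear_add[OF F'] P.smult_r_distr\<close>)
    then show "(\<Oplus>\<^bsub>P\<^esub>p\<in>I. c p \<odot>\<^bsub>P\<^esub> F (x \<oplus>\<^bsub>L\<^esub> y) (fst p) (snd p)) =
      (\<Oplus>\<^bsub>P\<^esub>p\<in>I. c p \<odot>\<^bsub>P\<^esub> F x (fst p) (snd p)) \<oplus>\<^bsub>P\<^esub> (\<Oplus>\<^bsub>P\<^esub>p\<in>I. c p \<odot>\<^bsub>P\<^esub> F y (fst p) (snd p))"
      using xy by (simp add: P.M.finsum_addf)
  next
    fix r x assume rx: "r \<in> carrier K" "x \<in> carrier L"
    have "(\<Oplus>\<^bsub>P\<^esub>p\<in>I. c p \<odot>\<^bsub>P\<^esub> F (r \<odot>\<^bsub>L\<^esub> x) (fst p) (snd p)) =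
      (\<Oplus>\<^bsub>P\<^esub>p\<in>I. r \<odot>\<^bsub>P\<^esub> (c p \<odot>\<^bsub>P\<^esub> F x (fst p) (snd p)))"
      by (rule finsum_cong_unconditional)
        (use rx in \<open>simp add: linear_smult[OF F'] P.smult_assoc1[symmetric] P.m_comm\<close>)
    then show "(\<Oplus>\<^bsub>P\<^esub>p\<in>I. c p \<odot>\<^bsub>P\<^esub> F (r \<odot>\<^bsub>L\<^esub> x) (fst p) (snd p)) =
      r \<odot>\<^bsub>P\<^esub> (\<Oplus>\<^bsub>P\<^esub>p\<in>I. c p \<odot>\<^bsub>P\<^esub> F x (fst p) (snd p))"
      using fin rx by (simp add: P.finsum_smult_ldistr)
  qed (auto intro!: P.M.finsum_closed)
qed

end

end

section \<open>Sweedler calculus\<close>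

context cring
begin

abbreviation (input) "KK \<equiv> self_module R"

lemma module_K [simp]: "module R KK"
  by (rule module_self) (rule is_cring)

lemma module_T [simp]: "\<lbrakk>module R M; module R N\<rbrakk> \<Longrightarrow> module R (tensor_module R M N)"
  by (rule module_tensor)

lemma smult_in [simp]:
  "\<lbrakk>module R P; r \<in> carrier R; x \<in> carrier P\<rbrakk> \<Longrightarrow> r \<odot>\<^bsub>P\<^esub> x \<in> carrier P"
  by (rule module.smult_closed)

lemma pure_closed [simp]:
  "\<lbrakk>module R M; module R N; x \<in> carrier M; y \<in> carrier N\<rbrakk> \<Longrightarrow>
    pure_tensor R M N x y \<in> carrier (tensor_module R M N)"
  by (rule bilinear_closed[OF pure_bilinear])

text \<open>Together with the simp rules for \<open>linear_maps\<close> that follow, this proves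
  linearity in one variable by recursion on the term, which discharges the side conditions of the
  Sweedler rules.\<close>

lemma lin_id [simp]: "(\<lambda>x. x) \<in> linear_maps R M M"
  by (rule linear_id)

lemma lin_smult_right [simp]:
  assumes "f \<in> linear_maps R M P" "module R P" "r \<in> carrier R"
  shows "(\<lambda>x. r \<odot>\<^bsub>P\<^esub> f x) \<in> linear_maps R M P"
proof -
  interpret P: module R P by fact
  show ?thesis
    using assms linear_closed[OF assms(1)]
    by (intro linear_mapsI)
      (auto simp: linear_add[OF assms(1)] linear_smult[OF assms(1)] P.smult_r_distr
        P.smult_assoc1[symmetric] m_comm)
qed

lemma lin_smult_left [simp]:
  assumes "f \<in> linear_maps R M KK" "module R P" "p \<in> carrier P"
  shows "(\<lambda>x. f x \<odot>\<^bsub>P\<^esub> p) \<in> linear_maps R M P"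
proof -
  interpret P: module R P by fact
  show ?thesis
    using assms linear_closed[OF assms(1)]
    by (intro linear_mapsI)
      (auto simp: linear_add[OF assms(1)] linear_smult[OF assms(1)] P.smult_l_distr
        P.smult_assoc1)
qed

lemma lin_mult_K [simp]:
  "\<lbrakk>f \<in> linear_maps R M KK; r \<in> carrier R\<rbrakk> \<Longrightarrow> (\<lambda>x. r \<otimes> f x) \<in> linear_maps R M KK"
  "\<lbrakk>f \<in> linear_maps R M KK; r \<in> carrier R\<rbrakk> \<Longrightarrow> (\<lambda>x. f x \<otimes> r) \<in> linear_maps R M KK"
  using lin_smult_right[of f M KK r] lin_smult_left[of f M KK r] by simp_all

lemma lin_pure [simp]:
  "\<lbrakk>f \<in> linear_maps R L M; module R M; module R N; y \<in> carrier N\<rbrakk> \<Longrightarrow>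
    (\<lambda>x. pure_tensor R M N (f x) y) \<in> linear_maps R L (tensor_module R M N)"
  "\<lbrakk>g \<in> linear_maps R L N; module R M; module R N; z \<in> carrier M\<rbrakk> \<Longrightarrow>
    (\<lambda>x. pure_tensor R M N z (g x)) \<in> linear_maps R L (tensor_module R M N)"
  by (rule linear_compose[OF bilinear_left[OF pure_bilinear]]; simp)
    (rule linear_compose[OF bilinear_right[OF pure_bilinear]]; simp)

end

text \<open>A linear comultiplication without any Hopf axiom. It makes Sweedler calculus available
  for the twisted square and in the transport argument before the structure in question is known to
  be a Hopf algebra.\<close>

locale comult_module = module K H for K (structure) and H :: "('k, 'h, 'm) hopf_scheme" (structure) +
  assumes comult_lin: "comult H \<in> linear_maps K H (tensor_module K H H)"
begin

abbreviation (input) "T \<equiv> tensor_module K H H"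
abbreviation (input) "Sw \<equiv> sweedler K H"

lemma module_H [simp]: "module K H" ..

lemma comult_closed [simp]: "x \<in> carrier H \<Longrightarrow> comult H x \<in> carrier (tensor_module K H H)"
  by (rule linear_closed[OF comult_lin])

lemma sw_closed [simp]:
  assumes "module K P" "a \<in> carrier H"
    and "\<And>x y. \<lbrakk>x \<in> carrier H; y \<in> carrier H\<rbrakk> \<Longrightarrow> F x y \<in> carrier P"
  shows "Sw P a F \<in> carrier P"
  unfolding sweedler_def by (rule tensor_lift_closed[of K H H]) (use assms in simp_all)

text \<open>As a congruence rule it supplies, under the sum, that the legs lie in the carrier; all
  rewriting of Sweedler sums depends on this.\<close>

lemma sw_cong:
  assumes "P = P'" "a = b" "b \<in> carrier H"
    and "\<And>x y. \<lbrakk>x \<in> carrier H; y \<in> carrier H\<rbrakk> \<Longrightarrow> F x y = G x y"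
  shows "Sw P a F = Sw P' b G"
  unfolding sweedler_def assms(1,2) by (rule tensor_lift_cong[of K H H]) (use assms(3,4) in simp_all)

lemma sw_swap:
  assumes "module K P" "a \<in> carrier H" "b \<in> carrier H"
    and "\<And>x y x' y'. \<lbrakk>x \<in> carrier H; y \<in> carrier H; x' \<in> carrier H; y' \<in> carrier H\<rbrakk> \<Longrightarrow>
      F x y x' y' \<in> carrier P"
  shows "Sw P a (\<lambda>x y. Sw P b (\<lambda>x' y'. F x y x' y')) =
    Sw P b (\<lambda>x' y'. Sw P a (\<lambda>x y. F x y x' y'))"
  unfolding sweedler_def
  by (rule tensor_lift_swap[of K H H _ _ H H]) (use assms in simp_all)

lemma linear_sw:
  assumes "L \<in> linear_maps K P Q" "module K P" "module K Q" "a \<in> carrier H"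
    and "\<And>x y. \<lbrakk>x \<in> carrier H; y \<in> carrier H\<rbrakk> \<Longrightarrow> F x y \<in> carrier P"
  shows "L (Sw P a F) = Sw Q a (\<lambda>x y. L (F x y))"
  unfolding sweedler_def
  by (rule linear_tensor_lift[of K H H]) (use assms in simp_all)

lemma lin_comult [simp]:
  "f \<in> linear_maps K M H \<Longrightarrow> (\<lambda>x. comult H (f x)) \<in> linear_maps K M T"
  by (rule linear_compose[OF comult_lin])

lemma lin_sw [simp]:
  assumes "f \<in> linear_maps K M H" "module K P"
    and "\<And>y. y \<in> carrier H \<Longrightarrow> (\<lambda>x. F x y) \<in> linear_maps K H P"
    and "\<And>x. x \<in> carrier H \<Longrightarrow> (\<lambda>y. F x y) \<in> linear_maps K H P"
  shows "(\<lambda>x. Sw P (f x) F) \<in> linear_maps K M P"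
  unfolding sweedler_def
  by (rule linear_compose[OF tensor_lift_linear[of K H H] lin_comult])
    (use assms in \<open>auto intro: bilinear_mapsI\<close>)

lemma lin_sw_body [simp]:
  assumes "module K M" "module K P" "a \<in> carrier H"
    and "\<And>x y. \<lbrakk>x \<in> carrier H; y \<in> carrier H\<rbrakk> \<Longrightarrow> (\<lambda>z. F z x y) \<in> linear_maps K M P"
  shows "(\<lambda>z. Sw P a (F z)) \<in> linear_maps K M P"
  unfolding sweedler_def
  by (rule tensor_lift_linear_body[of K H H]) (use assms in simp_all)

lemma sw_smult:
  assumes "module K P" "a \<in> carrier H" "r \<in> carrier K"
    and "\<And>x y. \<lbrakk>x \<in> carrier H; y \<in> carrier H\<rbrakk> \<Longrightarrow> F x y \<in> carrier P"
  shows "r \<odot>\<^bsub>P\<^esub> Sw P a F = Sw P a (\<lambda>x y. r \<odot>\<^bsub>P\<^esub> F x y)"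
  using assms by (intro linear_sw) simp_all

lemma sw_smult_left:
  assumes "module K P" "a \<in> carrier H" "p \<in> carrier P"
    and "\<And>x y. \<lbrakk>x \<in> carrier H; y \<in> carrier H\<rbrakk> \<Longrightarrow> F x y \<in> carrier K"
  shows "Sw KK a F \<odot>\<^bsub>P\<^esub> p = Sw P a (\<lambda>x y. F x y \<odot>\<^bsub>P\<^esub> p)"
  using assms by (intro linear_sw[where L = "\<lambda>r. r \<odot>\<^bsub>P\<^esub> p"]) simp_all

context
  fixes P :: "('k, 'x, 'y) module_scheme" and F
  assumes P: "module K P"
    and F1: "\<And>y. y \<in> carrier H \<Longrightarrow> (\<lambda>x. F x y) \<in> linear_maps K H P"
    and F2: "\<And>x. x \<in> carrier H \<Longrightarrow> (\<lambda>y. F x y) \<in> linear_maps K H P"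
begin

lemma tensor_lift_bilinear: "tensor_lift K P F \<in> linear_maps K T P"
    "\<lbrakk>x \<in> carrier H; y \<in> carrier H\<rbrakk> \<Longrightarrow> tensor_lift K P F (pure_tensor K H H x y) = F x y"
  using P F1 F2 by (auto intro!: tensor_lift_linear tensor_lift_pure bilinear_mapsI)

end

text \<open>The lift of the bilinear map \<open>pure_tensor\<close> is the identity, as both are
  linear and agree on pure tensors.\<close>

lemma comult_eq_sw: "comult H a = Sw T a (\<lambda>x y. pure_tensor K H H x y)" if "a \<in> carrier H"
  unfolding sweedler_def
  by (rule tensor_ext[of K H H T "\<lambda>t. t"])
    (use that in \<open>auto intro!: tensor_lift_linear pure_bilinear simp: tensor_lift_pure[OF _ _ _ pure_bilinear]\<close>)

end

sublocale hopf_algebra \<subseteq> C?: comult_module K H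
  by unfold_locales (rule comult_linear)

text \<open>
  Nested Sweedler sums over different elements commute, so a swap rule alone would loop as a
  rewrite rule. The predicates below are trivially true; they only guard the swap rule:
  \<open>before\<close> states the intended nesting order of the elements, and the congruence rule
  \<open>sw_cong_ordered\<close> passes it on to their legs. Together with coassociativity this
  rewrites nested sums to a normal form.
\<close>

definition before :: "'x \<Rightarrow> 'x \<Rightarrow> bool" where "before x y \<longleftrightarrow> True"

definition child :: "'x \<Rightarrow> 'x \<Rightarrow> bool" where "child x y \<longleftrightarrow> True"

context hopf_algebra
begin

declare sw_cong [cong]

lemmas sw_closed_K [simp] = sw_closed[where P = KK, simplified]

abbreviation (input) mulH (infixl \<open>\<cdot>\<close> 70) where "x \<cdot> y \<equiv> x \<otimes>\<^bsub>H\<^esub> y"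
abbreviation (input) tens (infix \<open>\<boxtimes>\<close> 65) where "x \<boxtimes> y \<equiv> pure_tensor K H H x y"
abbreviation (input) "\<epsilon> \<equiv> counit H"
abbreviation (input) "S \<equiv> antipode H"

lemma H_closed [simp]:
  "\<lbrakk>x \<in> carrier H; y \<in> carrier H\<rbrakk> \<Longrightarrow> x \<cdot> y \<in> carrier H"
  "\<one>\<^bsub>H\<^esub> \<in> carrier H"
  "x \<in> carrier H \<Longrightarrow> \<epsilon> x \<in> carrier K"
  "x \<in> carrier H \<Longrightarrow> S x \<in> carrier H"
  using linear_closed[OF counit_linear]
    linear_closed[OF antipode_linear] by auto

lemma lin_mult [simp]:
  assumes f: "f \<in> linear_maps K M H" and "y \<in> carrier H"
  shows "(\<lambda>x. f x \<cdot> y) \<in> linear_maps K M H" "(\<lambda>x. y \<cdot> f x) \<in> linear_maps K M H"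
  using assms(2) linear_closed[OF f]
  by (intro linear_mapsI;
      simp add: linear_add[OF f] linear_smult[OF f] H.A.l_distr H.A.r_distr
        H.smult_mult_left H.smult_mult_right)+

lemma lin_counit [simp]:
  "f \<in> linear_maps K M H \<Longrightarrow> (\<lambda>x. \<epsilon> (f x)) \<in> linear_maps K M KK"
  by (rule linear_compose[OF counit_linear])

lemma lin_antipode [simp]:
  "f \<in> linear_maps K M H \<Longrightarrow> (\<lambda>x. S (f x)) \<in> linear_maps K M H"
  by (rule linear_compose[OF antipode_linear])

text \<open>The axiom is an equation in \<open>?H3\<close>. A trilinear \<open>F\<close>, lifted
  twice, induces a linear map \<open>L\<close> on that module, and applying \<open>L\<close> to the
  two sides of the axiom gives the two sums.\<close>

lemma sw_coassoc:
  assumes P: "module K P" and a: "a \<in> carrier H"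
    and F: "\<And>y z. \<lbrakk>y \<in> carrier H; z \<in> carrier H\<rbrakk> \<Longrightarrow> (\<lambda>x. F x y z) \<in> linear_maps K H P"
      "\<And>x z. \<lbrakk>x \<in> carrier H; z \<in> carrier H\<rbrakk> \<Longrightarrow> (\<lambda>y. F x y z) \<in> linear_maps K H P"
      "\<And>x y. \<lbrakk>x \<in> carrier H; y \<in> carrier H\<rbrakk> \<Longrightarrow> (\<lambda>z. F x y z) \<in> linear_maps K H P"
  shows "Sw P a (\<lambda>x a3. Sw P x (\<lambda>a1 a2. F a1 a2 a3)) =
    Sw P a (\<lambda>a1 x. Sw P x (\<lambda>a2 a3. F a1 a2 a3))"
proof -
  let ?H2 = "tensor_module K H H" let ?H3 = "tensor_module K H ?H2"
  define G where "G x = tensor_lift K P (F x)" for x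
  have G: "G x \<in> linear_maps K T P" if "x \<in> carrier H" for x
    unfolding G_def by (rule tensor_lift_linear) (use that P F in \<open>auto intro: bilinear_mapsI\<close>)
  have G_pure: "G x (y \<boxtimes> z) = F x y z" if "x \<in> carrier H" "y \<in> carrier H" "z \<in> carrier H" for x y z
    unfolding G_def by (rule tensor_lift_pure) (use that P F in \<open>auto intro: bilinear_mapsI\<close>)
  have G': "(\<lambda>x. G x t) \<in> linear_maps K H P" if "t \<in> carrier T" for t
    unfolding G_def
    by (rule tensor_lift_linear_body[of K H H]) (use that P F in simp_all)
  define L where "L = tensor_lift K P G"
  have bil: "G \<in> bilinear_maps K H T P"
    using G G' by (auto intro: bilinear_mapsI)
  have L: "L \<in> linear_maps K ?H3 P"
    unfolding L_def by (rule tensor_lift_linear[OF _ _ P bil]) simp_all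
  have L_pure: "L (pure_tensor K H ?H2 x t) = G x t" if "x \<in> carrier H" "t \<in> carrier T" for x t
    unfolding L_def by (rule tensor_lift_pure[OF _ _ P bil]) (use that in simp_all)
  have [simp]: "F x y z \<in> carrier P" if "x \<in> carrier H" "y \<in> carrier H" "z \<in> carrier H" for x y z
    using linear_closed[OF F(1)] that by blast
  have "Sw P a (\<lambda>x a3. Sw P x (\<lambda>a1 a2. F a1 a2 a3)) =
    L (sweedler3 K H ?H3 a (\<lambda>a1 a2 a3. pure_tensor K H ?H2 a1 (a2 \<boxtimes> a3)))"
    unfolding sweedler3_def using a P
    by (simp add: linear_sw[OF L] L_pure G_pure)
  also have "\<dots> = L (Sw ?H3 a (\<lambda>a1 x. pure_tensor K H ?H2 a1 (comult H x)))"
    using coassoc[OF a] by (simp add: Let_def)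
  also have "\<dots> = Sw P a (\<lambda>a1 x. Sw P x (\<lambda>a2 a3. F a1 a2 a3))"
    using a P by (simp add: linear_sw[OF L] L_pure) (simp add: G_def sweedler_def)
  finally show ?thesis .
qed

lemma sw_counit_left:
  assumes "module K P" "f \<in> linear_maps K H P" "a \<in> carrier H"
  shows "Sw P a (\<lambda>x y. \<epsilon> x \<odot>\<^bsub>P\<^esub> f y) = f a"
proof -
  have "f a = f (Sw H a (\<lambda>x y. \<epsilon> x \<odot>\<^bsub>H\<^esub> y))"
    using counit_left assms(3) by simp
  also have "\<dots> = Sw P a (\<lambda>x y. \<epsilon> x \<odot>\<^bsub>P\<^esub> f y)"
    using assms by (simp add: linear_sw[OF assms(2)] linear_smult[OF assms(2)])
  finally show ?thesis by simp
qed

lemma sw_counit_right: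
  assumes "module K P" "f \<in> linear_maps K H P" "a \<in> carrier H"
  shows "Sw P a (\<lambda>x y. \<epsilon> y \<odot>\<^bsub>P\<^esub> f x) = f a"
proof -
  have "f a = f (Sw H a (\<lambda>x y. \<epsilon> y \<odot>\<^bsub>H\<^esub> x))"
    using counit_right assms(3) by simp
  also have "\<dots> = Sw P a (\<lambda>x y. \<epsilon> y \<odot>\<^bsub>P\<^esub> f x)"
    using assms by (simp add: linear_sw[OF assms(2)] linear_smult[OF assms(2)])
  finally show ?thesis by simp
qed

lemma sw_antipode_left:
  assumes "module K P" "f \<in> linear_maps K H P" "a \<in> carrier H"
  shows "Sw P a (\<lambda>x y. f (S x \<cdot> y)) = \<epsilon> a \<odot>\<^bsub>P\<^esub> f \<one>\<^bsub>H\<^esub>"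
  using assms linear_sw[OF assms(2), of a "\<lambda>x y. S x \<cdot> y"]
  by (simp add: antipode_left linear_smult[OF assms(2)])

lemma sw_antipode_right:
  assumes "module K P" "f \<in> linear_maps K H P" "a \<in> carrier H"
  shows "Sw P a (\<lambda>x y. f (x \<cdot> S y)) = \<epsilon> a \<odot>\<^bsub>P\<^esub> f \<one>\<^bsub>H\<^esub>"
  using assms linear_sw[OF assms(2), of a "\<lambda>x y. x \<cdot> S y"]
  by (simp add: antipode_right linear_smult[OF assms(2)])

lemma comult_mult:
  assumes "a \<in> carrier H" "b \<in> carrier H"
  shows "comult H (a \<cdot> b) = Sw T a (\<lambda>a1 a2. Sw T b (\<lambda>b1 b2. (a1 \<cdot> b1) \<boxtimes> (a2 \<cdot> b2)))"
  using assms ring_hom_mult[OF comult_ring_hom]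
  by (simp add: tensor_algebra_def Let_def sweedler_def)

lemma comult_one: "comult H \<one>\<^bsub>H\<^esub> = \<one>\<^bsub>H\<^esub> \<boxtimes> \<one>\<^bsub>H\<^esub>"
  using ring_hom_one[OF comult_ring_hom] by (simp add: tensor_algebra_def Let_def)

lemma counit_mult: "\<lbrakk>a \<in> carrier H; b \<in> carrier H\<rbrakk> \<Longrightarrow> \<epsilon> (a \<cdot> b) = \<epsilon> a \<otimes>\<^bsub>K\<^esub> \<epsilon> b"
  and counit_one [simp]: "\<epsilon> \<one>\<^bsub>H\<^esub> = \<one>\<^bsub>K\<^esub>"
  using ring_hom_mult[OF counit_ring_hom] ring_hom_one[OF counit_ring_hom] by auto

context
  fixes P :: "('a, 'x, 'y) module_scheme" and F
  assumes P: "module K P"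
    and F1: "\<And>y. y \<in> carrier H \<Longrightarrow> (\<lambda>x. F x y) \<in> linear_maps K H P"
    and F2: "\<And>x. x \<in> carrier H \<Longrightarrow> (\<lambda>y. F x y) \<in> linear_maps K H P"
begin

lemma sw_mult:
  assumes "a \<in> carrier H" "b \<in> carrier H"
  shows "Sw P (a \<cdot> b) F = Sw P a (\<lambda>a1 a2. Sw P b (\<lambda>b1 b2. F (a1 \<cdot> b1) (a2 \<cdot> b2)))"
proof -
  have "Sw P (a \<cdot> b) F =
    tensor_lift K P F (Sw T a (\<lambda>a1 a2. Sw T b (\<lambda>b1 b2. (a1 \<cdot> b1) \<boxtimes> (a2 \<cdot> b2))))"
    using assms by (simp add: sweedler_def[of _ _ _ _ F] comult_mult)
  also have "\<dots> = Sw P a (\<lambda>a1 a2. Sw P b (\<lambda>b1 b2. F (a1 \<cdot> b1) (a2 \<cdot> b2)))"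
    using assms P by (simp add: linear_sw[OF tensor_lift_bilinear(1)[OF P F1 F2]] tensor_lift_bilinear(2)[OF P F1 F2])
  finally show ?thesis .
qed

lemma sw_one: "Sw P \<one>\<^bsub>H\<^esub> F = F \<one>\<^bsub>H\<^esub> \<one>\<^bsub>H\<^esub>"
  by (simp add: sweedler_def comult_one tensor_lift_bilinear(2)[OF P F1 F2])

end

lemma sw_cong_ordered:
  assumes "P = P'" "a = b" "b \<in> carrier H"
    and "\<And>x y. \<lbrakk>x \<in> carrier H; y \<in> carrier H; child x b; child y b; before x y\<rbrakk> \<Longrightarrow> F x y = G x y"
  shows "Sw P a F = Sw P' b G"
  using assms by (intro sw_cong) (simp_all add: child_def before_def)

lemma before_child:
  "\<lbrakk>child x a; before a b\<rbrakk> \<Longrightarrow> before x b"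
  "\<lbrakk>child x a; before b a\<rbrakk> \<Longrightarrow> before b x"
  by (simp_all add: before_def)

lemma sw_swap_ordered:
  assumes "before b a" "module K P" "a \<in> carrier H" "b \<in> carrier H"
    and "\<And>x y x' y'. \<lbrakk>x \<in> carrier H; y \<in> carrier H; x' \<in> carrier H; y' \<in> carrier H\<rbrakk> \<Longrightarrow>
      F x y x' y' \<in> carrier P"
  shows "Sw P a (\<lambda>x y. Sw P b (\<lambda>x' y'. F x y x' y')) =
    Sw P b (\<lambda>x' y'. Sw P a (\<lambda>x y. F x y x' y'))"
  by (rule sw_swap[OF assms(2-)])

text \<open>Coassociativity is oriented so that the right leg is split further: iterated coproducts
  end as right combs.\<close>

lemmas sw_normalize = sw_swap_ordered before_child sw_coassoc

end

section \<open>The antipode\<close>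

context hopf_algebra
begin

abbreviation (input) tmult (infixl \<open>\<cdot>\<cdot>\<close> 70) where "s \<cdot>\<cdot> t \<equiv> s \<otimes>\<^bsub>tensor_algebra K H H\<^esub> t"

lemma tmult_inner_bilinear:
  assumes "a \<in> carrier H" "b \<in> carrier H"
  shows "(\<lambda>a' b'. (a \<cdot> a') \<boxtimes> (b \<cdot> b')) \<in> bilinear_maps K H H T"
  using assms by (auto intro!: bilinear_mapsI)

lemma tmult_outer_bilinear:
  assumes "t \<in> carrier T"
  shows "(\<lambda>a b. tensor_lift K T (\<lambda>a' b'. (a \<cdot> a') \<boxtimes> (b \<cdot> b')) t) \<in> bilinear_maps K H H T"
  using assms
  by (intro bilinear_mapsI; intro tensor_lift_linear_body[of K H H]) simp_all

lemma tmult_alt: "s \<cdot>\<cdot> t = tensor_lift K T (\<lambda>a b. tensor_lift K T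
    (\<lambda>a' b'. (a \<cdot> a') \<boxtimes> (b \<cdot> b')) t) s"
  by (simp add: tensor_algebra_def Let_def)

lemma tmult_linear_left: "t \<in> carrier T \<Longrightarrow> (\<lambda>s. s \<cdot>\<cdot> t) \<in> linear_maps K T T"
  unfolding tmult_alt by (rule tensor_lift_linear) (simp_all add: tmult_outer_bilinear)

lemma tmult_linear_right: "s \<in> carrier T \<Longrightarrow> (\<lambda>t. s \<cdot>\<cdot> t) \<in> linear_maps K T T"
  unfolding tmult_alt
  by (intro tensor_lift_linear_body[of K H H] tensor_lift_linear tmult_inner_bilinear) simp_all

lemma lin_tmult [simp]:
  "\<lbrakk>f \<in> linear_maps K M T; t \<in> carrier T\<rbrakk> \<Longrightarrow> (\<lambda>x. f x \<cdot>\<cdot> t) \<in> linear_maps K M T"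
  "\<lbrakk>f \<in> linear_maps K M T; t \<in> carrier T\<rbrakk> \<Longrightarrow> (\<lambda>x. t \<cdot>\<cdot> f x) \<in> linear_maps K M T"
  by (rule linear_compose[OF tmult_linear_left]; simp)
    (rule linear_compose[OF tmult_linear_right]; simp)

lemma tmult_closed [simp]: "\<lbrakk>s \<in> carrier T; t \<in> carrier T\<rbrakk> \<Longrightarrow> s \<cdot>\<cdot> t \<in> carrier T"
  by (rule linear_closed[OF tmult_linear_left])

lemma tmult_pure:
  "\<lbrakk>a \<in> carrier H; b \<in> carrier H; c \<in> carrier H; d \<in> carrier H\<rbrakk> \<Longrightarrow>
    (a \<boxtimes> b) \<cdot>\<cdot> (c \<boxtimes> d) = (a \<cdot> c) \<boxtimes> (b \<cdot> d)"
  unfolding tmult_alt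
  by (simp add: tensor_lift_pure[OF _ _ _ tmult_outer_bilinear]
      tensor_lift_pure[OF _ _ _ tmult_inner_bilinear])

lemma tmult_assoc:
  assumes "s \<in> carrier T" "t \<in> carrier T" "u \<in> carrier T"
  shows "s \<cdot>\<cdot> t \<cdot>\<cdot> u = s \<cdot>\<cdot> (t \<cdot>\<cdot> u)"
proof (rule tensor_ext[of K H H T "\<lambda>s. s \<cdot>\<cdot> t \<cdot>\<cdot> u"])
  fix a b assume ab: "a \<in> carrier H" "b \<in> carrier H"
  show "(a \<boxtimes> b) \<cdot>\<cdot> t \<cdot>\<cdot> u = (a \<boxtimes> b) \<cdot>\<cdot> (t \<cdot>\<cdot> u)"
  proof (rule tensor_ext[of K H H T "\<lambda>t. (a \<boxtimes> b) \<cdot>\<cdot> t \<cdot>\<cdot> u"])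
    fix c d assume cd: "c \<in> carrier H" "d \<in> carrier H"
    show "(a \<boxtimes> b) \<cdot>\<cdot> (c \<boxtimes> d) \<cdot>\<cdot> u = (a \<boxtimes> b) \<cdot>\<cdot> ((c \<boxtimes> d) \<cdot>\<cdot> u)"
      by (rule tensor_ext[of K H H T "\<lambda>u. (a \<boxtimes> b) \<cdot>\<cdot> (c \<boxtimes> d) \<cdot>\<cdot> u"])
        (use ab cd assms in \<open>simp_all add: tmult_pure H.A.m_assoc\<close>)
  qed (use ab assms in simp_all)
qed (use assms in simp_all)

lemma tmult_one:
  assumes "t \<in> carrier T"
  shows "(\<one>\<^bsub>H\<^esub> \<boxtimes> \<one>\<^bsub>H\<^esub>) \<cdot>\<cdot> t = t" "t \<cdot>\<cdot> (\<one>\<^bsub>H\<^esub> \<boxtimes> \<one>\<^bsub>H\<^esub>) = t"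
  by (rule tensor_ext[of K H H T _ "\<lambda>t. t"]; use assms in \<open>simp add: tmult_pure\<close>)+

lemma comult_tmult:
  "\<lbrakk>a \<in> carrier H; b \<in> carrier H\<rbrakk> \<Longrightarrow> comult H (a \<cdot> b) = comult H a \<cdot>\<cdot> comult H b"
  using ring_hom_mult[OF comult_ring_hom] .

text \<open>
  In the convolution algebra of linear maps from \<open>H\<close> to \<open>H \<otimes> H\<close>, both \<open>\<Delta> \<circ> S\<close> and the right-hand
  side are inverse to \<open>\<Delta>\<close>: the former from the left, the latter from the right.
\<close>

lemma comult_antipode:
  assumes a: "a \<in> carrier H"
  shows "comult H (S a) = Sw T a (\<lambda>x y. S y \<boxtimes> S x)"
proof -
  define N where "N a = Sw T a (\<lambda>x y. S y \<boxtimes> S x)" for a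
  have N [simp]: "N a \<in> carrier T" if "a \<in> carrier H" for a
    unfolding N_def using that by simp
  have N_lin [simp]: "(\<lambda>x. N (f x)) \<in> linear_maps K M T" if "f \<in> linear_maps K M H" for f
    and M :: "('a, 'm, 'q) module_scheme"
    unfolding N_def using that by simp
  let ?one = "\<one>\<^bsub>H\<^esub> \<boxtimes> \<one>\<^bsub>H\<^esub>"
  have left: "Sw T x (\<lambda>a1 a2. comult H (S a1) \<cdot>\<cdot> comult H a2) = \<epsilon> x \<odot>\<^bsub>T\<^esub> ?one"
    if "x \<in> carrier H" for x
    using sw_antipode_left[of T "comult H" x] that
    by (simp add: comult_linear comult_tmult comult_one)
  have right: "Sw T x (\<lambda>a1 a2. comult H a1 \<cdot>\<cdot> N a2) = \<epsilon> x \<odot>\<^bsub>T\<^esub> ?one"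
    if x: "x \<in> carrier H" for x
  proof -
    have "comult H u \<cdot>\<cdot> N y =
        Sw T u (\<lambda>u1 u2. Sw T y (\<lambda>p q. (u1 \<cdot> S q) \<boxtimes> (u2 \<cdot> S p)))"
      if "u \<in> carrier H" "y \<in> carrier H" for u y
    proof -
      have "comult H u \<cdot>\<cdot> N y = Sw T u (\<lambda>u1 u2. (u1 \<boxtimes> u2) \<cdot>\<cdot> N y)"
        using that by (simp add: comult_eq_sw linear_sw[OF tmult_linear_left])
      also have "\<dots> = Sw T u (\<lambda>u1 u2. Sw T y (\<lambda>p q. (u1 \<boxtimes> u2) \<cdot>\<cdot> (S q \<boxtimes> S p)))"
        using that by (simp add: N_def linear_sw[OF tmult_linear_right])
      also have "\<dots> = Sw T u (\<lambda>u1 u2. Sw T y (\<lambda>p q. (u1 \<cdot> S q) \<boxtimes> (u2 \<cdot> S p)))"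
        using that by (simp add: tmult_pure)
      finally show ?thesis .
    qed
    then have "Sw T x (\<lambda>a1 a2. comult H a1 \<cdot>\<cdot> N a2) =
        Sw T x (\<lambda>a1 y. Sw T a1 (\<lambda>u v. Sw T y (\<lambda>p q. (u \<cdot> S q) \<boxtimes> (v \<cdot> S p))))"
      using x by simp
    also have "\<dots> = Sw T x (\<lambda>u w. Sw T w (\<lambda>v y. Sw T y (\<lambda>p q. (u \<cdot> S q) \<boxtimes> (v \<cdot> S p))))"
      using x by (intro sw_coassoc) simp_all
    \<comment> \<open>\<open>v\<close> and \<open>p\<close> become the two legs of one element
      \<open>z\<close>, so that \<open>v \<cdot> S p\<close> collapses first and
      \<open>u \<cdot> S q\<close> afterwards.\<close>
    also have "\<dots> = Sw T x (\<lambda>u w. Sw T w (\<lambda>z q. Sw T z (\<lambda>v p. (u \<cdot> S q) \<boxtimes> (v \<cdot> S p))))"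
      using x by (intro sw_cong refl sw_coassoc[symmetric]) simp_all
    also have "\<dots> = Sw T x (\<lambda>u w. Sw T w (\<lambda>z q. \<epsilon> z \<odot>\<^bsub>T\<^esub> ((u \<cdot> S q) \<boxtimes> \<one>\<^bsub>H\<^esub>)))"
      using x by (intro sw_cong refl sw_antipode_right) simp_all
    also have "\<dots> = Sw T x (\<lambda>u w. (u \<cdot> S w) \<boxtimes> \<one>\<^bsub>H\<^esub>)"
      using x by (intro sw_cong refl sw_counit_left) simp_all
    also have "\<dots> = \<epsilon> x \<odot>\<^bsub>T\<^esub> ?one"
      using x by (intro sw_antipode_right) simp_all
    finally show ?thesis .
  qed
  \<comment> \<open>Uniqueness of inverses: the convolution product of
    \<open>\<Delta> \<circ> S\<close>, \<open>\<Delta>\<close> and \<open>N\<close> is bracketed in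
    both ways, using \<open>right\<close> and then \<open>left\<close>.\<close>
  have "comult H (S a) = Sw T a (\<lambda>a1 x. \<epsilon> x \<odot>\<^bsub>T\<^esub> comult H (S a1))"
    by (rule sw_counit_right[symmetric]) (use a in simp_all)
  also have "\<dots> = Sw T a (\<lambda>a1 x. comult H (S a1) \<cdot>\<cdot> (\<epsilon> x \<odot>\<^bsub>T\<^esub> ?one))"
    using a by (simp add: linear_smult[OF tmult_linear_right] tmult_one)
  also have "\<dots> = Sw T a (\<lambda>a1 x. comult H (S a1) \<cdot>\<cdot> Sw T x (\<lambda>a2 a3. comult H a2 \<cdot>\<cdot> N a3))"
    using a by (simp add: right)
  also have "\<dots> = Sw T a (\<lambda>a1 x. Sw T x (\<lambda>a2 a3. comult H (S a1) \<cdot>\<cdot> comult H a2 \<cdot>\<cdot> N a3))"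
    using a by (simp add: linear_sw[OF tmult_linear_right] tmult_assoc)
  also have "\<dots> = Sw T a (\<lambda>x a3. Sw T x (\<lambda>a1 a2. comult H (S a1) \<cdot>\<cdot> comult H a2 \<cdot>\<cdot> N a3))"
    using a by (intro sw_coassoc[symmetric]) simp_all
  also have "\<dots> = Sw T a (\<lambda>x a3. Sw T x (\<lambda>a1 a2. comult H (S a1) \<cdot>\<cdot> comult H a2) \<cdot>\<cdot> N a3)"
    using a by (simp add: linear_sw[OF tmult_linear_left])
  also have "\<dots> = Sw T a (\<lambda>x a3. \<epsilon> x \<odot>\<^bsub>T\<^esub> N a3)"
    using a by (simp add: left linear_smult[OF tmult_linear_left] tmult_one)
  also have "\<dots> = N a"
    using a by (intro sw_counit_left) simp_all
  finally show ?thesis by (simp add: N_def)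
qed

lemma sw_antipode:
  assumes "module K P" "a \<in> carrier H"
    and "\<And>y. y \<in> carrier H \<Longrightarrow> (\<lambda>x. F x y) \<in> linear_maps K H P"
    and "\<And>x. x \<in> carrier H \<Longrightarrow> (\<lambda>y. F x y) \<in> linear_maps K H P"
  shows "Sw P (S a) F = Sw P a (\<lambda>x y. F (S y) (S x))"
proof -
  note F = tensor_lift_bilinear[of P F, OF assms(1,3,4)]
  have "Sw P (S a) F = tensor_lift K P F (Sw T a (\<lambda>x y. S y \<boxtimes> S x))"
    using assms(2) by (simp add: sweedler_def[of _ _ _ _ F] comult_antipode)
  also have "\<dots> = Sw P a (\<lambda>x y. F (S y) (S x))"
    using assms(1,2) by (simp add: linear_sw[OF F(1)] F(2))
  finally show ?thesis .
qed

text \<open>Apply \<epsilon> to the left antipode axiom and let the counit absorb the second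
  leg.\<close>

lemma counit_antipode:
  assumes "a \<in> carrier H" shows "\<epsilon> (S a) = \<epsilon> a"
proof -
  have "\<epsilon> a = Sw KK a (\<lambda>x y. \<epsilon> (S x \<cdot> y))"
    using sw_antipode_left[of KK \<epsilon> a] assms by (simp add: counit_linear)
  also have "\<dots> = Sw KK a (\<lambda>x y. \<epsilon> y \<odot>\<^bsub>KK\<^esub> \<epsilon> (S x))"
    using assms by (simp add: counit_mult m_comm)
  also have "\<dots> = \<epsilon> (S a)"
    using assms by (intro sw_counit_right) simp_all
  finally show ?thesis by simp
qed

end

section \<open>The inverse antipode\<close>

locale bijective_hopf_algebra = hopf_algebra +
  assumes antipode_bij: "bij_betw (antipode H) (carrier H) (carrier H)"
begin

abbreviation (input) "R \<equiv> antipode_inv H"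

lemma R_closed [simp]: "a \<in> carrier H \<Longrightarrow> R a \<in> carrier H"
  using antipode_bij by (auto simp: antipode_inv_def bij_betw_def intro: inv_into_into)

lemma S_R [simp]: "a \<in> carrier H \<Longrightarrow> S (R a) = a"
  using antipode_bij by (auto simp: antipode_inv_def bij_betw_def intro: f_inv_into_f)

lemma R_S [simp]: "a \<in> carrier H \<Longrightarrow> R (S a) = a"
  using antipode_bij by (auto simp: antipode_inv_def bij_betw_def intro: inv_into_f_f)

lemma R_linear: "R \<in> linear_maps K H H"
proof (rule linear_mapsI)
  fix x y assume "x \<in> carrier H" "y \<in> carrier H"
  then show "R (x \<oplus>\<^bsub>H\<^esub> y) = R x \<oplus>\<^bsub>H\<^esub> R y"
    by (subst R_S[symmetric]) (auto simp: linear_add[OF antipode_linear])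
next
  fix r x assume "r \<in> carrier K" "x \<in> carrier H"
  then show "R (r \<odot>\<^bsub>H\<^esub> x) = r \<odot>\<^bsub>H\<^esub> R x"
    by (subst R_S[symmetric]) (auto simp: linear_smult[OF antipode_linear])
qed simp

lemma lin_R [simp]: "f \<in> linear_maps K M H \<Longrightarrow> (\<lambda>x. R (f x)) \<in> linear_maps K M H"
  by (rule linear_compose[OF R_linear])

text \<open>Since \<open>a = S (R a)\<close>, this is \<open>sw_antipode\<close> for
  \<open>R a\<close> read backwards.\<close>

lemma sw_R:
  assumes "module K P" "a \<in> carrier H"
    and "\<And>y. y \<in> carrier H \<Longrightarrow> (\<lambda>x. F x y) \<in> linear_maps K H P"
    and "\<And>x. x \<in> carrier H \<Longrightarrow> (\<lambda>y. F x y) \<in> linear_maps K H P"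
  shows "Sw P (R a) F = Sw P a (\<lambda>x y. F (R y) (R x))"
proof -
  have "Sw P a (\<lambda>x y. F (R y) (R x)) = Sw P (S (R a)) (\<lambda>x y. F (R y) (R x))"
    using assms(2) by simp
  also have "\<dots> = Sw P (R a) (\<lambda>x y. F (R (S x)) (R (S y)))"
    by (rule sw_antipode)
      (use assms in \<open>auto intro: linear_compose[OF _ R_linear]\<close>)
  also have "\<dots> = Sw P (R a) F"
    using assms(2) by simp
  finally show ?thesis by simp
qed

lemma counit_R: "a \<in> carrier H \<Longrightarrow> \<epsilon> (R a) = \<epsilon> a"
  using counit_antipode[of "R a"] by simp

text \<open>Writing \<open>a\<close> as \<open>S (R a)\<close> swaps the legs and turns
  \<open>R y \<cdot> x\<close> into \<open>x \<cdot> S y\<close>, so the sum becomes the right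
  antipode axiom for \<open>R a\<close>. The reversed order of legs is that of the co-opposite
  coalgebra.\<close>

lemma sw_R_left:
  assumes "module K P" "f \<in> linear_maps K H P" "a \<in> carrier H"
  shows "Sw P a (\<lambda>x y. f (R y \<cdot> x)) = \<epsilon> a \<odot>\<^bsub>P\<^esub> f \<one>\<^bsub>H\<^esub>"
proof -
  have "Sw P a (\<lambda>x y. f (R y \<cdot> x)) = Sw P (S (R a)) (\<lambda>x y. f (R y \<cdot> x))"
    using assms by simp
  also have "\<dots> = Sw P (R a) (\<lambda>x y. f (R (S x) \<cdot> S y))"
    by (rule sw_antipode) (use assms in \<open>auto intro!: linear_compose[OF assms(2)]\<close>)
  also have "\<dots> = \<epsilon> a \<odot>\<^bsub>P\<^esub> f \<one>\<^bsub>H\<^esub>"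
    using assms by (simp add: sw_antipode_right counit_R)
  finally show ?thesis .
qed

lemma sw_R_right:
  assumes "module K P" "f \<in> linear_maps K H P" "a \<in> carrier H"
  shows "Sw P a (\<lambda>x y. f (y \<cdot> R x)) = \<epsilon> a \<odot>\<^bsub>P\<^esub> f \<one>\<^bsub>H\<^esub>"
proof -
  have "Sw P a (\<lambda>x y. f (y \<cdot> R x)) = Sw P (S (R a)) (\<lambda>x y. f (y \<cdot> R x))"
    using assms by simp
  also have "\<dots> = Sw P (R a) (\<lambda>x y. f (S x \<cdot> R (S y)))"
    by (rule sw_antipode) (use assms in \<open>auto intro!: linear_compose[OF assms(2)]\<close>)
  also have "\<dots> = \<epsilon> a \<odot>\<^bsub>P\<^esub> f \<one>\<^bsub>H\<^esub>"
    using assms by (simp add: sw_antipode_left counit_R)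
  finally show ?thesis .
qed

end

section \<open>The actions induced by a Hopf pairing\<close>

context hopf_pairing
begin

lemma pairing_lin [simp]:
  "\<lbrakk>f \<in> linear_maps K M H; b \<in> carrier H\<rbrakk> \<Longrightarrow> (\<lambda>x. \<phi> (f x) b) \<in> linear_maps K M KK"
  "\<lbrakk>f \<in> linear_maps K M H; b \<in> carrier H\<rbrakk> \<Longrightarrow> (\<lambda>x. \<phi> b (f x)) \<in> linear_maps K M KK"
  using pairing_bilinear
  by (auto intro: linear_compose[OF bilinear_left] linear_compose[OF bilinear_right])

lemma pairing_closed [simp]: "\<lbrakk>a \<in> carrier H; b \<in> carrier H\<rbrakk> \<Longrightarrow> \<phi> a b \<in> carrier K"
  using bilinear_closed[OF pairing_bilinear] by simp

text \<open>This and \<open>hit_left\<close> are the standard actions of the dual algebra on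
  \<open>H\<close>, restricted to the functionals \<open>\<phi> _ b\<close>. The map from
  \<open>b\<close> to this functional is multiplicative by \<open>pairing_mult_right\<close>, which
  is why products of \<open>b\<close> become iterated actions.\<close>

definition hit_right (infixl \<open>\<leftharpoonup>\<close> 75)
  where "a \<leftharpoonup> b = Sw H a (\<lambda>x y. \<phi> x b \<odot>\<^bsub>H\<^esub> y)"

definition hit_left (infixr \<open>\<rightharpoonup>\<close> 75)
  where "b \<rightharpoonup> a = Sw H a (\<lambda>x y. \<phi> y b \<odot>\<^bsub>H\<^esub> x)"

lemma hit_closed [simp]:
  "\<lbrakk>a \<in> carrier H; b \<in> carrier H\<rbrakk> \<Longrightarrow> a \<leftharpoonup> b \<in> carrier H"
  "\<lbrakk>a \<in> carrier H; b \<in> carrier H\<rbrakk> \<Longrightarrow> b \<rightharpoonup> a \<in> carrier H"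
  by (simp_all add: hit_right_def hit_left_def)

lemma lin_hit [simp]:
  assumes "module K M" "f \<in> linear_maps K M H" "b \<in> carrier H"
  shows "(\<lambda>x. f x \<leftharpoonup> b) \<in> linear_maps K M H" "(\<lambda>x. b \<leftharpoonup> f x) \<in> linear_maps K M H"
    "(\<lambda>x. f x \<rightharpoonup> b) \<in> linear_maps K M H" "(\<lambda>x. b \<rightharpoonup> f x) \<in> linear_maps K M H"
  using assms by (simp_all add: hit_right_def hit_left_def)

text \<open>The exchange between an action and a Sweedler sum with a pairing scalar, below an
  arbitrary linear map.\<close>

lemma linear_hit_right:
  assumes "f \<in> linear_maps K H P" "module K P" "a \<in> carrier H" "b \<in> carrier H"
  shows "f (a \<leftharpoonup> b) = Sw P a (\<lambda>x y. \<phi> x b \<odot>\<^bsub>P\<^esub> f y)"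
  using assms by (simp add: hit_right_def linear_sw[OF assms(1)] linear_smult[OF assms(1)])

lemma linear_hit_left:
  assumes "f \<in> linear_maps K H P" "module K P" "a \<in> carrier H" "b \<in> carrier H"
  shows "f (b \<rightharpoonup> a) = Sw P a (\<lambda>x y. \<phi> y b \<odot>\<^bsub>P\<^esub> f x)"
  using assms by (simp add: hit_left_def linear_sw[OF assms(1)] linear_smult[OF assms(1)])

lemma hit_one:
  assumes "a \<in> carrier H"
  shows "a \<leftharpoonup> \<one>\<^bsub>H\<^esub> = a" "\<one>\<^bsub>H\<^esub> \<rightharpoonup> a = a"
  using assms counit_left counit_right by (simp_all add: hit_right_def hit_left_def pairing_one_right)

lemma one_hit:
  assumes "b \<in> carrier H"
  shows "\<one>\<^bsub>H\<^esub> \<leftharpoonup> b = \<epsilon> b \<odot>\<^bsub>H\<^esub> \<one>\<^bsub>H\<^esub>" "b \<rightharpoonup> \<one>\<^bsub>H\<^esub> = \<epsilon> b \<odot>\<^bsub>H\<^esub> \<one>\<^bsub>H\<^esub>"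
  using assms by (simp_all add: hit_right_def hit_left_def sw_one pairing_one_left)

context
  fixes P :: "('a, 'x, 'y) module_scheme" and F and a b
  assumes P: "module K P" and ab: "a \<in> carrier H" "b \<in> carrier H"
    and F1: "\<And>y. y \<in> carrier H \<Longrightarrow> (\<lambda>x. F x y) \<in> linear_maps K H P"
    and F2: "\<And>x. x \<in> carrier H \<Longrightarrow> (\<lambda>y. F x y) \<in> linear_maps K H P"
begin

private lemma F_closed [simp]: "\<lbrakk>x \<in> carrier H; y \<in> carrier H\<rbrakk> \<Longrightarrow> F x y \<in> carrier P"
  using linear_closed[OF F1] by blast

text \<open>The right action consumes the first of the three legs of \<open>a\<close>, so by
  coassociativity it touches only the first leg of the coproduct.\<close>

lemma sw_hit_right: "Sw P (a \<leftharpoonup> b) F = Sw P a (\<lambda>x y. F (x \<leftharpoonup> b) y)"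
proof -
  have "Sw P (a \<leftharpoonup> b) F = Sw P a (\<lambda>x y. \<phi> x b \<odot>\<^bsub>P\<^esub> Sw P y F)"
    using P ab F1 F2 by (intro linear_hit_right) simp_all
  also have "\<dots> = Sw P a (\<lambda>x y. Sw P y (\<lambda>u v. \<phi> x b \<odot>\<^bsub>P\<^esub> F u v))"
    using P ab by (simp add: sw_smult)
  also have "\<dots> = Sw P a (\<lambda>z v. Sw P z (\<lambda>x u. \<phi> x b \<odot>\<^bsub>P\<^esub> F u v))"
    using P ab F1 F2 by (intro sw_coassoc[symmetric]) simp_all
  also have "\<dots> = Sw P a (\<lambda>x y. F (x \<leftharpoonup> b) y)"
    using P ab by (simp add: linear_hit_right[OF F1])
  finally show ?thesis .
qed

lemma sw_hit_left: "Sw P (b \<rightharpoonup> a) F = Sw P a (\<lambda>x y. F x (b \<rightharpoonup> y))"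
proof -
  have "Sw P (b \<rightharpoonup> a) F = Sw P a (\<lambda>x y. \<phi> y b \<odot>\<^bsub>P\<^esub> Sw P x F)"
    using P ab F1 F2 by (intro linear_hit_left[where f = "\<lambda>x. Sw P x F"]) simp_all
  also have "\<dots> = Sw P a (\<lambda>x y. Sw P x (\<lambda>u v. \<phi> y b \<odot>\<^bsub>P\<^esub> F u v))"
    using P ab by (simp add: sw_smult)
  also have "\<dots> = Sw P a (\<lambda>u z. Sw P z (\<lambda>v y. \<phi> y b \<odot>\<^bsub>P\<^esub> F u v))"
    using P ab F1 F2 by (intro sw_coassoc) simp_all
  also have "\<dots> = Sw P a (\<lambda>x y. F x (b \<rightharpoonup> y))"
    using P ab by (simp add: linear_hit_left[OF F2])
  finally show ?thesis .
qed

text \<open>Both sides pair the middle one of three legs of \<open>a\<close> with \<open>b\<close>;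
  they differ in the bracketing of the coproduct.\<close>

lemma sw_hit_middle: "Sw P a (\<lambda>x y. F x (y \<leftharpoonup> b)) = Sw P a (\<lambda>x y. F (b \<rightharpoonup> x) y)"
proof -
  have "Sw P a (\<lambda>x y. F x (y \<leftharpoonup> b)) = Sw P a (\<lambda>x y. Sw P y (\<lambda>u v. \<phi> u b \<odot>\<^bsub>P\<^esub> F x v))"
    using P ab by (simp add: linear_hit_right[OF F2])
  also have "\<dots> = Sw P a (\<lambda>y v. Sw P y (\<lambda>x u. \<phi> u b \<odot>\<^bsub>P\<^esub> F x v))"
    using P ab F1 F2 by (intro sw_coassoc[symmetric]) simp_all
  also have "\<dots> = Sw P a (\<lambda>x y. F (b \<rightharpoonup> x) y)"
    using P ab by (simp add: linear_hit_left[OF F1])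
  finally show ?thesis .
qed

end

context
  fixes a b c
  assumes abc: "a \<in> carrier H" "b \<in> carrier H" "c \<in> carrier H"
begin

text \<open>The two actions consume opposite outer legs, hence do not interfere.\<close>

lemma hit_commute: "(b \<rightharpoonup> a) \<leftharpoonup> c = b \<rightharpoonup> (a \<leftharpoonup> c)"
proof -
  have "(b \<rightharpoonup> a) \<leftharpoonup> c = Sw H a (\<lambda>x y. \<phi> x c \<odot>\<^bsub>H\<^esub> (b \<rightharpoonup> y))"
    unfolding hit_right_def[of "b \<rightharpoonup> a"] using abc by (intro sw_hit_left) simp_all
  also have "\<dots> = b \<rightharpoonup> (a \<leftharpoonup> c)"
    using abc by (intro linear_hit_right[symmetric]) simp_all
  finally show ?thesis .
qed

lemma pairing_hit_right: "\<phi> (a \<leftharpoonup> b) c = \<phi> a (b \<cdot> c)"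
  using abc by (simp add: linear_hit_right[where P = KK and f = "\<lambda>x. \<phi> x c"] pairing_mult_right)

lemma pairing_hit_left: "\<phi> (c \<rightharpoonup> a) b = \<phi> a (b \<cdot> c)"
  using abc by (simp add: linear_hit_left[where P = KK and f = "\<lambda>x. \<phi> x b"] pairing_mult_right m_comm)

lemma hit_right_mult: "a \<leftharpoonup> (b \<cdot> c) = a \<leftharpoonup> b \<leftharpoonup> c"
proof -
  have "a \<leftharpoonup> b \<leftharpoonup> c = Sw H a (\<lambda>x y. \<phi> (x \<leftharpoonup> b) c \<odot>\<^bsub>H\<^esub> y)"
    unfolding hit_right_def[of "a \<leftharpoonup> b"] using abc by (intro sw_hit_right) simp_all
  also have "\<dots> = Sw H a (\<lambda>x y. \<phi> x (b \<cdot> c) \<odot>\<^bsub>H\<^esub> y)"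
    using abc by (intro sw_cong refl)
      (simp_all add: linear_hit_right[where P = KK and f = "\<lambda>x. \<phi> x c"] pairing_mult_right)
  finally show ?thesis by (simp add: hit_right_def)
qed

lemma hit_left_mult: "(b \<cdot> c) \<rightharpoonup> a = b \<rightharpoonup> c \<rightharpoonup> a"
proof -
  have "b \<rightharpoonup> c \<rightharpoonup> a = Sw H a (\<lambda>x y. \<phi> (c \<rightharpoonup> y) b \<odot>\<^bsub>H\<^esub> x)"
    unfolding hit_left_def[of b] using abc by (intro sw_hit_left) simp_all
  also have "\<dots> = Sw H a (\<lambda>x y. \<phi> y (b \<cdot> c) \<odot>\<^bsub>H\<^esub> x)"
    using abc by (intro sw_cong refl)
      (simp_all add: linear_hit_left[where P = KK and f = "\<lambda>x. \<phi> x b"] pairing_mult_right m_comm)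
  finally show ?thesis by (simp add: hit_left_def)
qed

text \<open>\<open>pairing_mult_left\<close> splits the scalar of the product through the coproduct
  of \<open>b\<close>. The rest brings the sum over \<open>b\<close> outside, so that the sums over
  \<open>a\<close> and \<open>c\<close> fold into separate actions.\<close>

lemma mult_hit_right: "(a \<cdot> c) \<leftharpoonup> b = Sw H b (\<lambda>x y. (a \<leftharpoonup> x) \<cdot> (c \<leftharpoonup> y))"
proof -
  have "(a \<cdot> c) \<leftharpoonup> b =
      Sw H a (\<lambda>a1 a2. Sw H c (\<lambda>c1 c2. \<phi> (a1 \<cdot> c1) b \<odot>\<^bsub>H\<^esub> (a2 \<cdot> c2)))"
    unfolding hit_right_def using abc by (intro sw_mult) simp_all
  also have "\<dots> = Sw H a (\<lambda>a1 a2. Sw H c (\<lambda>c1 c2.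
      Sw H b (\<lambda>x y. (\<phi> a1 x \<otimes>\<^bsub>K\<^esub> \<phi> c1 y) \<odot>\<^bsub>H\<^esub> (a2 \<cdot> c2))))"
    using abc by (simp add: pairing_mult_left sw_smult_left)
  also have "\<dots> = Sw H a (\<lambda>a1 a2. Sw H b (\<lambda>x y.
      Sw H c (\<lambda>c1 c2. (\<phi> a1 x \<otimes>\<^bsub>K\<^esub> \<phi> c1 y) \<odot>\<^bsub>H\<^esub> (a2 \<cdot> c2))))"
    using abc by (intro sw_cong refl sw_swap) simp_all
  also have "\<dots> = Sw H b (\<lambda>x y. Sw H a (\<lambda>a1 a2.
      Sw H c (\<lambda>c1 c2. (\<phi> a1 x \<otimes>\<^bsub>K\<^esub> \<phi> c1 y) \<odot>\<^bsub>H\<^esub> (a2 \<cdot> c2))))"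
    using abc by (intro sw_swap) simp_all
  also have "\<dots> = Sw H b (\<lambda>x y. Sw H a (\<lambda>a1 a2.
      \<phi> a1 x \<odot>\<^bsub>H\<^esub> Sw H c (\<lambda>c1 c2. \<phi> c1 y \<odot>\<^bsub>H\<^esub> (a2 \<cdot> c2))))"
    using abc by (simp add: sw_smult H.smult_assoc1)
  also have "\<dots> = Sw H b (\<lambda>x y. Sw H a (\<lambda>a1 a2. \<phi> a1 x \<odot>\<^bsub>H\<^esub> (a2 \<cdot> (c \<leftharpoonup> y))))"
    using abc by (simp add: linear_hit_right[where P = H and f = "\<lambda>c. x \<cdot> c" for x])
  also have "\<dots> = Sw H b (\<lambda>x y. (a \<leftharpoonup> x) \<cdot> (c \<leftharpoonup> y))"
    using abc by (simp add: linear_hit_right[where P = H and f = "\<lambda>a. a \<cdot> x" for x])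
  finally show ?thesis .
qed

lemma mult_hit_left: "b \<rightharpoonup> (a \<cdot> c) = Sw H b (\<lambda>x y. (x \<rightharpoonup> a) \<cdot> (y \<rightharpoonup> c))"
proof -
  have "b \<rightharpoonup> (a \<cdot> c) =
      Sw H a (\<lambda>a1 a2. Sw H c (\<lambda>c1 c2. \<phi> (a2 \<cdot> c2) b \<odot>\<^bsub>H\<^esub> (a1 \<cdot> c1)))"
    unfolding hit_left_def using abc by (intro sw_mult) simp_all
  also have "\<dots> = Sw H a (\<lambda>a1 a2. Sw H c (\<lambda>c1 c2.
      Sw H b (\<lambda>x y. (\<phi> a2 x \<otimes>\<^bsub>K\<^esub> \<phi> c2 y) \<odot>\<^bsub>H\<^esub> (a1 \<cdot> c1))))"
    using abc by (simp add: pairing_mult_left sw_smult_left)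
  also have "\<dots> = Sw H a (\<lambda>a1 a2. Sw H b (\<lambda>x y.
      Sw H c (\<lambda>c1 c2. (\<phi> a2 x \<otimes>\<^bsub>K\<^esub> \<phi> c2 y) \<odot>\<^bsub>H\<^esub> (a1 \<cdot> c1))))"
    using abc by (intro sw_cong refl sw_swap) simp_all
  also have "\<dots> = Sw H b (\<lambda>x y. Sw H a (\<lambda>a1 a2.
      Sw H c (\<lambda>c1 c2. (\<phi> a2 x \<otimes>\<^bsub>K\<^esub> \<phi> c2 y) \<odot>\<^bsub>H\<^esub> (a1 \<cdot> c1))))"
    using abc by (intro sw_swap) simp_all
  also have "\<dots> = Sw H b (\<lambda>x y. Sw H a (\<lambda>a1 a2.
      \<phi> a2 x \<odot>\<^bsub>H\<^esub> Sw H c (\<lambda>c1 c2. \<phi> c2 y \<odot>\<^bsub>H\<^esub> (a1 \<cdot> c1))))"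
    using abc by (simp add: sw_smult H.smult_assoc1)
  also have "\<dots> = Sw H b (\<lambda>x y. Sw H a (\<lambda>a1 a2. \<phi> a2 x \<odot>\<^bsub>H\<^esub> (a1 \<cdot> (y \<rightharpoonup> c))))"
    using abc by (simp add: linear_hit_left[where P = H and f = "\<lambda>c. x \<cdot> c" for x])
  also have "\<dots> = Sw H b (\<lambda>x y. (x \<rightharpoonup> a) \<cdot> (y \<rightharpoonup> c))"
    using abc by (simp add: linear_hit_left[where P = H and f = "\<lambda>a. a \<cdot> x" for x])
  finally show ?thesis .
qed

end

lemma counit_hit:
  assumes "a \<in> carrier H" "b \<in> carrier H"
  shows "\<epsilon> (a \<leftharpoonup> b) = \<phi> a b" "\<epsilon> (b \<rightharpoonup> a) = \<phi> a b"
  using pairing_hit_right[of a b "\<one>\<^bsub>H\<^esub>"] pairing_hit_left[of a "\<one>\<^bsub>H\<^esub>" b] assms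
  by (simp_all add: pairing_one_right)

text \<open>The antipode reverses the legs, which turns a left action into a right one, and
  \<open>pairing_antipode\<close> moves \<open>S\<close> to the acting element.\<close>

lemma hit_left_antipode:
  assumes "a \<in> carrier H" "b \<in> carrier H"
  shows "b \<rightharpoonup> S a = S (a \<leftharpoonup> S b)"
proof -
  have "b \<rightharpoonup> S a = Sw H a (\<lambda>x y. \<phi> (S x) b \<odot>\<^bsub>H\<^esub> S y)"
    unfolding hit_left_def using assms by (intro sw_antipode) simp_all
  also have "\<dots> = S (a \<leftharpoonup> S b)"
    using assms by (simp add: linear_hit_right[OF antipode_linear] pairing_antipode)
  finally show ?thesis .
qed

end

section \<open>The twisted square\<close>

locale bijective_hopf_pairing = hopf_pairing + bijective_hopf_algebra
begin

abbreviation (input) "Q \<equiv> twisted_square K H \<phi>"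
abbreviation (input) "TT \<equiv> tensor_module K T T"
abbreviation (input) tens2 (infix \<open>\<boxtimes>\<boxtimes>\<close> 64) where "s \<boxtimes>\<boxtimes> t \<equiv> pure_tensor K T T s t"
abbreviation (input) star (infixl \<open>\<star>\<close> 70) where "s \<star> t \<equiv> s \<otimes>\<^bsub>Q\<^esub> t"

lemma sw_out:
  "\<lbrakk>a \<in> carrier H; y \<in> carrier H; \<And>u v. \<lbrakk>u \<in> carrier H; v \<in> carrier H\<rbrakk> \<Longrightarrow> F u v \<in> carrier H\<rbrakk> \<Longrightarrow>
    Sw H a F \<cdot> y = Sw H a (\<lambda>u v. F u v \<cdot> y)"
  "\<lbrakk>a \<in> carrier H; y \<in> carrier H; \<And>u v. \<lbrakk>u \<in> carrier H; v \<in> carrier H\<rbrakk> \<Longrightarrow> F u v \<in> carrier H\<rbrakk> \<Longrightarrow>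
    y \<cdot> Sw H a F = Sw H a (\<lambda>u v. y \<cdot> F u v)"
  "\<lbrakk>a \<in> carrier H; y \<in> carrier H; \<And>u v. \<lbrakk>u \<in> carrier H; v \<in> carrier H\<rbrakk> \<Longrightarrow> F u v \<in> carrier H\<rbrakk> \<Longrightarrow>
    Sw H a F \<boxtimes> y = Sw T a (\<lambda>u v. F u v \<boxtimes> y)"
  "\<lbrakk>a \<in> carrier H; y \<in> carrier H; \<And>u v. \<lbrakk>u \<in> carrier H; v \<in> carrier H\<rbrakk> \<Longrightarrow> F u v \<in> carrier H\<rbrakk> \<Longrightarrow>
    y \<boxtimes> Sw H a F = Sw T a (\<lambda>u v. y \<boxtimes> F u v)"
  by (rule linear_sw[where P = H]; simp)+

definition twist_mult where
  "twist_mult a b c d =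
    Sw T b (\<lambda>b1 b2. Sw T d (\<lambda>d1 d2. ((a \<leftharpoonup> d2) \<cdot> (b1 \<rightharpoonup> c)) \<boxtimes> (b2 \<cdot> d1)))"

lemma twist_mult_closed [simp]:
  "\<lbrakk>a \<in> carrier H; b \<in> carrier H; c \<in> carrier H; d \<in> carrier H\<rbrakk> \<Longrightarrow>
    twist_mult a b c d \<in> carrier T"
  by (simp add: twist_mult_def)

lemma lin_twist_mult [simp]:
  assumes "module K M" "f \<in> linear_maps K M H" "x \<in> carrier H" "y \<in> carrier H" "z \<in> carrier H"
  shows "(\<lambda>t. twist_mult (f t) x y z) \<in> linear_maps K M T"
    "(\<lambda>t. twist_mult x (f t) y z) \<in> linear_maps K M T"
    "(\<lambda>t. twist_mult x y (f t) z) \<in> linear_maps K M T"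
    "(\<lambda>t. twist_mult x y z (f t)) \<in> linear_maps K M T"
  using assms by (simp_all add: twist_mult_def)

lemma twist_mult_eq:
  assumes "a \<in> carrier H" "b \<in> carrier H" "c \<in> carrier H" "d \<in> carrier H"
  shows "Sw T a (\<lambda>a1 a2. Sw T b (\<lambda>b1 b2. Sw T c (\<lambda>c1 c2. Sw T d (\<lambda>d1 d2.
      (\<phi> a1 d2 \<otimes>\<^bsub>K\<^esub> \<phi> c2 b1) \<odot>\<^bsub>T\<^esub> ((a2 \<cdot> c1) \<boxtimes> (b2 \<cdot> d1)))))) = twist_mult a b c d"
proof -
  interpret T: module K T by simp
  \<comment> \<open>The nesting order of the defining formula: the actions in
    \<open>twist_mult\<close> are expanded and their sums are moved into this order.\<close>
  have [simp]: "before a b" "before b c" "before c d" "before a c" "before a d" "before b d"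
    by (simp_all add: before_def)
  show ?thesis
    using assms
    by (simp add: twist_mult_def sw_normalize T.smult_assoc1[symmetric]
        linear_hit_right[where P = T and f = "\<lambda>a. (a \<cdot> y) \<boxtimes> z" for y z]
        linear_hit_left[where P = T and f = "\<lambda>a. (x \<cdot> a) \<boxtimes> z" for x z] sw_smult m_comm
      cong: sw_cong_ordered)
qed

lemma star_alt:
  assumes "s \<in> carrier T" "t \<in> carrier T"
  shows "s \<star> t = tensor_lift K T (\<lambda>a b. tensor_lift K T (\<lambda>c d. twist_mult a b c d) t) s"
proof -
  have "s \<star> t = tensor_lift K T (\<lambda>a b. tensor_lift K T (\<lambda>c d.
      Sw T a (\<lambda>a1 a2. Sw T b (\<lambda>b1 b2. Sw T c (\<lambda>c1 c2. Sw T d (\<lambda>d1 d2.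
        (\<phi> a1 d2 \<otimes>\<^bsub>K\<^esub> \<phi> c2 b1) \<odot>\<^bsub>T\<^esub> ((a2 \<cdot> c1) \<boxtimes> (b2 \<cdot> d1))))))) t) s"
    by (simp add: twisted_square_def)
  also have "\<dots> = tensor_lift K T (\<lambda>a b. tensor_lift K T (\<lambda>c d. twist_mult a b c d) t) s"
    by (intro tensor_lift_cong[of K H H] twist_mult_eq) (use assms in simp_all)
  finally show ?thesis .
qed

lemma star_inner_bilinear:
  assumes "a \<in> carrier H" "b \<in> carrier H"
  shows "(\<lambda>c d. twist_mult a b c d) \<in> bilinear_maps K H H T"
  using assms by (intro bilinear_mapsI) simp_all

lemma star_outer_bilinear:
  assumes "t \<in> carrier T"
  shows "(\<lambda>a b. tensor_lift K T (\<lambda>c d. twist_mult a b c d) t) \<in> bilinear_maps K H H T"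
  using assms
  by (intro bilinear_mapsI; intro tensor_lift_linear_body[of K H H]) simp_all

lemma star_linear_left: 
  assumes "t \<in> carrier T" shows "(\<lambda>s. s \<star> t) \<in> linear_maps K T T"
  by (subst linear_cong[where g = "\<lambda>s. tensor_lift K T (\<lambda>a b. tensor_lift K T (\<lambda>c d. twist_mult a b c d) t) s"])
    (use assms in \<open>simp_all add: star_alt tensor_lift_linear star_outer_bilinear\<close>)

lemma star_linear_right:
  assumes "s \<in> carrier T" shows "(\<lambda>t. s \<star> t) \<in> linear_maps K T T"
  by (subst linear_cong[where g = "\<lambda>t. tensor_lift K T (\<lambda>a b. tensor_lift K T (\<lambda>c d. twist_mult a b c d) t) s"])
    (use assms in \<open>simp_all add: star_alt tensor_lift_linear_body[of K H H] tensor_lift_linear star_inner_bilinear\<close>)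

lemma lin_star [simp]:
  "\<lbrakk>f \<in> linear_maps K M T; t \<in> carrier T\<rbrakk> \<Longrightarrow> (\<lambda>x. f x \<star> t) \<in> linear_maps K M T"
  "\<lbrakk>f \<in> linear_maps K M T; t \<in> carrier T\<rbrakk> \<Longrightarrow> (\<lambda>x. t \<star> f x) \<in> linear_maps K M T"
  by (rule linear_compose[OF star_linear_left]; simp)
    (rule linear_compose[OF star_linear_right]; simp)

lemma star_closed [simp]: "\<lbrakk>s \<in> carrier T; t \<in> carrier T\<rbrakk> \<Longrightarrow> s \<star> t \<in> carrier T"
  by (rule linear_closed[OF star_linear_left])

lemma star_pure:
  "\<lbrakk>a \<in> carrier H; b \<in> carrier H; c \<in> carrier H; d \<in> carrier H\<rbrakk> \<Longrightarrow>
    (a \<boxtimes> b) \<star> (c \<boxtimes> d) =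
      Sw T b (\<lambda>b1 b2. Sw T d (\<lambda>d1 d2. ((a \<leftharpoonup> d2) \<cdot> (b1 \<rightharpoonup> c)) \<boxtimes> (b2 \<cdot> d1)))"
  by (simp add: star_alt tensor_lift_pure[OF _ _ _ star_outer_bilinear]
      tensor_lift_pure[OF _ _ _ star_inner_bilinear]) (simp add: twist_mult_def)

lemma sw_star_out:
  assumes "a \<in> carrier H" "t \<in> carrier T"
    and "\<And>u v. \<lbrakk>u \<in> carrier H; v \<in> carrier H\<rbrakk> \<Longrightarrow> F u v \<in> carrier T"
  shows "Sw T a F \<star> t = Sw T a (\<lambda>u v. F u v \<star> t)" "t \<star> Sw T a F = Sw T a (\<lambda>u v. t \<star> F u v)"
  using assms by (simp_all add: linear_sw[OF star_linear_left] linear_sw[OF star_linear_right])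

text \<open>With the actions distributed over products, both sides become the sum of \<open>(a
  \<leftharpoonup> d3 \<leftharpoonup> f2) \<cdot> (b1 \<rightharpoonup> (c \<leftharpoonup> f3))
  \<cdot> ((b2 \<cdot> d1) \<rightharpoonup> e) \<boxtimes> (b3 \<cdot> d2 \<cdot> f1)\<close>. Only
  coproducts of \<open>b\<close>, \<open>d\<close> and \<open>f\<close> survive.\<close>

lemma star_pure_assoc:
  assumes "a \<in> carrier H" "b \<in> carrier H" "c \<in> carrier H" "d \<in> carrier H" "e \<in> carrier H" "f \<in> carrier H"
  shows "(a \<boxtimes> b) \<star> (c \<boxtimes> d) \<star> (e \<boxtimes> f) = (a \<boxtimes> b) \<star> ((c \<boxtimes> d) \<star> (e \<boxtimes> f))"
proof -
  have [simp]: "before b d" "before b f" "before d f"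
    by (simp_all add: before_def)
  show ?thesis
    using assms
    apply (simp add: star_pure sw_star_out)
    apply (simp add: sw_mult)
    apply (simp add: mult_hit_right mult_hit_left)
    apply (simp add: sw_out)
    apply (simp add: hit_right_mult hit_left_mult hit_commute H.A.m_assoc)
    apply (simp add: sw_normalize cong: sw_cong_ordered)
    done
qed

lemma star_assoc:
  assumes "s \<in> carrier T" "t \<in> carrier T" "u \<in> carrier T"
  shows "s \<star> t \<star> u = s \<star> (t \<star> u)"
proof (rule tensor_ext[of K H H T "\<lambda>s. s \<star> t \<star> u"])
  fix a b assume ab: "a \<in> carrier H" "b \<in> carrier H"
  show "(a \<boxtimes> b) \<star> t \<star> u = (a \<boxtimes> b) \<star> (t \<star> u)"
  proof (rule tensor_ext[of K H H T "\<lambda>t. (a \<boxtimes> b) \<star> t \<star> u"])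
    fix c d assume cd: "c \<in> carrier H" "d \<in> carrier H"
    show "(a \<boxtimes> b) \<star> (c \<boxtimes> d) \<star> u = (a \<boxtimes> b) \<star> ((c \<boxtimes> d) \<star> u)"
      by (rule tensor_ext[of K H H T "\<lambda>u. (a \<boxtimes> b) \<star> (c \<boxtimes> d) \<star> u"])
        (use ab cd assms in \<open>simp_all add: star_pure_assoc\<close>)
  qed (use ab assms in simp_all)
qed (use assms in simp_all)

lemma pure_smult:
  "\<lbrakk>r \<in> carrier K; x \<in> carrier H; y \<in> carrier H\<rbrakk> \<Longrightarrow> (r \<odot>\<^bsub>H\<^esub> x) \<boxtimes> y = r \<odot>\<^bsub>T\<^esub> (x \<boxtimes> y)"
  "\<lbrakk>r \<in> carrier K; x \<in> carrier H; y \<in> carrier H\<rbrakk> \<Longrightarrow> x \<boxtimes> (r \<odot>\<^bsub>H\<^esub> y) = r \<odot>\<^bsub>T\<^esub> (x \<boxtimes> y)"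
  by (rule linear_smult[OF bilinear_left[OF pure_bilinear]]; simp)
    (rule linear_smult[OF bilinear_right[OF pure_bilinear]]; simp)

lemmas smult_out = H.smult_mult_left H.smult_mult_right pure_smult

lemma star_pure_one:
  assumes "a \<in> carrier H" "b \<in> carrier H"
  shows "(\<one>\<^bsub>H\<^esub> \<boxtimes> \<one>\<^bsub>H\<^esub>) \<star> (a \<boxtimes> b) = a \<boxtimes> b" "(a \<boxtimes> b) \<star> (\<one>\<^bsub>H\<^esub> \<boxtimes> \<one>\<^bsub>H\<^esub>) = a \<boxtimes> b"
  using assms
  by (simp_all add: star_pure sw_one one_hit hit_one smult_out sw_counit_left sw_counit_right)

lemma star_one:
  assumes "t \<in> carrier T"
  shows "(\<one>\<^bsub>H\<^esub> \<boxtimes> \<one>\<^bsub>H\<^esub>) \<star> t = t" "t \<star> (\<one>\<^bsub>H\<^esub> \<boxtimes> \<one>\<^bsub>H\<^esub>) = t"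
  by (rule tensor_ext[of K H H T _ "\<lambda>t. t"]; use assms in \<open>simp add: star_pure_one\<close>)+

lemma Q_simps [simp]:
  "carrier Q = carrier T" "zero Q = zero T" "add Q = add T" "smult Q = smult T"
  "one Q = \<one>\<^bsub>H\<^esub> \<boxtimes> \<one>\<^bsub>H\<^esub>"
  by (simp_all add: twisted_square_def)

text \<open>Linear maps, tensor modules and lifts see only the module part of a record. These rules
  replace \<open>Q\<close> by \<open>T\<close> so that the facts about \<open>T\<close>
  apply.\<close>

lemma Q_linear [simp]: "linear_maps K Q P = linear_maps K T P" "linear_maps K P Q = linear_maps K P T"
  by (simp_all add: linear_maps_def)

lemma Q_tensor [simp]:
  "tensor_module K Q Q = TT" "tensor_module K Q TT = tensor_module K T TT"
  "pure_tensor K Q Q = pure_tensor K T T" "pure_tensor K Q TT = pure_tensor K T TT"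
  by (intro tensor_cong; simp)+

lemma Q_tensor_lift [simp]: "tensor_lift K Q F t = tensor_lift K T F t"
  by (rule tensor_lift_module_cong) simp_all

lemma module_Q [simp]: "module K Q"
  by (rule module_cong[of K T]) simp_all

lemma unital_algebra_Q: "unital_algebra K Q"
proof -
  interpret Q: module K Q by simp
  show ?thesis
  proof (intro unital_algebra.intro unital_algebra_axioms.intro ringI)
    show "monoid Q"
      by (rule monoidI) (simp_all add: star_assoc star_one)
  next
    fix r x y assume "r \<in> carrier K" "x \<in> carrier Q" "y \<in> carrier Q"
    then show "(r \<odot>\<^bsub>Q\<^esub> x) \<star> y = r \<odot>\<^bsub>Q\<^esub> (x \<star> y)" "x \<star> (r \<odot>\<^bsub>Q\<^esub> y) = r \<odot>\<^bsub>Q\<^esub> (x \<star> y)"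
      using linear_smult[OF star_linear_left] linear_smult[OF star_linear_right] by simp_all
  next
    fix x y z assume "x \<in> carrier Q" "y \<in> carrier Q" "z \<in> carrier Q"
    then show "(x \<oplus>\<^bsub>Q\<^esub> y) \<star> z = x \<star> z \<oplus>\<^bsub>Q\<^esub> y \<star> z" "z \<star> (x \<oplus>\<^bsub>Q\<^esub> y) = z \<star> x \<oplus>\<^bsub>Q\<^esub> z \<star> y"
      using linear_add[OF star_linear_left] linear_add[OF star_linear_right] by simp_all
  qed (simp_all add: Q.abelian_group_axioms)
qed

section \<open>The comultiplication of the twisted square\<close>

definition twist_comult where
  "twist_comult a b = Sw TT a (\<lambda>a1 a2. Sw TT b (\<lambda>b1 y. Sw TT y (\<lambda>b2 b3.
    (a1 \<boxtimes> b3) \<boxtimes>\<boxtimes> ((a2 \<leftharpoonup> b2) \<boxtimes> b1))))"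

lemma twist_comult_eq:
  assumes "a \<in> carrier H" "b \<in> carrier H"
  shows "sweedler3 K H TT a (\<lambda>a1 a2 a3. sweedler3 K H TT b (\<lambda>b1 b2 b3.
      \<phi> a2 b2 \<odot>\<^bsub>TT\<^esub> ((a1 \<boxtimes> b3) \<boxtimes>\<boxtimes> (a3 \<boxtimes> b1)))) = twist_comult a b"
proof -
  have [simp]: "before a b" by (simp add: before_def)
  show ?thesis
    using assms
    by (simp add: sweedler3_def twist_comult_def sw_normalize
        linear_hit_right[where P = TT and f = "\<lambda>a. s \<boxtimes>\<boxtimes> (a \<boxtimes> z)" for s z]
        cong: sw_cong_ordered)
qed

lemma twist_comult_bilinear: "twist_comult \<in> bilinear_maps K H H TT"
  by (intro bilinear_mapsI) (simp_all add: twist_comult_def)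

lemma comult_Q_alt:
  assumes "t \<in> carrier T"
  shows "comult Q t = tensor_lift K TT twist_comult t"
proof -
  have "comult Q t = tensor_lift K TT (\<lambda>a b. sweedler3 K H TT a (\<lambda>a1 a2 a3. sweedler3 K H TT b
      (\<lambda>b1 b2 b3. \<phi> a2 b2 \<odot>\<^bsub>TT\<^esub> ((a1 \<boxtimes> b3) \<boxtimes>\<boxtimes> (a3 \<boxtimes> b1))))) t"
    by (simp add: twisted_square_def)
  also have "\<dots> = tensor_lift K TT twist_comult t"
    by (intro tensor_lift_cong[of K H H] twist_comult_eq) (use assms in simp_all)
  finally show ?thesis .
qed

lemma comult_Q_linear: "comult Q \<in> linear_maps K T TT"
  by (subst linear_cong[where g = "tensor_lift K TT twist_comult"])
    (simp_all add: comult_Q_alt tensor_lift_linear twist_comult_bilinear)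

lemma comult_Q_pure:
  assumes "a \<in> carrier H" "b \<in> carrier H"
  shows "comult Q (a \<boxtimes> b) = Sw TT a (\<lambda>a1 a2. Sw TT b (\<lambda>b1 y. Sw TT y (\<lambda>b2 b3.
    (a1 \<boxtimes> b3) \<boxtimes>\<boxtimes> ((a2 \<leftharpoonup> b2) \<boxtimes> b1))))"
  using assms
  by (simp add: comult_Q_alt tensor_lift_pure[OF _ _ _ twist_comult_bilinear])
    (simp add: twist_comult_def)

end

sublocale bijective_hopf_pairing \<subseteq> Q: comult_module K "twisted_square K H \<phi>"
  by (intro comult_module.intro comult_module_axioms.intro) (simp_all add: comult_Q_linear)

context bijective_hopf_pairing
begin

lemma sw_Q_pure:
  assumes P: "module K P" and ab: "a \<in> carrier H" "b \<in> carrier H"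
    and F: "\<And>y. y \<in> carrier T \<Longrightarrow> (\<lambda>x. F x y) \<in> linear_maps K T P"
      "\<And>x. x \<in> carrier T \<Longrightarrow> (\<lambda>y. F x y) \<in> linear_maps K T P"
  shows "Q.Sw P (a \<boxtimes> b) F = Sw P a (\<lambda>a1 a2. Sw P b (\<lambda>b1 y. Sw P y (\<lambda>b2 b3.
    F (a1 \<boxtimes> b3) ((a2 \<leftharpoonup> b2) \<boxtimes> b1))))"
proof -
  note F' = Q.tensor_lift_bilinear[of P F, simplified, OF P F]
  have "Q.Sw P (a \<boxtimes> b) F = tensor_lift K P F (comult Q (a \<boxtimes> b))"
    by (simp add: sweedler_def)
  also have "\<dots> = Sw P a (\<lambda>a1 a2. Sw P b (\<lambda>b1 y. Sw P y (\<lambda>b2 b3.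
    F (a1 \<boxtimes> b3) ((a2 \<leftharpoonup> b2) \<boxtimes> b1))))"
    using ab P by (simp add: comult_Q_pure linear_sw[OF F'(1)] F'(2))
  finally show ?thesis .
qed

end

section \<open>The Hopf algebra structure of the twisted square\<close>

context bijective_hopf_pairing
begin

abbreviation (input) "T3 \<equiv> tensor_module K T TT"

lemma sw_TT_out:
  assumes "a \<in> carrier H" "t \<in> carrier T"
    and "\<And>u v. \<lbrakk>u \<in> carrier H; v \<in> carrier H\<rbrakk> \<Longrightarrow> F u v \<in> carrier T"
  shows "Sw T a F \<boxtimes>\<boxtimes> t = Sw TT a (\<lambda>u v. F u v \<boxtimes>\<boxtimes> t)"
    "t \<boxtimes>\<boxtimes> Sw T a F = Sw TT a (\<lambda>u v. t \<boxtimes>\<boxtimes> F u v)"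
  by (rule linear_sw[where P = T]; use assms in simp)+

lemma sw_T3_out:
  assumes "a \<in> carrier H" "t \<in> carrier T"
    and "\<And>u v. \<lbrakk>u \<in> carrier H; v \<in> carrier H\<rbrakk> \<Longrightarrow> F u v \<in> carrier TT"
  shows "pure_tensor K T TT t (Sw TT a F) = Sw T3 a (\<lambda>u v. pure_tensor K T TT t (F u v))"
  by (rule linear_sw[where P = TT]; use assms in simp)+

lemma comult_Q_lin [simp]:
  "f \<in> linear_maps K M T \<Longrightarrow> (\<lambda>x. comult Q (f x)) \<in> linear_maps K M TT"
  by (rule linear_compose[OF comult_Q_linear])

lemma comult_Q_closed [simp]: "t \<in> carrier T \<Longrightarrow> comult Q t \<in> carrier TT"
  by (rule linear_closed[OF comult_Q_linear])

lemma sw_Q_closed [simp]: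
  assumes "module K P" "x \<in> carrier T"
    and "\<And>x y. \<lbrakk>x \<in> carrier T; y \<in> carrier T\<rbrakk> \<Longrightarrow> F x y \<in> carrier P"
  shows "Q.Sw P x F \<in> carrier P"
  by (rule Q.sw_closed) (use assms in simp_all)

lemma lin_sw_Q [simp]:
  assumes "f \<in> linear_maps K M T" "module K P"
    and "\<And>y. y \<in> carrier T \<Longrightarrow> (\<lambda>x. F x y) \<in> linear_maps K T P"
    and "\<And>x. x \<in> carrier T \<Longrightarrow> (\<lambda>y. F x y) \<in> linear_maps K T P"
  shows "(\<lambda>x. Q.Sw P (f x) F) \<in> linear_maps K M P"
  by (rule Q.lin_sw) (use assms in simp_all)

lemma lin_sw_body_Q [simp]:
  assumes "module K M" "module K P" "a \<in> carrier T"
    and "\<And>x y. \<lbrakk>x \<in> carrier T; y \<in> carrier T\<rbrakk> \<Longrightarrow> (\<lambda>z. F z x y) \<in> linear_maps K M P"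
  shows "(\<lambda>z. Q.Sw P a (F z)) \<in> linear_maps K M P"
  by (rule Q.lin_sw_body) (use assms in simp_all)

text \<open>On a pure tensor both sides have the summands \<open>a1 \<boxtimes> b5\<close>,
  \<open>(a2 \<leftharpoonup> b4) \<boxtimes> b3\<close> and
  \<open>(a3 \<leftharpoonup> b2) \<boxtimes> b1\<close> in the three tensor factors, because by
  \<open>sw_hit_right\<close> the coproduct of an acted element keeps the action on its first
  leg.\<close>

lemma coassoc_Q:
  assumes "x \<in> carrier T"
  shows "sweedler3 K Q T3 x (\<lambda>a1 a2 a3. pure_tensor K T TT a1 (a2 \<boxtimes>\<boxtimes> a3)) =
    Q.Sw T3 x (\<lambda>a1 x. pure_tensor K T TT a1 (comult Q x))"
  unfolding sweedler3_def
proof (rule tensor_ext[of K H H T3 _ _ x])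
  fix a b assume ab: "a \<in> carrier H" "b \<in> carrier H"
  have [simp]: "before a b" by (simp add: before_def)
  show "Q.Sw T3 (a \<boxtimes> b) (\<lambda>x a3. Q.Sw T3 x (\<lambda>a1 a2. pure_tensor K T TT a1 (a2 \<boxtimes>\<boxtimes> a3))) =
    Q.Sw T3 (a \<boxtimes> b) (\<lambda>a1 x. pure_tensor K T TT a1 (comult Q x))"
    using ab
    apply (simp add: sw_Q_pure comult_Q_pure)
    apply (simp add: sw_T3_out sw_hit_right)
    apply (simp add: sw_normalize cong: sw_cong_ordered)
    done
qed (use assms in simp_all)

section \<open>The counit of the twisted square\<close>

lemma counit_Q_bilinear: "(\<lambda>a b. \<phi> a (R b)) \<in> bilinear_maps K H H KK"
  by (intro bilinear_mapsI) simp_all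

lemma counit_Q_linear: "counit Q \<in> linear_maps K T KK"
  by (simp add: twisted_square_def tensor_lift_linear counit_Q_bilinear)

lemma counit_Q_lin [simp]: "f \<in> linear_maps K M T \<Longrightarrow> (\<lambda>x. counit Q (f x)) \<in> linear_maps K M KK"
  by (rule linear_compose[OF counit_Q_linear])

lemma counit_Q_closed [simp]: "t \<in> carrier T \<Longrightarrow> counit Q t \<in> carrier K"
  using linear_closed[OF counit_Q_linear] by simp

lemma counit_Q_pure: "\<lbrakk>a \<in> carrier H; b \<in> carrier H\<rbrakk> \<Longrightarrow> counit Q (a \<boxtimes> b) = \<phi> a (R b)"
  by (simp add: twisted_square_def tensor_lift_pure[OF _ _ _ counit_Q_bilinear])

lemma counit_left_Q:
  assumes "x \<in> carrier T"
  shows "Q.Sw T x (\<lambda>u v. counit Q u \<odot>\<^bsub>T\<^esub> v) = x"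
proof (rule tensor_ext[of K H H T _ "\<lambda>x. x" x])
  fix a b assume ab: "a \<in> carrier H" "b \<in> carrier H"
  \<comment> \<open>The sum over \<open>a\<close> has to be innermost, where it is the expansion of
    an action by \<open>R b3\<close>.\<close>
  have [simp]: "before b a" by (simp add: before_def)
  have "Q.Sw T (a \<boxtimes> b) (\<lambda>u v. counit Q u \<odot>\<^bsub>T\<^esub> v) = Sw T b (\<lambda>b1 y. Sw T y (\<lambda>b2 b3.
      Sw T a (\<lambda>a1 a2. \<phi> a1 (R b3) \<odot>\<^bsub>T\<^esub> ((a2 \<leftharpoonup> b2) \<boxtimes> b1))))"
    using ab by (simp add: sw_Q_pure counit_Q_pure) (simp add: sw_normalize cong: sw_cong_ordered)
  also have "\<dots> = Sw T b (\<lambda>b1 y. Sw T y (\<lambda>b2 b3. (a \<leftharpoonup> (R b3 \<cdot> b2)) \<boxtimes> b1))"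
    using ab by (simp add: hit_right_mult
        linear_hit_right[where P = T and f = "\<lambda>a. (a \<leftharpoonup> x) \<boxtimes> y" for x y])
  also have "\<dots> = Sw T b (\<lambda>b1 y. \<epsilon> y \<odot>\<^bsub>T\<^esub> ((a \<leftharpoonup> \<one>\<^bsub>H\<^esub>) \<boxtimes> b1))"
    using ab by (intro sw_cong refl sw_R_left) simp_all
  also have "\<dots> = a \<boxtimes> b"
    using ab by (simp add: hit_one) (rule sw_counit_right; simp)
  finally show "Q.Sw T (a \<boxtimes> b) (\<lambda>u v. counit Q u \<odot>\<^bsub>T\<^esub> v) = a \<boxtimes> b" .
qed (use assms in simp_all)

lemma counit_right_Q:
  assumes "x \<in> carrier T"
  shows "Q.Sw T x (\<lambda>u v. counit Q v \<odot>\<^bsub>T\<^esub> u) = x"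
proof (rule tensor_ext[of K H H T _ "\<lambda>x. x" x])
  fix a b assume ab: "a \<in> carrier H" "b \<in> carrier H"
  have "Q.Sw T (a \<boxtimes> b) (\<lambda>u v. counit Q v \<odot>\<^bsub>T\<^esub> u) = Sw T a (\<lambda>a1 a2. Sw T b (\<lambda>b1 y. Sw T y (\<lambda>b2 b3.
      \<phi> a2 (b2 \<cdot> R b1) \<odot>\<^bsub>T\<^esub> (a1 \<boxtimes> b3))))"
    using ab by (simp add: sw_Q_pure counit_Q_pure pairing_hit_right)
  \<comment> \<open>Regrouping makes \<open>b1\<close> and \<open>b2\<close> the legs of one
    element, so that \<open>b2 \<cdot> R b1\<close> collapses.\<close>
  also have "\<dots> = Sw T a (\<lambda>a1 a2. Sw T b (\<lambda>y b3. Sw T y (\<lambda>b1 b2.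
      \<phi> a2 (b2 \<cdot> R b1) \<odot>\<^bsub>T\<^esub> (a1 \<boxtimes> b3))))"
    using ab by (intro sw_cong refl sw_coassoc[symmetric]) simp_all
  also have "\<dots> = Sw T a (\<lambda>a1 a2. Sw T b (\<lambda>y b3. \<epsilon> y \<odot>\<^bsub>T\<^esub> (\<phi> a2 \<one>\<^bsub>H\<^esub> \<odot>\<^bsub>T\<^esub> (a1 \<boxtimes> b3))))"
    using ab by (intro sw_cong refl sw_R_right) simp_all
  also have "\<dots> = Sw T a (\<lambda>a1 a2. \<epsilon> a2 \<odot>\<^bsub>T\<^esub> (a1 \<boxtimes> b))"
    using ab by (simp add: pairing_one_right sw_counit_left)
  also have "\<dots> = a \<boxtimes> b"
    using ab by (intro sw_counit_right) simp_all
  finally show "Q.Sw T (a \<boxtimes> b) (\<lambda>u v. counit Q v \<odot>\<^bsub>T\<^esub> u) = a \<boxtimes> b" .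
qed (use assms in simp_all)

section \<open>The antipode of the twisted square\<close>

lemma antipode_Q_bilinear: "(\<lambda>a b. S a \<boxtimes> R b) \<in> bilinear_maps K H H T"
  by (intro bilinear_mapsI) simp_all

lemma antipode_Q_linear: "antipode Q \<in> linear_maps K T T"
  by (simp add: twisted_square_def tensor_lift_linear antipode_Q_bilinear)

lemma antipode_Q_lin [simp]: "f \<in> linear_maps K M T \<Longrightarrow> (\<lambda>x. antipode Q (f x)) \<in> linear_maps K M T"
  by (rule linear_compose[OF antipode_Q_linear])

lemma antipode_Q_closed [simp]: "t \<in> carrier T \<Longrightarrow> antipode Q t \<in> carrier T"
  by (rule linear_closed[OF antipode_Q_linear])

lemma antipode_Q_pure: "\<lbrakk>a \<in> carrier H; b \<in> carrier H\<rbrakk> \<Longrightarrow> antipode Q (a \<boxtimes> b) = S a \<boxtimes> R b"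
  by (simp add: twisted_square_def tensor_lift_pure[OF _ _ _ antipode_Q_bilinear])

text \<open>An action on an outer leg is an action on \<open>a\<close> itself, so the antipode axiom
  for \<open>c \<rightharpoonup> a\<close> or \<open>a \<leftharpoonup> c\<close> applies. It leaves
  the counit of that element, which is \<open>\<phi> a c\<close>.\<close>

lemma sw_antipode_hit:
  assumes "module K P" "f \<in> linear_maps K H P" "a \<in> carrier H" "c \<in> carrier H"
  shows "Sw P a (\<lambda>x y. f (S x \<cdot> (c \<rightharpoonup> y))) = \<phi> a c \<odot>\<^bsub>P\<^esub> f \<one>\<^bsub>H\<^esub>"
    "Sw P a (\<lambda>x y. f ((x \<leftharpoonup> c) \<cdot> S y)) = \<phi> a c \<odot>\<^bsub>P\<^esub> f \<one>\<^bsub>H\<^esub>"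
proof -
  note [simp] = linear_compose[OF assms(2)]
  have "Sw P a (\<lambda>x y. f (S x \<cdot> (c \<rightharpoonup> y))) = Sw P (c \<rightharpoonup> a) (\<lambda>x y. f (S x \<cdot> y))"
    using assms by (intro sw_hit_left[symmetric]) simp_all
  also have "\<dots> = \<phi> a c \<odot>\<^bsub>P\<^esub> f \<one>\<^bsub>H\<^esub>"
    using assms by (simp add: sw_antipode_left counit_hit)
  finally show "Sw P a (\<lambda>x y. f (S x \<cdot> (c \<rightharpoonup> y))) = \<phi> a c \<odot>\<^bsub>P\<^esub> f \<one>\<^bsub>H\<^esub>" .
  have "Sw P a (\<lambda>x y. f ((x \<leftharpoonup> c) \<cdot> S y)) = Sw P (a \<leftharpoonup> c) (\<lambda>x y. f (x \<cdot> S y))"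
    using assms by (intro sw_hit_right[symmetric]) simp_all
  also have "\<dots> = \<phi> a c \<odot>\<^bsub>P\<^esub> f \<one>\<^bsub>H\<^esub>"
    using assms by (simp add: sw_antipode_right counit_hit)
  finally show "Sw P a (\<lambda>x y. f ((x \<leftharpoonup> c) \<cdot> S y)) = \<phi> a c \<odot>\<^bsub>P\<^esub> f \<one>\<^bsub>H\<^esub>" .
qed

text \<open>The sum collapses from the inside: \<open>sw_antipode_hit\<close> removes the legs of
  \<open>a\<close>, the unit acted on by \<open>p\<close> contributes \<epsilon> of
  \<open>p\<close>, and then \<open>p1\<close> and \<open>p4\<close> are adjacent and
  \<open>R p4 \<cdot> p1\<close> cancels.\<close>

lemma antipode_left_Q:
  assumes "x \<in> carrier T"
  shows "Q.Sw T x (\<lambda>u v. antipode Q u \<star> v) = counit Q x \<odot>\<^bsub>T\<^esub> (\<one>\<^bsub>H\<^esub> \<boxtimes> \<one>\<^bsub>H\<^esub>)"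
proof (rule tensor_ext[of K H H T _ _ x])
  fix a b assume ab: "a \<in> carrier H" "b \<in> carrier H"
  interpret T: module K T by simp
  have [simp]: "before b a" by (simp add: before_def)
  have "Q.Sw T (a \<boxtimes> b) (\<lambda>u v. antipode Q u \<star> v) = Sw T b (\<lambda>p1 y. Sw T y (\<lambda>p y. Sw T y (\<lambda>p4 p5.
      Sw T a (\<lambda>a1 a2. ((S a1 \<cdot> (R p5 \<rightharpoonup> a2)) \<leftharpoonup> p) \<boxtimes> (R p4 \<cdot> p1)))))"
    using ab
    apply (simp add: sw_Q_pure antipode_Q_pure star_pure)
    apply (simp add: sw_R)
    apply (simp add: mult_hit_right sw_out hit_commute)
    apply (simp add: sw_normalize cong: sw_cong_ordered)
    done
  also have "\<dots> = Sw T b (\<lambda>p1 y. Sw T y (\<lambda>p y. Sw T y (\<lambda>p4 p5.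
      \<phi> a (R p5) \<odot>\<^bsub>T\<^esub> ((\<one>\<^bsub>H\<^esub> \<leftharpoonup> p) \<boxtimes> (R p4 \<cdot> p1)))))"
    using ab by (intro sw_cong refl sw_antipode_hit) simp_all
  also have "\<dots> = Sw T b (\<lambda>p1 y. Sw T y (\<lambda>p y. \<epsilon> p \<odot>\<^bsub>T\<^esub> Sw T y (\<lambda>p4 p5.
      \<phi> a (R p5) \<odot>\<^bsub>T\<^esub> (\<one>\<^bsub>H\<^esub> \<boxtimes> (R p4 \<cdot> p1)))))"
    using ab by (simp add: one_hit pure_smult sw_smult T.smult_assoc1[symmetric] m_comm)
  also have "\<dots> = Sw T b (\<lambda>p1 y. Sw T y (\<lambda>p4 p5. \<phi> a (R p5) \<odot>\<^bsub>T\<^esub> (\<one>\<^bsub>H\<^esub> \<boxtimes> (R p4 \<cdot> p1))))"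
    using ab by (intro sw_cong refl sw_counit_left) simp_all
  also have "\<dots> = Sw T b (\<lambda>y p5. Sw T y (\<lambda>p1 p4. \<phi> a (R p5) \<odot>\<^bsub>T\<^esub> (\<one>\<^bsub>H\<^esub> \<boxtimes> (R p4 \<cdot> p1))))"
    using ab by (intro sw_coassoc[symmetric]) simp_all
  also have "\<dots> = Sw T b (\<lambda>y p5. \<epsilon> y \<odot>\<^bsub>T\<^esub> (\<phi> a (R p5) \<odot>\<^bsub>T\<^esub> (\<one>\<^bsub>H\<^esub> \<boxtimes> \<one>\<^bsub>H\<^esub>)))"
    using ab by (intro sw_cong refl sw_R_left) simp_all
  also have "\<dots> = counit Q (a \<boxtimes> b) \<odot>\<^bsub>T\<^esub> (\<one>\<^bsub>H\<^esub> \<boxtimes> \<one>\<^bsub>H\<^esub>)"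
    using ab by (simp add: counit_Q_pure) (rule sw_counit_left; simp)
  finally show "Q.Sw T (a \<boxtimes> b) (\<lambda>u v. antipode Q u \<star> v) =
      counit Q (a \<boxtimes> b) \<odot>\<^bsub>T\<^esub> (\<one>\<^bsub>H\<^esub> \<boxtimes> \<one>\<^bsub>H\<^esub>)" .
qed (use assms in simp_all)

text \<open>\<open>hit_left_antipode\<close> brings both actions on the second leg of
  \<open>a\<close> inside \<open>S\<close>, where they combine to \<open>p3 \<cdot> S p4\<close> and
  cancel. After that the legs of \<open>a\<close> collapse by \<open>sw_antipode_hit\<close>, and
  \<open>p5 \<cdot> R p2\<close> is left to cancel.\<close>

lemma antipode_right_Q:
  assumes "x \<in> carrier T"
  shows "Q.Sw T x (\<lambda>u v. u \<star> antipode Q v) = counit Q x \<odot>\<^bsub>T\<^esub> (\<one>\<^bsub>H\<^esub> \<boxtimes> \<one>\<^bsub>H\<^esub>)"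
proof (rule tensor_ext[of K H H T _ _ x])
  fix a b assume ab: "a \<in> carrier H" "b \<in> carrier H"
  have [simp]: "before b a" by (simp add: before_def)
  have "Q.Sw T (a \<boxtimes> b) (\<lambda>u v. u \<star> antipode Q v) = Sw T b (\<lambda>p1 y. Sw T y (\<lambda>p2 y. Sw T y (\<lambda>p p5.
      Sw T p (\<lambda>p3 p4. Sw T a (\<lambda>a1 a2.
        ((a1 \<leftharpoonup> R p1) \<cdot> S (a2 \<leftharpoonup> (p3 \<cdot> S p4))) \<boxtimes> (p5 \<cdot> R p2))))))"
    using ab
    apply (simp add: sw_Q_pure antipode_Q_pure star_pure)
    apply (simp add: sw_R)
    apply (simp add: hit_left_antipode hit_right_mult)
    apply (simp add: sw_normalize cong: sw_cong_ordered)
    done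
  also have "\<dots> = Sw T b (\<lambda>p1 y. Sw T y (\<lambda>p2 y. Sw T y (\<lambda>p p5. \<epsilon> p \<odot>\<^bsub>T\<^esub>
      Sw T a (\<lambda>a1 a2. ((a1 \<leftharpoonup> R p1) \<cdot> S (a2 \<leftharpoonup> \<one>\<^bsub>H\<^esub>)) \<boxtimes> (p5 \<cdot> R p2)))))"
    using ab by (intro sw_cong refl sw_antipode_right) simp_all
  also have "\<dots> = Sw T b (\<lambda>p1 y. Sw T y (\<lambda>p2 p5.
      Sw T a (\<lambda>a1 a2. ((a1 \<leftharpoonup> R p1) \<cdot> S a2) \<boxtimes> (p5 \<cdot> R p2))))"
    using ab by (simp add: hit_one) (intro sw_cong refl sw_counit_left; simp)
  also have "\<dots> = Sw T b (\<lambda>p1 y. Sw T y (\<lambda>p2 p5. \<phi> a (R p1) \<odot>\<^bsub>T\<^esub> (\<one>\<^bsub>H\<^esub> \<boxtimes> (p5 \<cdot> R p2))))"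
    using ab by (intro sw_cong refl sw_antipode_hit) simp_all
  also have "\<dots> = Sw T b (\<lambda>p1 y. \<epsilon> y \<odot>\<^bsub>T\<^esub> (\<phi> a (R p1) \<odot>\<^bsub>T\<^esub> (\<one>\<^bsub>H\<^esub> \<boxtimes> \<one>\<^bsub>H\<^esub>)))"
    using ab by (intro sw_cong refl sw_R_right) simp_all
  also have "\<dots> = counit Q (a \<boxtimes> b) \<odot>\<^bsub>T\<^esub> (\<one>\<^bsub>H\<^esub> \<boxtimes> \<one>\<^bsub>H\<^esub>)"
    using ab by (simp add: counit_Q_pure) (rule sw_counit_right; simp)
  finally show "Q.Sw T (a \<boxtimes> b) (\<lambda>u v. u \<star> antipode Q v) =
      counit Q (a \<boxtimes> b) \<odot>\<^bsub>T\<^esub> (\<one>\<^bsub>H\<^esub> \<boxtimes> \<one>\<^bsub>H\<^esub>)" .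
qed (use assms in simp_all)

section \<open>Multiplicativity of the counit and the comultiplication\<close>

lemma pairing_R:
  assumes "a \<in> carrier H" "b \<in> carrier H"
  shows "\<phi> a (R b) = \<phi> (R a) b"
  using pairing_antipode[of "R a" "R b"] assms by simp

text \<open>That \<open>R\<close> reverses products is wanted only under the pairing. There
  \<open>R\<close> can be moved to the first argument, where \<open>sw_R\<close> reverses the
  coproduct instead.\<close>

lemma pairing_R_mult:
  assumes "a \<in> carrier H" "b \<in> carrier H" "c \<in> carrier H"
  shows "\<phi> a (R (b \<cdot> c)) = \<phi> a (R c \<cdot> R b)"
proof -
  have "\<phi> a (R (b \<cdot> c)) = Sw KK (R a) (\<lambda>x y. \<phi> x b \<otimes>\<^bsub>K\<^esub> \<phi> y c)"
    using assms by (simp add: pairing_R pairing_mult_right)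
  also have "\<dots> = Sw KK a (\<lambda>x y. \<phi> (R y) b \<otimes>\<^bsub>K\<^esub> \<phi> (R x) c)"
    using assms by (intro sw_R) simp_all
  also have "\<dots> = \<phi> a (R c \<cdot> R b)"
    using assms by (simp add: pairing_R[symmetric] pairing_mult_right m_comm)
  finally show ?thesis .
qed

text \<open>The pairing with a product splits \<open>R (b2 \<cdot> d1)\<close> into legs. Two
  adjacent pairs arise, \<open>d2 \<cdot> R v'\<close> among the legs of \<open>d\<close> and
  \<open>R u \<cdot> b1\<close> among those of \<open>b\<close>; they cancel in turn.\<close>

lemma counit_Q_mult_pure:
  assumes H: "a \<in> carrier H" "b \<in> carrier H" "c \<in> carrier H" "d \<in> carrier H"
  shows "counit Q ((a \<boxtimes> b) \<star> (c \<boxtimes> d)) = counit Q (a \<boxtimes> b) \<otimes>\<^bsub>K\<^esub> counit Q (c \<boxtimes> d)"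
proof -
  have [simp]: "before b d" by (simp add: before_def)
  have pair: "\<phi> ((a \<leftharpoonup> d2) \<cdot> (b1 \<rightharpoonup> c)) (R (b2 \<cdot> d1)) = Sw KK d1 (\<lambda>u' v'. Sw KK b2 (\<lambda>u v.
      \<phi> a (d2 \<cdot> R v' \<cdot> R v) \<otimes>\<^bsub>K\<^esub> \<phi> c (R u' \<cdot> (R u \<cdot> b1))))"
    if "b1 \<in> carrier H" "b2 \<in> carrier H" "d1 \<in> carrier H" "d2 \<in> carrier H" for b1 b2 d1 d2
    using H that
    by (simp add: pairing_mult_left sw_R sw_mult pairing_R_mult)
      (simp add: pairing_hit_right pairing_hit_left H.A.m_assoc)
  have "counit Q ((a \<boxtimes> b) \<star> (c \<boxtimes> d)) = Sw KK b (\<lambda>b1 b2. Sw KK d (\<lambda>d1 d2.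
      \<phi> ((a \<leftharpoonup> d2) \<cdot> (b1 \<rightharpoonup> c)) (R (b2 \<cdot> d1))))"
    using H by (simp add: star_pure linear_sw[OF counit_Q_linear] counit_Q_pure)
  also have "\<dots> = Sw KK b (\<lambda>b1 y. Sw KK y (\<lambda>u v. Sw KK d (\<lambda>u' y. Sw KK y (\<lambda>v' d2.
      \<phi> a (d2 \<cdot> R v' \<cdot> R v) \<otimes>\<^bsub>K\<^esub> \<phi> c (R u' \<cdot> (R u \<cdot> b1))))))"
    using H by (simp add: pair) (simp add: sw_normalize cong: sw_cong_ordered)
  also have "\<dots> = Sw KK b (\<lambda>b1 y. Sw KK y (\<lambda>u v. Sw KK d (\<lambda>u' y. \<epsilon> y \<odot>\<^bsub>KK\<^esub>
      (\<phi> a (\<one>\<^bsub>H\<^esub> \<cdot> R v) \<otimes>\<^bsub>K\<^esub> \<phi> c (R u' \<cdot> (R u \<cdot> b1))))))"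
    using H by (intro sw_cong refl sw_R_right) simp_all
  also have "\<dots> = Sw KK b (\<lambda>b1 y. Sw KK y (\<lambda>u v.
      \<phi> a (\<one>\<^bsub>H\<^esub> \<cdot> R v) \<otimes>\<^bsub>K\<^esub> \<phi> c (R d \<cdot> (R u \<cdot> b1))))"
    using H by (intro sw_cong refl sw_counit_right) simp_all
  also have "\<dots> = Sw KK b (\<lambda>y v. Sw KK y (\<lambda>b1 u.
      \<phi> a (\<one>\<^bsub>H\<^esub> \<cdot> R v) \<otimes>\<^bsub>K\<^esub> \<phi> c (R d \<cdot> (R u \<cdot> b1))))"
    using H by (intro sw_coassoc[symmetric]) simp_all
  also have "\<dots> = Sw KK b (\<lambda>y v. \<epsilon> y \<odot>\<^bsub>KK\<^esub>
      (\<phi> a (\<one>\<^bsub>H\<^esub> \<cdot> R v) \<otimes>\<^bsub>K\<^esub> \<phi> c (R d \<cdot> \<one>\<^bsub>H\<^esub>)))"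
    using H by (intro sw_cong refl sw_R_left) simp_all
  also have "\<dots> = \<phi> a (\<one>\<^bsub>H\<^esub> \<cdot> R b) \<otimes>\<^bsub>K\<^esub> \<phi> c (R d \<cdot> \<one>\<^bsub>H\<^esub>)"
    using H by (intro sw_counit_left) simp_all
  finally show ?thesis
    using H by (simp add: counit_Q_pure)
qed

lemma counit_Q_mult:
  assumes "s \<in> carrier T" "t \<in> carrier T"
  shows "counit Q (s \<star> t) = counit Q s \<otimes>\<^bsub>K\<^esub> counit Q t"
proof (rule tensor_ext[of K H H KK _ _ s])
  fix a b assume ab: "a \<in> carrier H" "b \<in> carrier H"
  show "counit Q ((a \<boxtimes> b) \<star> t) = counit Q (a \<boxtimes> b) \<otimes>\<^bsub>K\<^esub> counit Q t"
    by (rule tensor_ext[of K H H KK _ _ t]) (use ab assms in \<open>simp_all add: counit_Q_mult_pure\<close>)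
qed (use assms in simp_all)

text \<open>The two expansions agree except for one leg of \<open>b\<close>: in the coproduct of the
  product \<open>b4\<close> acts on \<open>c2\<close> from the right, in the product of the
  coproducts it acts on \<open>c1\<close> from the left. \<open>sw_hit_middle\<close> exchanges the
  two.\<close>

lemma comult_Q_mult_pure:
  assumes H: "a \<in> carrier H" "b \<in> carrier H" "c \<in> carrier H" "d \<in> carrier H"
  shows "comult Q ((a \<boxtimes> b) \<star> (c \<boxtimes> d)) = Q.Sw TT (a \<boxtimes> b) (\<lambda>u u'. Q.Sw TT (c \<boxtimes> d) (\<lambda>v v'.
    (u \<star> v) \<boxtimes>\<boxtimes> (u' \<star> v')))"
proof -
  \<comment> \<open>The sum over \<open>c\<close> is placed innermost, where
    \<open>sw_hit_middle\<close> is applied.\<close>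
  have [simp]: "before b d" "before b a" "before b c" "before d a" "before d c" "before a c"
    by (simp_all add: before_def)
  have "comult Q ((a \<boxtimes> b) \<star> (c \<boxtimes> d)) =
      Sw TT b (\<lambda>b1 y. Sw TT y (\<lambda>b2 y. Sw TT y (\<lambda>b3 y. Sw TT y (\<lambda>b4 b5.
      Sw TT d (\<lambda>d1 y. Sw TT y (\<lambda>d2 y. Sw TT y (\<lambda>d3 y. Sw TT y (\<lambda>d4 d5.
      Sw TT a (\<lambda>a1 a2. Sw TT c (\<lambda>c1 c2. (((a1 \<leftharpoonup> d5) \<cdot> c1) \<boxtimes> (b5 \<cdot> d4)) \<boxtimes>\<boxtimes>
        (((a2 \<leftharpoonup> b3 \<leftharpoonup> d2) \<cdot> (b1 \<rightharpoonup> (c2 \<leftharpoonup> b4 \<leftharpoonup> d3))) \<boxtimes> (b2 \<cdot> d1))))))))))))"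
    using H
    apply (simp add: star_pure linear_sw[OF comult_Q_linear] comult_Q_pure)
    apply (simp add: sw_mult sw_hit_right sw_hit_left)
    apply (simp add: mult_hit_right)
    apply (simp add: sw_out sw_TT_out)
    apply (simp add: sw_mult)
    apply (simp add: hit_right_mult hit_commute)
    apply (simp add: sw_normalize cong: sw_cong_ordered)
    done
  also have "\<dots> =
      Sw TT b (\<lambda>b1 y. Sw TT y (\<lambda>b2 y. Sw TT y (\<lambda>b3 y. Sw TT y (\<lambda>b4 b5.
      Sw TT d (\<lambda>d1 y. Sw TT y (\<lambda>d2 y. Sw TT y (\<lambda>d3 y. Sw TT y (\<lambda>d4 d5.
      Sw TT a (\<lambda>a1 a2. Sw TT c (\<lambda>c1 c2. (((a1 \<leftharpoonup> d5) \<cdot> (b4 \<rightharpoonup> c1)) \<boxtimes> (b5 \<cdot> d4)) \<boxtimes>\<boxtimes>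
        (((a2 \<leftharpoonup> b3 \<leftharpoonup> d2) \<cdot> (b1 \<rightharpoonup> (c2 \<leftharpoonup> d3))) \<boxtimes> (b2 \<cdot> d1))))))))))))"
    by (intro sw_cong refl sw_hit_middle[where F = "\<lambda>x y. (((_ \<leftharpoonup> _) \<cdot> x) \<boxtimes> (_ \<cdot> _)) \<boxtimes>\<boxtimes>
        ((_ \<cdot> (_ \<rightharpoonup> (y \<leftharpoonup> _))) \<boxtimes> (_ \<cdot> _))"]) (use H in simp_all)
  also have "\<dots> = Q.Sw TT (a \<boxtimes> b) (\<lambda>u u'. Q.Sw TT (c \<boxtimes> d) (\<lambda>v v'. (u \<star> v) \<boxtimes>\<boxtimes> (u' \<star> v')))"
    using H
    apply (simp add: sw_Q_pure star_pure)
    apply (simp add: sw_TT_out hit_right_mult hit_commute)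
    apply (simp add: sw_normalize cong: sw_cong_ordered)
    done
  finally show ?thesis .
qed

lemma comult_Q_mult:
  assumes "s \<in> carrier T" "t \<in> carrier T"
  shows "comult Q (s \<star> t) = Q.Sw TT s (\<lambda>u u'. Q.Sw TT t (\<lambda>v v'. (u \<star> v) \<boxtimes>\<boxtimes> (u' \<star> v')))"
proof (rule tensor_ext[of K H H TT _ _ s])
  fix a b assume ab: "a \<in> carrier H" "b \<in> carrier H"
  show "comult Q ((a \<boxtimes> b) \<star> t) =
      Q.Sw TT (a \<boxtimes> b) (\<lambda>u u'. Q.Sw TT t (\<lambda>v v'. (u \<star> v) \<boxtimes>\<boxtimes> (u' \<star> v')))"
    by (rule tensor_ext[of K H H TT _ _ t]) (use ab assms in \<open>simp_all add: comult_Q_mult_pure\<close>)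
qed (use assms in simp_all)

theorem hopf_algebra_Q: "hopf_algebra K Q"
proof (intro hopf_algebra.intro hopf_algebra_axioms.intro unital_algebra_Q)
  show "comult Q \<in> ring_hom Q (tensor_algebra K Q Q)"
  proof (rule ring_hom_memI)
    fix s t assume st: "s \<in> carrier Q" "t \<in> carrier Q"
    show "comult Q (s \<star> t) = comult Q s \<otimes>\<^bsub>tensor_algebra K Q Q\<^esub> comult Q t"
      using st by (simp add: tensor_algebra_def Let_def comult_Q_mult sweedler_def)
    show "comult Q (s \<oplus>\<^bsub>Q\<^esub> t) = comult Q s \<oplus>\<^bsub>tensor_algebra K Q Q\<^esub> comult Q t"
      using st linear_add[OF comult_Q_linear] by (simp add: tensor_algebra_def Let_def)
  next
    show "comult Q \<one>\<^bsub>Q\<^esub> = \<one>\<^bsub>tensor_algebra K Q Q\<^esub>"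
      by (simp add: tensor_algebra_def Let_def comult_Q_pure sw_one one_hit smult_out)
  qed (simp add: tensor_algebra_def Let_def)
  show "counit Q \<in> ring_hom Q K"
  proof (rule ring_hom_memI)
    fix s t assume st: "s \<in> carrier Q" "t \<in> carrier Q"
    show "counit Q (s \<star> t) = counit Q s \<otimes>\<^bsub>K\<^esub> counit Q t"
      using st by (simp add: counit_Q_mult)
    show "counit Q (s \<oplus>\<^bsub>Q\<^esub> t) = counit Q s \<oplus>\<^bsub>K\<^esub> counit Q t"
      using st linear_add[OF counit_Q_linear] by simp
  next
    show "counit Q \<one>\<^bsub>Q\<^esub> = \<one>\<^bsub>K\<^esub>"
      by (simp add: counit_Q_pure pairing_one_left counit_R)
  qed simp
  fix x assume x: "x \<in> carrier Q"
  show "let H2 = tensor_module K Q Q; H3 = tensor_module K Q H2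
    in sweedler3 K Q H3 x (\<lambda>a1 a2 a3. pure_tensor K Q H2 a1 (pure_tensor K Q Q a2 a3)) =
      sweedler K Q H3 x (\<lambda>a1 x. pure_tensor K Q H2 a1 (comult Q x))"
    using coassoc_Q[of x] x by (simp add: Let_def)
  show "sweedler K Q Q x (\<lambda>u v. counit Q u \<odot>\<^bsub>Q\<^esub> v) = x"
    "sweedler K Q Q x (\<lambda>u v. counit Q v \<odot>\<^bsub>Q\<^esub> u) = x"
    "sweedler K Q Q x (\<lambda>u v. antipode Q u \<otimes>\<^bsub>Q\<^esub> v) = counit Q x \<odot>\<^bsub>Q\<^esub> \<one>\<^bsub>Q\<^esub>"
    "sweedler K Q Q x (\<lambda>u v. u \<otimes>\<^bsub>Q\<^esub> antipode Q v) = counit Q x \<odot>\<^bsub>Q\<^esub> \<one>\<^bsub>Q\<^esub>"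
    using counit_left_Q[of x] counit_right_Q[of x] antipode_left_Q[of x] antipode_right_Q[of x] x
    by (simp_all add: sweedler_def)
qed (simp_all add: field_axioms comult_Q_linear counit_Q_linear antipode_Q_linear)

end

section \<open>Transport of Hopf algebra structures\<close>

text \<open>Of \<open>A\<close> only the module structure is known in advance; product and unit are
  pulled back from \<open>B\<close>. This fits both the candidate record inside
  \<open>is_drinfeld_mult\<close> and the double itself.\<close>

locale transport =
  fixes K :: "('k, 'n) ring_scheme" and A :: "('k, 'a, 'p) module_scheme"
    and B :: "('k, 'b, 'q) module_scheme" and f g
  assumes A: "module K A"
    and f_linear: "f \<in> linear_maps K A B" and g_linear: "g \<in> linear_maps K B A"
    and gf: "x \<in> carrier A \<Longrightarrow> g (f x) = x" and fg: "y \<in> carrier B \<Longrightarrow> f (g y) = y"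
    and mult_A: "\<lbrakk>x \<in> carrier A; x' \<in> carrier A\<rbrakk> \<Longrightarrow> x \<otimes>\<^bsub>A\<^esub> x' = g (f x \<otimes>\<^bsub>B\<^esub> f x')"
    and one_A: "\<one>\<^bsub>A\<^esub> = g \<one>\<^bsub>B\<^esub>"
begin

lemma f_closed [simp]: "x \<in> carrier A \<Longrightarrow> f x \<in> carrier B"
  by (rule linear_closed[OF f_linear])

lemma g_closed [simp]: "x \<in> carrier B \<Longrightarrow> g x \<in> carrier A"
  by (rule linear_closed[OF g_linear])

lemma unital_algebra_transport:
  assumes "unital_algebra K B"
  shows "unital_algebra K A"
proof -
  interpret A: module K A by (rule A)
  interpret B: unital_algebra K B by fact
  note [simp] = mult_A one_A fg gf linear_add[OF f_linear] linear_add[OF g_linear]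
    linear_smult[OF f_linear] linear_smult[OF g_linear]
  show ?thesis
  proof (intro unital_algebra.intro unital_algebra_axioms.intro ringI A A.abelian_group_axioms)
    show "monoid A"
      by (rule monoidI) (simp_all add: B.A.m_assoc)
  qed (simp_all add: B.A.l_distr B.A.r_distr B.smult_mult_left B.smult_mult_right)
qed

end

text \<open>Compatibility of \<open>f\<close> with the comultiplications turns each Sweedler sum
  over \<open>x\<close> in \<open>A\<close> into one over \<open>f x\<close> in \<open>B\<close>,
  which is the content of \<open>sw\<close> and \<open>sw'\<close>. The axioms of \<open>A\<close>
  are then pulled back from those of \<open>B\<close> along the mutually inverse maps.\<close>

lemma hopf_algebra_transport:
  fixes K :: "('k, 'n) ring_scheme" and A :: "('k, 'a, 'p) hopf_scheme"
    and B :: "('k, 'b, 'q) hopf_scheme"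
  assumes "transport K A B f g" and B: "hopf_algebra K B"
    and comult_A: "comult A \<in> linear_maps K A (tensor_module K A A)"
    and antipode_A: "antipode A \<in> carrier A \<rightarrow> carrier A"
    and f_comult: "\<And>x. x \<in> carrier A \<Longrightarrow> comult B (f x) = tensor_map K B B f f (comult A x)"
    and f_counit: "\<And>x. x \<in> carrier A \<Longrightarrow> counit B (f x) = counit A x"
    and f_antipode: "\<And>x. x \<in> carrier A \<Longrightarrow> antipode B (f x) = f (antipode A x)"
  shows "hopf_algebra K A"
proof -
  interpret transport K A B f g by fact
  interpret B: hopf_algebra K B by (rule B)
  interpret A: comult_module K A
    by (intro comult_module.intro comult_module_axioms.intro A comult_A)
  let ?A2 = "tensor_module K A A" let ?A3 = "tensor_module K A ?A2"
  have lin_f [simp]: "(\<lambda>x. f (h x)) \<in> linear_maps K M B" if "h \<in> linear_maps K M A"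
    for h and M :: "('k, 'x, 'y) module_scheme"
    by (rule linear_compose[OF f_linear that])
  have lin_g [simp]: "(\<lambda>x. g (h x)) \<in> linear_maps K M A" if "h \<in> linear_maps K M B"
    for h and M :: "('k, 'x, 'y) module_scheme"
    by (rule linear_compose[OF g_linear that])
  have sw: "A.Sw P x (\<lambda>u v. G (f u) (f v)) = B.Sw P (f x) G"
    if "module K P" "x \<in> carrier A"
      "\<And>y. y \<in> carrier B \<Longrightarrow> (\<lambda>x. G x y) \<in> linear_maps K B P"
      "\<And>x. x \<in> carrier B \<Longrightarrow> (\<lambda>y. G x y) \<in> linear_maps K B P"
    for P :: "('k, 'x, 'y) module_scheme" and x G
  proof -
    note G = B.tensor_lift_bilinear[of P G, OF that(1,3,4)]
    have "B.Sw P (f x) G = tensor_lift K P G (A.Sw B.T x (\<lambda>u v. pure_tensor K B B (f u) (f v)))"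
      using that(2) by (simp add: sweedler_def f_comult tensor_map_def)
    also have "\<dots> = A.Sw P x (\<lambda>u v. tensor_lift K P G (pure_tensor K B B (f u) (f v)))"
      using that by (intro A.linear_sw[OF G(1)]) simp_all
    also have "\<dots> = A.Sw P x (\<lambda>u v. G (f u) (f v))"
      using that by (intro A.sw_cong refl G(2)) simp_all
    finally show ?thesis by simp
  qed
  have sw': "A.Sw P x F = B.Sw P (f x) (\<lambda>u v. F (g u) (g v))"
    if "module K P" "x \<in> carrier A"
      "\<And>y. y \<in> carrier A \<Longrightarrow> (\<lambda>x. F x y) \<in> linear_maps K A P"
      "\<And>x. x \<in> carrier A \<Longrightarrow> (\<lambda>y. F x y) \<in> linear_maps K A P"
    for P :: "('k, 'x, 'y) module_scheme" and x F
  proof -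
    have "A.Sw P x F = A.Sw P x (\<lambda>u v. F (g (f u)) (g (f v)))"
      using that(2) by (intro A.sw_cong refl) (simp_all add: gf)
    also have "\<dots> = B.Sw P (f x) (\<lambda>u v. F (g u) (g v))"
      by (rule sw) (auto intro!: that linear_compose[OF _ g_linear])
    finally show ?thesis .
  qed
  have comult: "comult A x = B.Sw ?A2 (f x) (\<lambda>u v. pure_tensor K A A (g u) (g v))"
    if "x \<in> carrier A" for x
    using that A by (subst A.comult_eq_sw, simp) (rule sw'; simp)
  show ?thesis
  proof (intro hopf_algebra.intro hopf_algebra_axioms.intro unital_algebra_transport
      B.unital_algebra_axioms B.field_axioms comult_A)
    show "counit A \<in> linear_maps K A (self_module K)"
      using linear_compose[OF B.counit_linear f_linear] f_counit
      by (subst linear_cong[OF A, where g = "\<lambda>x. counit B (f x)"]) simp_all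
    have antipode: "antipode A x = g (antipode B (f x))" if "x \<in> carrier A" for x
      using that antipode_A by (simp add: f_antipode gf Pi_iff)
    show "antipode A \<in> linear_maps K A A"
      using linear_compose[OF linear_compose[OF g_linear B.antipode_linear] f_linear]
      by (subst linear_cong[OF A, where g = "\<lambda>x. g (antipode B (f x))"]) (simp_all add: antipode)
    interpret A': unital_algebra K A
      by (rule unital_algebra_transport) (rule B.unital_algebra_axioms)
    have g_mult: "g (u \<otimes>\<^bsub>B\<^esub> v) = g u \<otimes>\<^bsub>A\<^esub> g v" if "u \<in> carrier B" "v \<in> carrier B" for u v
      using that by (simp add: mult_A fg)
    have f_mult: "f (u \<otimes>\<^bsub>A\<^esub> v) = f u \<otimes>\<^bsub>B\<^esub> f v" if "u \<in> carrier A" "v \<in> carrier A" for u v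
      using that by (simp add: mult_A fg)
    have lin_A: "(\<lambda>x. x \<otimes>\<^bsub>A\<^esub> y) \<in> linear_maps K A A" "(\<lambda>x. y \<otimes>\<^bsub>A\<^esub> x) \<in> linear_maps K A A"
      if "y \<in> carrier A" for y
      using that by (auto intro!: linear_mapsI
          simp: A'.A.l_distr A'.A.r_distr A'.smult_mult_left A'.smult_mult_right)
    show "comult A \<in> ring_hom A (tensor_algebra K A A)"
    proof (rule ring_hom_memI)
      fix x y assume xy: "x \<in> carrier A" "y \<in> carrier A"
      have "comult A (x \<otimes>\<^bsub>A\<^esub> y) =
          B.Sw ?A2 (f x \<otimes>\<^bsub>B\<^esub> f y) (\<lambda>u v. pure_tensor K A A (g u) (g v))"
        using xy by (simp add: comult f_mult)
      also have "\<dots> = B.Sw ?A2 (f x) (\<lambda>x1 x2. B.Sw ?A2 (f y) (\<lambda>y1 y2.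
          pure_tensor K A A (g (x1 \<otimes>\<^bsub>B\<^esub> y1)) (g (x2 \<otimes>\<^bsub>B\<^esub> y2))))"
        using xy A by (intro B.sw_mult) simp_all
      also have "\<dots> = B.Sw ?A2 (f x) (\<lambda>x1 x2. B.Sw ?A2 (f y) (\<lambda>y1 y2.
          pure_tensor K A A (g x1 \<otimes>\<^bsub>A\<^esub> g y1) (g x2 \<otimes>\<^bsub>A\<^esub> g y2)))"
        using xy by (simp add: g_mult)
      also have "\<dots> = B.Sw ?A2 (f x) (\<lambda>x1 x2. A.Sw ?A2 y (\<lambda>y1 y2.
          pure_tensor K A A (g x1 \<otimes>\<^bsub>A\<^esub> y1) (g x2 \<otimes>\<^bsub>A\<^esub> y2)))"
        using xy A by (intro B.sw_cong refl sw'[symmetric]) (simp_all add: lin_A)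
      also have "\<dots> = A.Sw ?A2 x (\<lambda>x1 x2. A.Sw ?A2 y (\<lambda>y1 y2.
          pure_tensor K A A (x1 \<otimes>\<^bsub>A\<^esub> y1) (x2 \<otimes>\<^bsub>A\<^esub> y2)))"
        using xy A by (intro sw'[symmetric]) (simp_all add: lin_A)
      finally show "comult A (x \<otimes>\<^bsub>A\<^esub> y) = comult A x \<otimes>\<^bsub>tensor_algebra K A A\<^esub> comult A y"
        by (simp add: tensor_algebra_def Let_def sweedler_def)
      show "comult A (x \<oplus>\<^bsub>A\<^esub> y) = comult A x \<oplus>\<^bsub>tensor_algebra K A A\<^esub> comult A y"
        using xy linear_add[OF comult_A] by (simp add: tensor_algebra_def Let_def)
    next
      show "comult A \<one>\<^bsub>A\<^esub> = \<one>\<^bsub>tensor_algebra K A A\<^esub>"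
        using A by (simp add: comult) (simp add: one_A fg B.sw_one tensor_algebra_def Let_def)
    qed (use linear_closed[OF comult_A] in \<open>simp add: tensor_algebra_def Let_def\<close>)
    show "counit A \<in> ring_hom A K"
    proof (rule ring_hom_memI)
      show "counit A x \<in> carrier K" if "x \<in> carrier A" for x
        using that by (simp add: f_counit[symmetric])
      fix x y assume xy: "x \<in> carrier A" "y \<in> carrier A"
      show "counit A (x \<otimes>\<^bsub>A\<^esub> y) = counit A x \<otimes>\<^bsub>K\<^esub> counit A y"
        using xy by (simp add: f_counit[symmetric] f_mult B.counit_mult)
      show "counit A (x \<oplus>\<^bsub>A\<^esub> y) = counit A x \<oplus>\<^bsub>K\<^esub> counit A y"
        using xy linear_add[OF f_linear] linear_add[OF B.counit_linear]
        by (simp add: f_counit[symmetric])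
    next
      show "counit A \<one>\<^bsub>A\<^esub> = \<one>\<^bsub>K\<^esub>"
        by (simp add: f_counit[symmetric]) (simp add: one_A fg)
    qed
    fix x assume x: "x \<in> carrier A"
    have [simp]: "counit A x \<in> carrier K"
      using x B.H_closed(3)[of "f x"] by (simp add: f_counit)
    have "A.Sw ?A3 x (\<lambda>w a3. A.Sw ?A3 w (\<lambda>a1 a2. pure_tensor K A ?A2 a1 (pure_tensor K A A a2 a3))) =
      A.Sw ?A3 x (\<lambda>w a3. B.Sw ?A3 (f w) (\<lambda>a1 a2. pure_tensor K A ?A2 (g a1) (pure_tensor K A A (g a2) a3)))"
      using x A by (intro A.sw_cong refl sw') simp_all
    also have "\<dots> = B.Sw ?A3 (f x) (\<lambda>w a3. B.Sw ?A3 (f (g w)) (\<lambda>a1 a2.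
        pure_tensor K A ?A2 (g a1) (pure_tensor K A A (g a2) (g a3))))"
      using x A by (intro sw') simp_all
    also have "\<dots> = B.Sw ?A3 (f x) (\<lambda>w a3. B.Sw ?A3 w (\<lambda>a1 a2.
        pure_tensor K A ?A2 (g a1) (pure_tensor K A A (g a2) (g a3))))"
      using x by (simp add: fg)
    also have "\<dots> = B.Sw ?A3 (f x) (\<lambda>a1 w. B.Sw ?A3 w (\<lambda>a2 a3.
        pure_tensor K A ?A2 (g a1) (pure_tensor K A A (g a2) (g a3))))"
      using x A by (intro B.sw_coassoc) simp_all
    also have "\<dots> = B.Sw ?A3 (f x) (\<lambda>a1 w. pure_tensor K A ?A2 (g a1)
        (B.Sw ?A2 w (\<lambda>a2 a3. pure_tensor K A A (g a2) (g a3))))"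
      using x A by (intro B.sw_cong refl B.linear_sw[symmetric]) simp_all
    also have "\<dots> = B.Sw ?A3 (f x) (\<lambda>a1 w. pure_tensor K A ?A2 (g a1) (comult A (g w)))"
      using x by (simp add: comult fg)
    also have "\<dots> = A.Sw ?A3 x (\<lambda>a1 w. pure_tensor K A ?A2 a1 (comult A w))"
      using x A by (intro sw'[symmetric]) simp_all
    finally show "let H2 = ?A2; H3 = tensor_module K A H2
      in sweedler3 K A H3 x (\<lambda>a1 a2 a3. pure_tensor K A H2 a1 (pure_tensor K A A a2 a3)) =
        sweedler K A H3 x (\<lambda>a1 x. pure_tensor K A H2 a1 (comult A x))"
      by (simp add: Let_def sweedler3_def)
    have to_B: "A.Sw A x (\<lambda>u v. g (F (f u) (f v))) = g (B.Sw B (f x) F)"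
      if "\<And>y. y \<in> carrier B \<Longrightarrow> (\<lambda>x. F x y) \<in> linear_maps K B B"
      "\<And>x. x \<in> carrier B \<Longrightarrow> (\<lambda>y. F x y) \<in> linear_maps K B B" for F
    proof -
      have "A.Sw A x (\<lambda>u v. g (F (f u) (f v))) = B.Sw A (f x) (\<lambda>u v. g (F u v))"
        using x A that by (intro sw) simp_all
      also have "\<dots> = g (B.Sw B (f x) F)"
        using x A linear_closed[OF that(1)] by (intro B.linear_sw[OF g_linear, symmetric]) simp_all
      finally show ?thesis .
    qed
    have "A.Sw A x (\<lambda>u v. counit A u \<odot>\<^bsub>A\<^esub> v) = A.Sw A x (\<lambda>u v. g (counit B (f u) \<odot>\<^bsub>B\<^esub> f v))"
      using x by (intro A.sw_cong refl) (simp_all add: linear_smult[OF g_linear] f_counit[symmetric] gf)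
    also have "\<dots> = x"
      using x by (simp add: to_B[of "\<lambda>u v. counit B u \<odot>\<^bsub>B\<^esub> v"] B.counit_left gf)
    finally show "A.Sw A x (\<lambda>u v. counit A u \<odot>\<^bsub>A\<^esub> v) = x" .
    have "A.Sw A x (\<lambda>u v. counit A v \<odot>\<^bsub>A\<^esub> u) = A.Sw A x (\<lambda>u v. g (counit B (f v) \<odot>\<^bsub>B\<^esub> f u))"
      using x by (intro A.sw_cong refl) (simp_all add: linear_smult[OF g_linear] f_counit[symmetric] gf)
    also have "\<dots> = x"
      using x by (simp add: to_B[of "\<lambda>u v. counit B v \<odot>\<^bsub>B\<^esub> u"] B.counit_right gf)
    finally show "A.Sw A x (\<lambda>u v. counit A v \<odot>\<^bsub>A\<^esub> u) = x" .
    have "A.Sw A x (\<lambda>u v. antipode A u \<otimes>\<^bsub>A\<^esub> v) = A.Sw A x (\<lambda>u v. g (antipode B (f u) \<otimes>\<^bsub>B\<^esub> f v))"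
      using x by (intro A.sw_cong refl) (simp_all add: antipode g_mult gf)
    also have "\<dots> = counit A x \<odot>\<^bsub>A\<^esub> \<one>\<^bsub>A\<^esub>"
      using x by (simp add: to_B[of "\<lambda>u v. antipode B u \<otimes>\<^bsub>B\<^esub> v"] B.antipode_left linear_smult[OF g_linear] one_A f_counit)
    finally show "A.Sw A x (\<lambda>u v. antipode A u \<otimes>\<^bsub>A\<^esub> v) = counit A x \<odot>\<^bsub>A\<^esub> \<one>\<^bsub>A\<^esub>" .
    have "A.Sw A x (\<lambda>u v. u \<otimes>\<^bsub>A\<^esub> antipode A v) = A.Sw A x (\<lambda>u v. g (f u \<otimes>\<^bsub>B\<^esub> antipode B (f v)))"
      using x by (intro A.sw_cong refl) (simp_all add: antipode g_mult gf)
    also have "\<dots> = counit A x \<odot>\<^bsub>A\<^esub> \<one>\<^bsub>A\<^esub>"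
      using x by (simp add: to_B[of "\<lambda>u v. u \<otimes>\<^bsub>B\<^esub> antipode B v"] B.antipode_right linear_smult[OF g_linear] one_A f_counit)
    finally show "A.Sw A x (\<lambda>u v. u \<otimes>\<^bsub>A\<^esub> antipode A v) = counit A x \<odot>\<^bsub>A\<^esub> \<one>\<^bsub>A\<^esub>" .
  qed
qed

section \<open>The Drinfeld double\<close>

context bijective_hopf_pairing
begin

text \<open>
  Applied to the pure tensors, this says that \<open>\<Phi>\<close> is invertible; applied to
  \<open>F x y = (1 \<otimes> y)(x \<otimes> 1)\<close>, it solves the cross relation for \<open>F\<close>.
\<close>

lemma twist_inverse:
  assumes P: "module K P" and ab: "a \<in> carrier H" "b \<in> carrier H"
    and F1: "\<And>y. y \<in> carrier H \<Longrightarrow> (\<lambda>x. F x y) \<in> linear_maps K H P"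
    and F2: "\<And>x. x \<in> carrier H \<Longrightarrow> (\<lambda>y. F x y) \<in> linear_maps K H P"
  shows "Sw P b (\<lambda>b1 b2. Sw P b1 (\<lambda>u v. F (a \<leftharpoonup> R b2 \<leftharpoonup> v) u)) = F a b"
    "Sw P b (\<lambda>b1 b2. Sw P b1 (\<lambda>u v. F (a \<leftharpoonup> b2 \<leftharpoonup> R v) u)) = F a b"
proof -
  note [simp] = linear_compose[OF F1] linear_compose[OF F2] linear_closed[OF F1]
  have "Sw P b (\<lambda>b1 b2. Sw P b1 (\<lambda>u v. F (a \<leftharpoonup> R b2 \<leftharpoonup> v) u)) =
      Sw P b (\<lambda>u y. Sw P y (\<lambda>v b2. F (a \<leftharpoonup> (R b2 \<cdot> v)) u))"
    using P ab by (simp add: hit_right_mult) (rule sw_coassoc; simp)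
  also have "\<dots> = Sw P b (\<lambda>u y. \<epsilon> y \<odot>\<^bsub>P\<^esub> F (a \<leftharpoonup> \<one>\<^bsub>H\<^esub>) u)"
    using P ab by (intro sw_cong refl sw_R_left) simp_all
  also have "\<dots> = F a b"
    using P ab F2 by (simp add: hit_one) (rule sw_counit_right; simp)
  finally show "Sw P b (\<lambda>b1 b2. Sw P b1 (\<lambda>u v. F (a \<leftharpoonup> R b2 \<leftharpoonup> v) u)) = F a b" .
  have "Sw P b (\<lambda>b1 b2. Sw P b1 (\<lambda>u v. F (a \<leftharpoonup> b2 \<leftharpoonup> R v) u)) =
      Sw P b (\<lambda>u y. Sw P y (\<lambda>v b2. F (a \<leftharpoonup> (b2 \<cdot> R v)) u))"
    using P ab by (simp add: hit_right_mult) (rule sw_coassoc; simp)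
  also have "\<dots> = Sw P b (\<lambda>u y. \<epsilon> y \<odot>\<^bsub>P\<^esub> F (a \<leftharpoonup> \<one>\<^bsub>H\<^esub>) u)"
    using P ab by (intro sw_cong refl sw_R_right) simp_all
  also have "\<dots> = F a b"
    using P ab F2 by (simp add: hit_one) (rule sw_counit_right; simp)
  finally show "Sw P b (\<lambda>b1 b2. Sw P b1 (\<lambda>u v. F (a \<leftharpoonup> b2 \<leftharpoonup> R v) u)) = F a b" .
qed

section \<open>The isomorphism and its inverse on the vector space
  \<open>H \<otimes> H\<close>\<close>

definition Phi where
  "Phi = tensor_lift K T (\<lambda>a b. Sw T b (\<lambda>b1 b2. (a \<leftharpoonup> b2) \<boxtimes> b1))"

definition Psi where
  "Psi = tensor_lift K T (\<lambda>a b. Sw T b (\<lambda>b1 b2. (a \<leftharpoonup> R b2) \<boxtimes> b1))"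

lemma Phi_linear: "Phi \<in> linear_maps K T T" and Psi_linear: "Psi \<in> linear_maps K T T"
  unfolding Phi_def Psi_def by (intro tensor_lift_linear bilinear_mapsI; simp)+

lemma Phi_pure:
  "\<lbrakk>a \<in> carrier H; b \<in> carrier H\<rbrakk> \<Longrightarrow> Phi (a \<boxtimes> b) = Sw T b (\<lambda>b1 b2. (a \<leftharpoonup> b2) \<boxtimes> b1)"
  unfolding Phi_def by (subst tensor_lift_pure) (auto intro: bilinear_mapsI)

lemma Psi_pure:
  "\<lbrakk>a \<in> carrier H; b \<in> carrier H\<rbrakk> \<Longrightarrow> Psi (a \<boxtimes> b) = Sw T b (\<lambda>b1 b2. (a \<leftharpoonup> R b2) \<boxtimes> b1)"
  unfolding Psi_def by (subst tensor_lift_pure) (auto intro: bilinear_mapsI)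

lemma Phi_Psi_closed [simp]:
  "t \<in> carrier T \<Longrightarrow> Phi t \<in> carrier T" "t \<in> carrier T \<Longrightarrow> Psi t \<in> carrier T"
  by (rule linear_closed[OF Phi_linear], simp) (rule linear_closed[OF Psi_linear], simp)

lemma lin_Phi_Psi [simp]:
  "f \<in> linear_maps K M T \<Longrightarrow> (\<lambda>x. Phi (f x)) \<in> linear_maps K M T"
  "f \<in> linear_maps K M T \<Longrightarrow> (\<lambda>x. Psi (f x)) \<in> linear_maps K M T"
  by (rule linear_compose[OF Phi_linear], simp) (rule linear_compose[OF Psi_linear], simp)

lemma Psi_Phi [simp]: "t \<in> carrier T \<Longrightarrow> Psi (Phi t) = t"
proof (rule tensor_ext[of K H H T _ "\<lambda>t. t"])
  fix a b assume ab: "a \<in> carrier H" "b \<in> carrier H"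
  show "Psi (Phi (a \<boxtimes> b)) = a \<boxtimes> b"
    using ab by (simp add: Phi_pure linear_sw[OF Psi_linear] Psi_pure)
      (rule twist_inverse[where F = "\<lambda>x y. x \<boxtimes> y"]; simp)
qed simp_all

lemma Phi_Psi [simp]: "t \<in> carrier T \<Longrightarrow> Phi (Psi t) = t"
proof (rule tensor_ext[of K H H T _ "\<lambda>t. t"])
  fix a b assume ab: "a \<in> carrier H" "b \<in> carrier H"
  show "Phi (Psi (a \<boxtimes> b)) = a \<boxtimes> b"
    using ab by (simp add: Psi_pure linear_sw[OF Phi_linear] Phi_pure)
      (rule twist_inverse[where F = "\<lambda>x y. x \<boxtimes> y"]; simp)
qed simp_all

text \<open>Both copies of \<open>H\<close> are fixed, so the relations inside each copy pass
  through the transport unchanged.\<close>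

lemma Phi_embeddings [simp]:
  assumes "a \<in> carrier H"
  shows "Phi (a \<boxtimes> \<one>\<^bsub>H\<^esub>) = a \<boxtimes> \<one>\<^bsub>H\<^esub>" "Phi (\<one>\<^bsub>H\<^esub> \<boxtimes> a) = \<one>\<^bsub>H\<^esub> \<boxtimes> a"
  using assms by (simp_all add: Phi_pure sw_one hit_one one_hit smult_out sw_counit_right)

text \<open>The first equation identifies \<open>Phi\<close> with the map of the theorem; the second
  is the product that the cross relation has to produce.\<close>

lemma star_embeddings:
  assumes "a \<in> carrier H" "b \<in> carrier H"
  shows "(a \<boxtimes> \<one>\<^bsub>H\<^esub>) \<star> (\<one>\<^bsub>H\<^esub> \<boxtimes> b) = Phi (a \<boxtimes> b)"
    "(\<one>\<^bsub>H\<^esub> \<boxtimes> b) \<star> (a \<boxtimes> \<one>\<^bsub>H\<^esub>) = Sw T b (\<lambda>b1 b2. (b1 \<rightharpoonup> a) \<boxtimes> b2)"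
    "(a \<boxtimes> \<one>\<^bsub>H\<^esub>) \<star> (b \<boxtimes> \<one>\<^bsub>H\<^esub>) = (a \<cdot> b) \<boxtimes> \<one>\<^bsub>H\<^esub>"
    "(\<one>\<^bsub>H\<^esub> \<boxtimes> a) \<star> (\<one>\<^bsub>H\<^esub> \<boxtimes> b) = \<one>\<^bsub>H\<^esub> \<boxtimes> (a \<cdot> b)"
  using assms
  by (simp_all add: star_pure Phi_pure sw_one hit_one)
    (simp_all add: one_hit smult_out sw_counit_left sw_counit_right,
      simp add: sw_smult[symmetric] sw_counit_left sw_counit_right)

text \<open>The product of the twisted square pulled back along \<open>Phi\<close>. It is restricted
  to the carrier because \<open>is_drinfeld_mult\<close> asks for an extensional function, which
  makes uniqueness an equality of functions.\<close>

definition double_mult where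
  "double_mult = (\<lambda>s\<in>carrier T. \<lambda>t\<in>carrier T. Psi (Phi s \<star> Phi t))"

lemma double_mult_apply:
  "\<lbrakk>s \<in> carrier T; t \<in> carrier T\<rbrakk> \<Longrightarrow> double_mult s t = Psi (Phi s \<star> Phi t)"
  by (simp add: double_mult_def)

text \<open>Folding the sum over \<open>a\<close> into the actions leaves a relation with coproducts
  of \<open>b\<close> only, and that form can be inverted by \<open>twist_inverse\<close>.\<close>

lemma cross_relation_iff:
  assumes "a \<in> carrier H" "b \<in> carrier H"
    and m: "\<And>y. y \<in> carrier H \<Longrightarrow> (\<lambda>x. m (\<one>\<^bsub>H\<^esub> \<boxtimes> y) (x \<boxtimes> \<one>\<^bsub>H\<^esub>)) \<in> linear_maps K H T"
  shows "Sw T a (\<lambda>a1 a2. Sw T b (\<lambda>b1 b2.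
       \<phi> a1 b2 \<odot>\<^bsub>T\<^esub> m (\<one>\<^bsub>H\<^esub> \<boxtimes> b1) (a2 \<boxtimes> \<one>\<^bsub>H\<^esub>))) =
     Sw T a (\<lambda>a1 a2. Sw T b (\<lambda>b1 b2. \<phi> a2 b1 \<odot>\<^bsub>T\<^esub> (a1 \<boxtimes> b2))) \<longleftrightarrow>
   Sw T b (\<lambda>b1 b2. m (\<one>\<^bsub>H\<^esub> \<boxtimes> b1) ((a \<leftharpoonup> b2) \<boxtimes> \<one>\<^bsub>H\<^esub>)) =
     Sw T b (\<lambda>b1 b2. (b1 \<rightharpoonup> a) \<boxtimes> b2)"
proof -
  have [simp]: "m (\<one>\<^bsub>H\<^esub> \<boxtimes> y) (x \<boxtimes> \<one>\<^bsub>H\<^esub>) \<in> carrier T" if "x \<in> carrier H" "y \<in> carrier H" for x y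
    using linear_closed[OF m] that by blast
  have "Sw T a (\<lambda>a1 a2. Sw T b (\<lambda>b1 b2. \<phi> a1 b2 \<odot>\<^bsub>T\<^esub> m (\<one>\<^bsub>H\<^esub> \<boxtimes> b1) (a2 \<boxtimes> \<one>\<^bsub>H\<^esub>))) =
      Sw T b (\<lambda>b1 b2. Sw T a (\<lambda>a1 a2. \<phi> a1 b2 \<odot>\<^bsub>T\<^esub> m (\<one>\<^bsub>H\<^esub> \<boxtimes> b1) (a2 \<boxtimes> \<one>\<^bsub>H\<^esub>)))"
    using assms(1,2) by (intro sw_swap) simp_all
  also have "\<dots> = Sw T b (\<lambda>b1 b2. m (\<one>\<^bsub>H\<^esub> \<boxtimes> b1) ((a \<leftharpoonup> b2) \<boxtimes> \<one>\<^bsub>H\<^esub>))"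
    using assms(1,2) by (intro sw_cong refl linear_hit_right[OF m, symmetric]) simp_all
  finally have left: "Sw T a (\<lambda>a1 a2. Sw T b (\<lambda>b1 b2.
      \<phi> a1 b2 \<odot>\<^bsub>T\<^esub> m (\<one>\<^bsub>H\<^esub> \<boxtimes> b1) (a2 \<boxtimes> \<one>\<^bsub>H\<^esub>))) =
    Sw T b (\<lambda>b1 b2. m (\<one>\<^bsub>H\<^esub> \<boxtimes> b1) ((a \<leftharpoonup> b2) \<boxtimes> \<one>\<^bsub>H\<^esub>))" .
  have "Sw T a (\<lambda>a1 a2. Sw T b (\<lambda>b1 b2. \<phi> a2 b1 \<odot>\<^bsub>T\<^esub> (a1 \<boxtimes> b2))) =
      Sw T b (\<lambda>b1 b2. Sw T a (\<lambda>a1 a2. \<phi> a2 b1 \<odot>\<^bsub>T\<^esub> (a1 \<boxtimes> b2)))"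
    using assms(1,2) by (intro sw_swap) simp_all
  also have "\<dots> = Sw T b (\<lambda>b1 b2. (b1 \<rightharpoonup> a) \<boxtimes> b2)"
    using assms(1,2) by (intro sw_cong refl linear_hit_left[where f = "\<lambda>a. a \<boxtimes> _", symmetric]) simp_all
  finally show ?thesis by (simp add: left)
qed

lemma transport_double_mult:
  assumes "module K A" "carrier A = carrier T" "add A = add T" "smult A = smult T"
    and "one A = \<one>\<^bsub>H\<^esub> \<boxtimes> \<one>\<^bsub>H\<^esub>" "\<And>s t. \<lbrakk>s \<in> carrier T; t \<in> carrier T\<rbrakk> \<Longrightarrow> mult A s t = double_mult s t"
  shows "transport K A Q Phi Psi"
proof (rule transport.intro)
  show "\<one>\<^bsub>A\<^esub> = Psi \<one>\<^bsub>Q\<^esub>"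
  proof -
    have "Psi (\<one>\<^bsub>H\<^esub> \<boxtimes> \<one>\<^bsub>H\<^esub>) = \<one>\<^bsub>H\<^esub> \<boxtimes> \<one>\<^bsub>H\<^esub>"
      using Psi_Phi[of "\<one>\<^bsub>H\<^esub> \<boxtimes> \<one>\<^bsub>H\<^esub>"] by (simp del: Psi_Phi)
    then show ?thesis by (simp add: assms)
  qed
qed (use assms Phi_linear Psi_linear in \<open>simp_all add: linear_maps_def double_mult_apply\<close>)

lemma Psi_eqI: "\<lbrakk>s \<in> carrier T; t = Phi s\<rbrakk> \<Longrightarrow> Psi t = s"
  by simp

lemma is_drinfeld_mult_double_mult: "is_drinfeld_mult K H \<phi> double_mult"
  unfolding is_drinfeld_mult_def
proof (intro conjI ballI)
  show "double_mult \<in> carrier T \<rightarrow>\<^sub>E carrier T \<rightarrow>\<^sub>E carrier T"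
    by (auto simp: double_mult_def)
  let ?A = "T\<lparr>mult := double_mult, one := \<one>\<^bsub>H\<^esub> \<boxtimes> \<one>\<^bsub>H\<^esub>\<rparr>"
  interpret T: module K T by simp
  have "module K ?A"
    using module_cong[of K T ?A] by simp
  then have "transport K ?A Q Phi Psi"
    by (rule transport_double_mult) simp_all
  then show "unital_algebra K ?A"
    by (rule transport.unital_algebra_transport) (rule unital_algebra_Q)
next
  fix a b assume ab: "a \<in> carrier H" "b \<in> carrier H"
  show "double_mult (a \<boxtimes> \<one>\<^bsub>H\<^esub>) (b \<boxtimes> \<one>\<^bsub>H\<^esub>) = (a \<cdot> b) \<boxtimes> \<one>\<^bsub>H\<^esub>"
    "double_mult (\<one>\<^bsub>H\<^esub> \<boxtimes> a) (\<one>\<^bsub>H\<^esub> \<boxtimes> b) = \<one>\<^bsub>H\<^esub> \<boxtimes> (a \<cdot> b)"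
    "double_mult (a \<boxtimes> \<one>\<^bsub>H\<^esub>) (\<one>\<^bsub>H\<^esub> \<boxtimes> b) = a \<boxtimes> b"
    using ab by (auto intro!: Psi_eqI simp: double_mult_apply star_embeddings)
  have dm: "double_mult (\<one>\<^bsub>H\<^esub> \<boxtimes> y) (x \<boxtimes> \<one>\<^bsub>H\<^esub>) = Psi (Sw T y (\<lambda>b1 b2. (b1 \<rightharpoonup> x) \<boxtimes> b2))"
    if "x \<in> carrier H" "y \<in> carrier H" for x y
    using that by (simp add: double_mult_apply star_embeddings)
  have lin: "(\<lambda>x. double_mult (\<one>\<^bsub>H\<^esub> \<boxtimes> y) (x \<boxtimes> \<one>\<^bsub>H\<^esub>)) \<in> linear_maps K H T"
    if "y \<in> carrier H" for y
    using that
    by (subst linear_cong[where g = "\<lambda>x. Psi (Sw T y (\<lambda>b1 b2. (b1 \<rightharpoonup> x) \<boxtimes> b2))"])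
      (simp_all add: dm)
  show "Sw T a (\<lambda>a1 a2. Sw T b (\<lambda>b1 b2.
       \<phi> a1 b2 \<odot>\<^bsub>T\<^esub> double_mult (\<one>\<^bsub>H\<^esub> \<boxtimes> b1) (a2 \<boxtimes> \<one>\<^bsub>H\<^esub>))) =
     Sw T a (\<lambda>a1 a2. Sw T b (\<lambda>b1 b2. \<phi> a2 b1 \<odot>\<^bsub>T\<^esub> (a1 \<boxtimes> b2)))"
  proof (rule iffD2[OF cross_relation_iff[where m = double_mult, OF ab]], erule lin)
    have "Sw T b (\<lambda>b1 b2. double_mult (\<one>\<^bsub>H\<^esub> \<boxtimes> b1) ((a \<leftharpoonup> b2) \<boxtimes> \<one>\<^bsub>H\<^esub>)) =
        Psi (Sw T b (\<lambda>b1 b2. Sw T b1 (\<lambda>u v. (u \<rightharpoonup> (a \<leftharpoonup> b2)) \<boxtimes> v)))"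
      using ab by (simp add: dm linear_sw[OF Psi_linear])
    \<comment> \<open>Since the two actions commute, the sum inside \<open>Psi\<close> is
      \<open>Phi\<close> of the right-hand side of the cross relation.\<close>
    also have "\<dots> = Psi (Phi (Sw T b (\<lambda>b1 b2. (b1 \<rightharpoonup> a) \<boxtimes> b2)))"
      using ab by (simp add: linear_sw[OF Phi_linear] Phi_pure sw_coassoc hit_commute)
    also have "\<dots> = Sw T b (\<lambda>b1 b2. (b1 \<rightharpoonup> a) \<boxtimes> b2)"
      using ab by simp
    finally show "Sw T b (\<lambda>b1 b2. double_mult (\<one>\<^bsub>H\<^esub> \<boxtimes> b1) ((a \<leftharpoonup> b2) \<boxtimes> \<one>\<^bsub>H\<^esub>)) =
      Sw T b (\<lambda>b1 b2. (b1 \<rightharpoonup> a) \<boxtimes> b2)" .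
  qed
qed

text \<open>Factoring \<open>a \<boxtimes> b\<close> through the two copies of \<open>H\<close>,
  associativity reduces the product to \<open>(1 \<otimes> b)(c \<otimes> 1)\<close>, which the
  cross relation determines. The right-hand side does not mention \<open>m\<close>, and this gives
  uniqueness.\<close>

lemma drinfeld_mult_pure:
  assumes m: "is_drinfeld_mult K H \<phi> m"
    and H: "a \<in> carrier H" "b \<in> carrier H" "c \<in> carrier H" "d \<in> carrier H"
  shows "m (a \<boxtimes> b) (c \<boxtimes> d) =
    Sw T b (\<lambda>b1 b2. Sw T b1 (\<lambda>u v. (a \<cdot> (u \<rightharpoonup> (c \<leftharpoonup> R b2))) \<boxtimes> (v \<cdot> d)))"
proof -
  interpret A: unital_algebra K "T\<lparr>mult := m, one := \<one>\<^bsub>H\<^esub> \<boxtimes> \<one>\<^bsub>H\<^esub>\<rparr>"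
    using m by (simp add: is_drinfeld_mult_def)
  note m' = m[unfolded is_drinfeld_mult_def]
  have aa: "m (x \<boxtimes> \<one>\<^bsub>H\<^esub>) (y \<boxtimes> \<one>\<^bsub>H\<^esub>) = (x \<cdot> y) \<boxtimes> \<one>\<^bsub>H\<^esub>"
    and bb: "m (\<one>\<^bsub>H\<^esub> \<boxtimes> x) (\<one>\<^bsub>H\<^esub> \<boxtimes> y) = \<one>\<^bsub>H\<^esub> \<boxtimes> (x \<cdot> y)"
    and ab: "m (x \<boxtimes> \<one>\<^bsub>H\<^esub>) (\<one>\<^bsub>H\<^esub> \<boxtimes> y) = x \<boxtimes> y"
    if "x \<in> carrier H" "y \<in> carrier H" for x y
    using m' that by blast+
  have m_closed [simp]: "m s t \<in> carrier T" if "s \<in> carrier T" "t \<in> carrier T" for s t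
    using A.A.m_closed[of s t] that by simp
  have assoc: "m (m s t) u = m s (m t u)"
    if "s \<in> carrier T" "t \<in> carrier T" "u \<in> carrier T" for s t u
    using A.A.m_assoc[of s t u] that by simp
  have left: "(\<lambda>s. m s t) \<in> linear_maps K T T" and right: "(\<lambda>s. m t s) \<in> linear_maps K T T"
    if "t \<in> carrier T" for t
    using that A.A.l_distr A.A.r_distr A.smult_mult_left A.smult_mult_right
    by (auto intro!: linear_mapsI)
  have [simp]: "(\<lambda>x. m (f x) t) \<in> linear_maps K M T" "(\<lambda>x. m t (f x)) \<in> linear_maps K M T"
    if "f \<in> linear_maps K M T" "t \<in> carrier T" for f t and M :: "('a, 'x, 'y) module_scheme"
    using that by (auto intro: linear_compose[OF left] linear_compose[OF right])
  have cross: "m (\<one>\<^bsub>H\<^esub> \<boxtimes> b) (c \<boxtimes> \<one>\<^bsub>H\<^esub>) =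
      Sw T b (\<lambda>b1 b2. Sw T b1 (\<lambda>u v. (u \<rightharpoonup> (c \<leftharpoonup> R b2)) \<boxtimes> v))"
  proof -
    have rel: "Sw T b (\<lambda>b1 b2. m (\<one>\<^bsub>H\<^esub> \<boxtimes> b1) ((c \<leftharpoonup> b2) \<boxtimes> \<one>\<^bsub>H\<^esub>)) =
        Sw T b (\<lambda>b1 b2. (b1 \<rightharpoonup> c) \<boxtimes> b2)"
      if "b \<in> carrier H" "c \<in> carrier H" for b c
      using m' that by (subst cross_relation_iff[symmetric]) (simp_all add: left right)
    \<comment> \<open>\<open>twist_inverse\<close> read backwards inserts a cancelling pair of legs,
      after which the inner sum is the left side of \<open>rel\<close> for
      \<open>c \<leftharpoonup> R b2\<close> and \<open>b1\<close>.\<close>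
    have "m (\<one>\<^bsub>H\<^esub> \<boxtimes> b) (c \<boxtimes> \<one>\<^bsub>H\<^esub>) = Sw T b (\<lambda>b1 b2. Sw T b1 (\<lambda>u v.
        m (\<one>\<^bsub>H\<^esub> \<boxtimes> u) ((c \<leftharpoonup> R b2 \<leftharpoonup> v) \<boxtimes> \<one>\<^bsub>H\<^esub>)))"
      using H by (intro twist_inverse(1)[symmetric, where F = "\<lambda>x y. m (\<one>\<^bsub>H\<^esub> \<boxtimes> y) (x \<boxtimes> \<one>\<^bsub>H\<^esub>)"]) simp_all
    also have "\<dots> = Sw T b (\<lambda>b1 b2. Sw T b1 (\<lambda>u v. (u \<rightharpoonup> (c \<leftharpoonup> R b2)) \<boxtimes> v))"
      using H by (intro sw_cong refl rel) simp_all
    finally show ?thesis .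
  qed
  have pull: "m (a \<boxtimes> \<one>\<^bsub>H\<^esub>) (m (p \<boxtimes> q) (\<one>\<^bsub>H\<^esub> \<boxtimes> d)) = (a \<cdot> p) \<boxtimes> (q \<cdot> d)"
    if "p \<in> carrier H" "q \<in> carrier H" for p q
  proof -
    have "m (a \<boxtimes> \<one>\<^bsub>H\<^esub>) (m (p \<boxtimes> q) (\<one>\<^bsub>H\<^esub> \<boxtimes> d)) =
      m (a \<boxtimes> \<one>\<^bsub>H\<^esub>) (m (m (p \<boxtimes> \<one>\<^bsub>H\<^esub>) (\<one>\<^bsub>H\<^esub> \<boxtimes> q)) (\<one>\<^bsub>H\<^esub> \<boxtimes> d))"
      using that by (simp add: ab)
    also have "\<dots> = m (m (a \<boxtimes> \<one>\<^bsub>H\<^esub>) (p \<boxtimes> \<one>\<^bsub>H\<^esub>)) (m (\<one>\<^bsub>H\<^esub> \<boxtimes> q) (\<one>\<^bsub>H\<^esub> \<boxtimes> d))"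
      using H that by (simp add: assoc)
    finally show ?thesis
      using H that by (simp add: aa bb ab)
  qed
  have "m (a \<boxtimes> b) (c \<boxtimes> d) =
      m (m (a \<boxtimes> \<one>\<^bsub>H\<^esub>) (\<one>\<^bsub>H\<^esub> \<boxtimes> b)) (m (c \<boxtimes> \<one>\<^bsub>H\<^esub>) (\<one>\<^bsub>H\<^esub> \<boxtimes> d))"
    using H by (simp add: ab)
  also have "\<dots> =
      m (a \<boxtimes> \<one>\<^bsub>H\<^esub>) (m (m (\<one>\<^bsub>H\<^esub> \<boxtimes> b) (c \<boxtimes> \<one>\<^bsub>H\<^esub>)) (\<one>\<^bsub>H\<^esub> \<boxtimes> d))"
    using H by (simp add: assoc)
  also have "\<dots> = Sw T b (\<lambda>b1 b2. Sw T b1 (\<lambda>u v. (a \<cdot> (u \<rightharpoonup> (c \<leftharpoonup> R b2))) \<boxtimes> (v \<cdot> d)))"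
    using H by (simp add: cross linear_sw[OF left] linear_sw[OF right] pull)
  finally show ?thesis .
qed

lemma drinfeld_mult_eq: "drinfeld_mult K H \<phi> = double_mult"
  unfolding drinfeld_mult_def
proof (rule the_equality)
  show "is_drinfeld_mult K H \<phi> double_mult"
    by (rule is_drinfeld_mult_double_mult)
  fix m assume m: "is_drinfeld_mult K H \<phi> m"
  \<comment> \<open>Stated for an arbitrary solution \<open>n\<close>, as it is needed for
    \<open>m\<close> and for \<open>double_mult\<close>.\<close>
  have funcset: "n \<in> carrier T \<rightarrow>\<^sub>E carrier T \<rightarrow>\<^sub>E carrier T"
    and left: "t \<in> carrier T \<Longrightarrow> (\<lambda>s. n s t) \<in> linear_maps K T T"
    and right: "t \<in> carrier T \<Longrightarrow> (\<lambda>s. n t s) \<in> linear_maps K T T"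
    if n: "is_drinfeld_mult K H \<phi> n" for n t
  proof -
    interpret A: unital_algebra K "T\<lparr>mult := n, one := \<one>\<^bsub>H\<^esub> \<boxtimes> \<one>\<^bsub>H\<^esub>\<rparr>"
      using n by (simp add: is_drinfeld_mult_def)
    show "n \<in> carrier T \<rightarrow>\<^sub>E carrier T \<rightarrow>\<^sub>E carrier T"
      using n by (simp add: is_drinfeld_mult_def)
    show "(\<lambda>s. n s t) \<in> linear_maps K T T" "(\<lambda>s. n t s) \<in> linear_maps K T T"
      if "t \<in> carrier T"
      using that A.A.l_distr A.A.r_distr A.smult_mult_left A.smult_mult_right A.A.m_closed
      by (auto intro!: linear_mapsI)
  qed
  note m' = funcset[OF m] left[OF m] right[OF m]
  note d = is_drinfeld_mult_double_mult
  note d' = funcset[OF d] left[OF d] right[OF d]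
  have eq: "m s t = double_mult s t" if s: "s \<in> carrier T" and t: "t \<in> carrier T" for s t
  proof (rule tensor_ext[of K H H T _ _ s])
    fix a b assume ab: "a \<in> carrier H" "b \<in> carrier H"
    show "m (a \<boxtimes> b) t = double_mult (a \<boxtimes> b) t"
      by (rule tensor_ext[of K H H T _ _ t])
        (use ab t m' d' in \<open>simp_all add: drinfeld_mult_pure[OF m] drinfeld_mult_pure[OF d]\<close>)
  qed (use s t m' d' in simp_all)
  \<comment> \<open>Agreement on the carrier extends to all arguments because both functions are
    extensional in each argument.\<close>
  show "m = double_mult"
  proof (rule ext)
    fix s show "m s = double_mult s"
    proof (cases "s \<in> carrier T")
      case True
      then have "m s \<in> carrier T \<rightarrow>\<^sub>E carrier T" "double_mult s \<in> carrier T \<rightarrow>\<^sub>E carrier T"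
        using m'(1) d'(1) by (auto dest: PiE_mem)
      then show ?thesis
        by (rule PiE_ext) (use eq True in simp)
    next
      case False
      then show ?thesis using PiE_arb[OF m'(1)] PiE_arb[OF d'(1)] by simp
    qed
  qed
qed

section \<open>The Hopf structure of the double and its comparison with the twisted square\<close>

abbreviation (input) "D \<equiv> drinfeld_double K H \<phi>"

lemma D_simps [simp]:
  "carrier D = carrier T" "zero D = zero T" "add D = add T" "smult D = smult T"
  "one D = \<one>\<^bsub>H\<^esub> \<boxtimes> \<one>\<^bsub>H\<^esub>" "mult D = double_mult"
  by (simp_all add: drinfeld_double_def drinfeld_mult_eq)

lemma D_linear [simp]: "linear_maps K D P = linear_maps K T P" "linear_maps K P D = linear_maps K P T"
  by (simp_all add: linear_maps_def)

lemma D_tensor [simp]: "tensor_module K D D = TT"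
  by (intro tensor_cong; simp)

lemma module_D: "module K D"
  by (rule module_cong[of K T]) simp_all

lemma transport_D: "transport K D Q Phi Psi"
  by (rule transport_double_mult) (simp_all add: module_D)

lemma comult_D_linear: "comult D \<in> linear_maps K T TT"
  unfolding drinfeld_double_def by simp (intro tensor_lift_linear bilinear_mapsI; simp)

lemma comult_D_pure:
  "\<lbrakk>a \<in> carrier H; b \<in> carrier H\<rbrakk> \<Longrightarrow>
    comult D (a \<boxtimes> b) = Sw TT a (\<lambda>a1 a2. Sw TT b (\<lambda>b1 b2. (a1 \<boxtimes> b2) \<boxtimes>\<boxtimes> (a2 \<boxtimes> b1)))"
  unfolding drinfeld_double_def by simp (subst tensor_lift_pure; auto intro: bilinear_mapsI)

lemma counit_D_linear: "counit D \<in> linear_maps K T KK"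
  unfolding drinfeld_double_def by simp (intro tensor_lift_linear bilinear_mapsI; simp)

lemma counit_D_pure:
  "\<lbrakk>a \<in> carrier H; b \<in> carrier H\<rbrakk> \<Longrightarrow> counit D (a \<boxtimes> b) = \<epsilon> a \<otimes>\<^bsub>K\<^esub> \<epsilon> b"
  unfolding drinfeld_double_def by simp (subst tensor_lift_pure; auto intro: bilinear_mapsI)

text \<open>\<open>double_mult\<close> is a restricted function; its linearity is read off from the
  unrestricted formula that it satisfies on the carrier.\<close>

lemma antipode_D_bilinear:
  "(\<lambda>a b. double_mult (\<one>\<^bsub>H\<^esub> \<boxtimes> R b) (S a \<boxtimes> \<one>\<^bsub>H\<^esub>)) \<in> bilinear_maps K H H T"
proof (intro bilinear_mapsI)
  fix x assume x: "x \<in> carrier H"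
  show "(\<lambda>y. double_mult (\<one>\<^bsub>H\<^esub> \<boxtimes> R y) (S x \<boxtimes> \<one>\<^bsub>H\<^esub>)) \<in> linear_maps K H T"
    by (subst linear_cong[where g = "\<lambda>y. Psi (Phi (\<one>\<^bsub>H\<^esub> \<boxtimes> R y) \<star> Phi (S x \<boxtimes> \<one>\<^bsub>H\<^esub>))"])
      (use x in \<open>simp_all add: double_mult_apply del: Phi_embeddings\<close>)
  show "(\<lambda>y. double_mult (\<one>\<^bsub>H\<^esub> \<boxtimes> R x) (S y \<boxtimes> \<one>\<^bsub>H\<^esub>)) \<in> linear_maps K H T"
    by (subst linear_cong[where g = "\<lambda>y. Psi (Phi (\<one>\<^bsub>H\<^esub> \<boxtimes> R x) \<star> Phi (S y \<boxtimes> \<one>\<^bsub>H\<^esub>))"])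
      (use x in \<open>simp_all add: double_mult_apply del: Phi_embeddings\<close>)
qed

lemma antipode_D_linear: "antipode D \<in> linear_maps K T T"
  unfolding drinfeld_double_def
  by (simp add: drinfeld_mult_eq tensor_lift_linear antipode_D_bilinear)

lemma antipode_D_pure:
  "\<lbrakk>a \<in> carrier H; b \<in> carrier H\<rbrakk> \<Longrightarrow>
    antipode D (a \<boxtimes> b) = double_mult (\<one>\<^bsub>H\<^esub> \<boxtimes> R b) (S a \<boxtimes> \<one>\<^bsub>H\<^esub>)"
  unfolding drinfeld_double_def
  by (simp add: drinfeld_mult_eq tensor_lift_pure[OF _ _ _ antipode_D_bilinear])

lemma Phi_Phi_bilinear: "(\<lambda>s t. Phi s \<boxtimes>\<boxtimes> Phi t) \<in> bilinear_maps K T T TT"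
  by (intro bilinear_mapsI) simp_all

text \<open>On a pure tensor both sides are the sum of \<open>((a1 \<leftharpoonup> b4) \<boxtimes>
  b3) \<boxtimes>\<boxtimes> ((a2 \<leftharpoonup> b2) \<boxtimes> b1)\<close>: on the right each
  leg of \<open>b\<close> is split once more by \<open>Phi\<close>, on the left
  \<open>sw_hit_right\<close> puts the action of \<open>b4\<close> on the first leg of
  \<open>a\<close>.\<close>

lemma Phi_comult:
  assumes "x \<in> carrier T"
  shows "comult Q (Phi x) = tensor_map K Q Q Phi Phi (comult D x)"
proof -
  have lift: "tensor_map K Q Q Phi Phi = tensor_lift K TT (\<lambda>s t. Phi s \<boxtimes>\<boxtimes> Phi t)"
    by (simp add: tensor_map_def)
  have lin: "tensor_lift K TT (\<lambda>s t. Phi s \<boxtimes>\<boxtimes> Phi t) \<in> linear_maps K TT TT"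
    by (rule tensor_lift_linear) (simp_all add: Phi_Phi_bilinear)
  show ?thesis
    unfolding lift
  proof (rule tensor_ext[of K H H TT _ _ x])
    fix a b assume ab: "a \<in> carrier H" "b \<in> carrier H"
    have [simp]: "before a b" by (simp add: before_def)
    show "comult Q (Phi (a \<boxtimes> b)) =
        tensor_lift K TT (\<lambda>s t. Phi s \<boxtimes>\<boxtimes> Phi t) (comult D (a \<boxtimes> b))"
      using ab
      apply (simp add: Phi_pure comult_D_pure linear_sw[OF comult_Q_linear] linear_sw[OF lin]
          tensor_lift_pure[OF _ _ _ Phi_Phi_bilinear])
      apply (simp add: Phi_pure comult_Q_pure sw_hit_right sw_TT_out)
      apply (simp add: sw_normalize cong: sw_cong_ordered)
      done
  qed (use assms in \<open>simp_all add: linear_compose[OF lin] comult_D_linear linear_compose[OF comult_Q_linear] Phi_linear\<close>)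
qed

lemma Phi_counit:
  assumes "x \<in> carrier T"
  shows "counit Q (Phi x) = counit D x"
proof (rule tensor_ext[of K H H KK _ _ x])
  fix a b assume ab: "a \<in> carrier H" "b \<in> carrier H"
  have "counit Q (Phi (a \<boxtimes> b)) = Sw KK b (\<lambda>b1 b2. \<phi> a (b2 \<cdot> R b1))"
    using ab by (simp add: Phi_pure linear_sw[OF counit_Q_linear] counit_Q_pure pairing_hit_right)
  \<comment> \<open>The inverse antipode in the twisted counit cancels the leg that
    \<open>Phi\<close> has moved into the action.\<close>
  also have "\<dots> = \<epsilon> b \<odot>\<^bsub>KK\<^esub> \<phi> a \<one>\<^bsub>H\<^esub>"
    using ab by (intro sw_R_right) simp_all
  finally show "counit Q (Phi (a \<boxtimes> b)) = counit D (a \<boxtimes> b)"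
    using ab by (simp add: counit_D_pure pairing_one_right m_comm)
qed (use assms counit_D_linear in simp_all)

text \<open>The right side is \<open>(1 \<otimes> R b) \<star> (S a \<otimes> 1)\<close>, the sum of
  \<open>(R b2 \<rightharpoonup> S a) \<boxtimes> R b1\<close>, and \<open>hit_left_antipode\<close>
  rewrites the first factor as \<open>S (a \<leftharpoonup> b2)\<close>.\<close>

lemma Phi_antipode:
  assumes "x \<in> carrier T"
  shows "antipode Q (Phi x) = Phi (antipode D x)"
proof (rule tensor_ext[of K H H T _ _ x])
  fix a b assume ab: "a \<in> carrier H" "b \<in> carrier H"
  show "antipode Q (Phi (a \<boxtimes> b)) = Phi (antipode D (a \<boxtimes> b))"
    using ab
    by (simp add: antipode_D_pure double_mult_apply star_embeddings)
      (simp add: Phi_pure linear_sw[OF antipode_Q_linear] antipode_Q_pure sw_R hit_left_antipode)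
qed (use assms linear_compose[OF Phi_linear antipode_D_linear] in simp_all)

theorem hopf_algebra_D: "hopf_algebra K D"
  by (rule hopf_algebra_transport[OF transport_D hopf_algebra_Q])
    (use linear_closed[OF antipode_D_linear] in
      \<open>simp_all add: comult_D_linear Phi_comult Phi_counit Phi_antipode\<close>)

lemma Phi_bij: "bij_betw Phi (carrier T) (carrier T)"
  by (rule bij_betw_byWitness[where f' = Psi]) auto

lemma Phi_mult: "\<lbrakk>s \<in> carrier T; t \<in> carrier T\<rbrakk> \<Longrightarrow> Phi (double_mult s t) = Phi s \<star> Phi t"
  by (simp add: double_mult_apply)

theorem Phi_hopf_iso: "Phi \<in> hopf_iso K D Q"
  unfolding hopf_iso_def hopf_hom_def
  using linear_add[OF Phi_linear] Phi_linear Phi_bij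
  by (auto intro!: ring_hom_memI simp: Phi_mult Phi_comult Phi_counit Phi_antipode)

text \<open>Expanding the action recovers the formula for the inverse in the theorem.\<close>

lemma Psi_pure_sweedler:
  assumes "a \<in> carrier H" "b \<in> carrier H"
  shows "Psi (a \<boxtimes> b) = Sw T a (\<lambda>a1 a2. Sw T b (\<lambda>b1 b2. \<phi> a1 (R b2) \<odot>\<^bsub>T\<^esub> (a2 \<boxtimes> b1)))"
proof -
  have "Psi (a \<boxtimes> b) = Sw T b (\<lambda>b1 b2. Sw T a (\<lambda>a1 a2. \<phi> a1 (R b2) \<odot>\<^bsub>T\<^esub> (a2 \<boxtimes> b1)))"
    using assms by (simp add: Psi_pure linear_hit_right[where P = T and f = "\<lambda>a. a \<boxtimes> y" for y])
  also have "\<dots> = Sw T a (\<lambda>a1 a2. Sw T b (\<lambda>b1 b2. \<phi> a1 (R b2) \<odot>\<^bsub>T\<^esub> (a2 \<boxtimes> b1)))"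
    using assms by (intro sw_swap) simp_all
  finally show ?thesis .
qed

end

theorem proposition2p8:
  fixes K :: "('k, 'n) ring_scheme"
    and H :: "('k, 'h, 'm) hopf_scheme"
    and \<phi> :: "'h \<Rightarrow> 'h \<Rightarrow> 'k"
  assumes "field K"
    and "hopf_algebra K H"
    and "bij_betw (antipode H) (carrier H) (carrier H)"
    and "hopf_pairing K H \<phi>"
  shows "hopf_algebra K (drinfeld_double K H \<phi>) \<and>
    hopf_algebra K (twisted_square K H \<phi>) \<and>
    (\<exists>\<Phi>\<in>hopf_iso K (drinfeld_double K H \<phi>) (twisted_square K H \<phi>).
      \<forall>a\<in>carrier H. \<forall>b\<in>carrier H.
        \<Phi> (pure_tensor K H H a b) =
          pure_tensor K H H a \<one>\<^bsub>H\<^esub> \<otimes>\<^bsub>twisted_square K H \<phi>\<^esub> pure_tensor K H H \<one>\<^bsub>H\<^esub> b \<and>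
        inv_into (carrier (drinfeld_double K H \<phi>)) \<Phi> (pure_tensor K H H a b) =
          sweedler K H (tensor_module K H H) a (\<lambda>a1 a2.
            sweedler K H (tensor_module K H H) b (\<lambda>b1 b2.
              \<phi> a1 (antipode_inv H b2) \<odot>\<^bsub>tensor_module K H H\<^esub> pure_tensor K H H a2 b1)))"
proof -
  interpret bijective_hopf_pairing K H \<phi>
    using assms
    by (intro bijective_hopf_pairing.intro bijective_hopf_algebra.intro
        bijective_hopf_algebra_axioms.intro)
  have "inv_into (carrier D) Phi (a \<boxtimes> b) = Psi (a \<boxtimes> b)"
    if "a \<in> carrier H" "b \<in> carrier H" for a b
    using that Phi_bij by (intro inv_into_f_eq) (auto simp: bij_betw_def)
  then show ?thesis
    using hopf_algebra_D hopf_algebra_Q Phi_hopf_iso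
    by (auto intro!: bexI[of _ Phi] simp: star_embeddings Psi_pure_sweedler)
qed

end
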